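(* For any $\varepsilon>0$ there is an algorithm that, given an $m\times n$ grid graph $M$ with $N=mn$ nodes and positive integer node weights, computes in $O((1+\frac{1}{\varepsilon})mN^2 8^m)$ time a connected bipartition $(U,V\setminus U)$ with $\mathrm{OPT}\leq (1+\varepsilon)\min\{w(U),w(V\setminus U)\}$, where $\mathrm{OPT}$ is the maximum of $\min\{w(U'),w(V\setminus U')\}$ over all connected bipartitions of $M$. In particular, for a fixed number of rows $m$ this is a fully polynomial time approximation scheme.
   Context: An $m\times n$ grid graph has node set $V=\{M_{ij}: 1\leq i\leq m,\ 1\leq j\leq n\}$, with an edge between two nodes consecutive in the same row or the same column. For $S\subseteq V$, $w(S)=\sum_{v\in S}w(v)$. A connected bipartition is a partition $(U,V\setminus U)$ of $V$ into two nonempty sets such that both $M[U]$ and $M[V\setminus U]$ are connected. *)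

theory Defs
  imports
    Complex_Main
    "HOL-Library.Log_Nat"
    "Graph_Theory.Graph_Theory"
begin

section \<open>Grid graphs and balanced connected bipartitions\<close>

definition grid_nodes :: "nat \<Rightarrow> nat \<Rightarrow> (nat \<times> nat) set" where
  "grid_nodes m n = {1..m} \<times> {1..n}"

definition consecutive :: "nat \<Rightarrow> nat \<Rightarrow> bool" where
  "consecutive a b \<longleftrightarrow> b = Suc a \<or> a = Suc b"

text \<open>An undirected edge is represented by the two opposite arcs.\<close>

definition grid_graph :: "nat \<Rightarrow> nat \<Rightarrow> (nat \<times> nat) pair_pre_digraph" where
  "grid_graph m n = \<lparr> pverts = grid_nodes m n,
     parcs = {((i, j), (i', j')) | i j i' j'.
       (i, j) \<in> grid_nodes m n \<and> (i', j') \<in> grid_nodes m n \<and>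
       (i = i' \<and> consecutive j j' \<or> j = j' \<and> consecutive i i')} \<rparr>"

definition connected_bipartition :: "nat \<Rightarrow> nat \<Rightarrow> (nat \<times> nat) set \<Rightarrow> bool" where
  "connected_bipartition m n U \<longleftrightarrow>
     U \<subseteq> grid_nodes m n \<and> U \<noteq> {} \<and> grid_nodes m n - U \<noteq> {} \<and>
     Digraph_Component.connected (with_proj (grid_graph m n) \<restriction> U) \<and>
     Digraph_Component.connected (with_proj (grid_graph m n) \<restriction> (grid_nodes m n - U))"

definition bipartition_value ::
    "nat \<Rightarrow> nat \<Rightarrow> (nat \<times> nat \<Rightarrow> nat) \<Rightarrow> (nat \<times> nat) set \<Rightarrow> nat" where
  "bipartition_value m n w U = min (sum w U) (sum w (grid_nodes m n - U))"

definition OPT :: "nat \<Rightarrow> nat \<Rightarrow> (nat \<times> nat \<Rightarrow> nat) \<Rightarrow> nat" where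
  "OPT m n w = Max {bipartition_value m n w U | U. connected_bipartition m n U}"

text \<open>
  The one-node grid is excluded because it has no connected bipartition, so that the maximum
  would range over the empty set.
\<close>

definition grid_instance :: "nat \<Rightarrow> nat \<Rightarrow> (nat \<times> nat \<Rightarrow> nat) \<Rightarrow> bool" where
  "grid_instance m n w \<longleftrightarrow> m \<ge> 1 \<and> n \<ge> 1 \<and> m * n \<ge> 2 \<and> (\<forall>v \<in> grid_nodes m n. w v > 0)"


section \<open>Random access programs with unit-cost steps\<close>

text \<open>
  Algorithms are programs of a fixed imperative language over natural-number registers and
  natural-number arrays. A program is a finite object mentioning finitely many registers and
  arrays, so it is a structured form of a random access machine with indirect addressing.
  Arithmetic consists of addition and truncated subtraction only. A step then lengthens the
  largest number in memory by at most a constant number of bits, so the unit-cost measure is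
  polynomially related to bit complexity, which would fail with unit-cost multiplication.
\<close>

type_synonym vname = string

record state =
  reg :: "vname \<Rightarrow> nat"
  arr :: "vname \<Rightarrow> nat \<Rightarrow> nat"

datatype aexp =
    Const nat
  | Reg vname
  | Fetch vname aexp
  | Plus aexp aexp
  | Minus aexp aexp

datatype bexp =
    Less aexp aexp
  | Equal aexp aexp
  | Not bexp
  | And bexp bexp

datatype com =
    Skip
  | Assign vname aexp
  | Store vname aexp aexp
  | Seq com com
  | If bexp com com
  | While bexp com

primrec aval :: "aexp \<Rightarrow> state \<Rightarrow> nat" where
  "aval (Const c) s = c"
| "aval (Reg x) s = reg s x"
| "aval (Fetch a e) s = arr s a (aval e s)"
| "aval (Plus e1 e2) s = aval e1 s + aval e2 s"
| "aval (Minus e1 e2) s = aval e1 s - aval e2 s"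

primrec bval :: "bexp \<Rightarrow> state \<Rightarrow> bool" where
  "bval (Less e1 e2) s \<longleftrightarrow> aval e1 s < aval e2 s"
| "bval (Equal e1 e2) s \<longleftrightarrow> aval e1 s = aval e2 s"
| "bval (Not b) s \<longleftrightarrow> \<not> bval b s"
| "bval (And b1 b2) s \<longleftrightarrow> bval b1 s \<and> bval b2 s"

primrec acost :: "aexp \<Rightarrow> nat" where
  "acost (Const c) = 1"
| "acost (Reg x) = 1"
| "acost (Fetch a e) = 1 + acost e"
| "acost (Plus e1 e2) = 1 + acost e1 + acost e2"
| "acost (Minus e1 e2) = 1 + acost e1 + acost e2"

primrec bcost :: "bexp \<Rightarrow> nat" where
  "bcost (Less e1 e2) = 1 + acost e1 + acost e2"
| "bcost (Equal e1 e2) = 1 + acost e1 + acost e2"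
| "bcost (Not b) = 1 + bcost b"
| "bcost (And b1 b2) = 1 + bcost b1 + bcost b2"

text \<open>\<open>exec P s t s'\<close>: started in \<open>s\<close>, program \<open>P\<close> halts in \<open>s'\<close> after exactly \<open>t\<close> steps.\<close>

inductive exec :: "com \<Rightarrow> state \<Rightarrow> nat \<Rightarrow> state \<Rightarrow> bool" where
  Skip: "exec Skip s 1 s"
| Assign: "exec (Assign x e) s (1 + acost e) (s\<lparr>reg := (reg s)(x := aval e s)\<rparr>)"
| Store: "exec (Store a e1 e2) s (1 + acost e1 + acost e2)
    (s\<lparr>arr := (arr s)(a := (arr s a)(aval e1 s := aval e2 s))\<rparr>)"
| Seq: "exec c1 s1 t1 s2 \<Longrightarrow> exec c2 s2 t2 s3 \<Longrightarrow> exec (Seq c1 c2) s1 (t1 + t2) s3"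
| IfTrue: "bval b s \<Longrightarrow> exec c1 s t s' \<Longrightarrow> exec (If b c1 c2) s (1 + bcost b + t) s'"
| IfFalse: "\<not> bval b s \<Longrightarrow> exec c2 s t s' \<Longrightarrow> exec (If b c1 c2) s (1 + bcost b + t) s'"
| WhileFalse: "\<not> bval b s \<Longrightarrow> exec (While b c) s (1 + bcost b) s"
| WhileTrue: "bval b s1 \<Longrightarrow> exec c s1 t1 s2 \<Longrightarrow> exec (While b c) s2 t2 s3 \<Longrightarrow>
    exec (While b c) s1 (1 + bcost b + t1 + t2) s3"

inductive_cases exec_SkipE: "exec Skip s t s'"
inductive_cases exec_AssignE: "exec (Assign x e) s t s'"
inductive_cases exec_StoreE: "exec (Store a e1 e2) s t s'"
inductive_cases exec_SeqE: "exec (Seq c1 c2) s t s'"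
inductive_cases exec_IfE: "exec (If b c1 c2) s t s'"
inductive_cases exec_WhileE: "exec (While b c) s t s'"

text \<open>Execution is deterministic, so result and running time are functions of the input.\<close>

lemma exec_deterministic:
  "exec c s t s' \<Longrightarrow> exec c s u s'' \<Longrightarrow> u = t \<and> s'' = s'"
proof (induction arbitrary: u s'' rule: exec.induct)
  case (Skip s)
  then show ?case by (rule exec_SkipE) simp
next
  case (Assign x e s)
  then show ?case by (rule exec_AssignE) simp
next
  case (Store a e1 e2 s)
  then show ?case by (rule exec_StoreE) simp
next
  case (Seq c1 s1 t1 s2 c2 t2 s3)
  from Seq.prems show ?case
  proof (rule exec_SeqE)
    fix r1 r r2 assume u: "u = r1 + r2" and c1: "exec c1 s1 r1 r" and c2: "exec c2 r r2 s''"
    have 1: "r1 = t1 \<and> r = s2" by (rule Seq.IH(1)[OF c1])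
    with c2 have "exec c2 s2 r2 s''" by simp
    then have "r2 = t2 \<and> s'' = s3" by (rule Seq.IH(2))
    with 1 u show ?case by simp
  qed
next
  case (IfTrue b s c1 t s' c2)
  from IfTrue.prems show ?case
  proof (rule exec_IfE)
    fix r assume u: "u = Suc (bcost b + r)" and c: "exec c1 s r s''"
    have "r = t \<and> s'' = s'" by (rule IfTrue.IH[OF c])
    with u show ?case by simp
  next
    assume "\<not> bval b s"
    with IfTrue.hyps(1) show ?case by contradiction
  qed
next
  case (IfFalse b s c2 t s' c1)
  from IfFalse.prems show ?case
  proof (rule exec_IfE)
    fix r assume u: "u = Suc (bcost b + r)" and c: "exec c2 s r s''"
    have "r = t \<and> s'' = s'" by (rule IfFalse.IH[OF c])
    with u show ?case by simp
  next
    assume "bval b s"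
    with IfFalse.hyps(1) show ?case by contradiction
  qed
next
  case (WhileFalse b s c)
  from WhileFalse.prems show ?case
  proof (rule exec_WhileE)
    assume "u = Suc (bcost b)" "s'' = s"
    then show ?case by simp
  next
    assume "bval b s"
    with WhileFalse.hyps(1) show ?case by contradiction
  qed
next
  case (WhileTrue b s1 c t1 s2 t2 s3)
  from WhileTrue.prems show ?case
  proof (rule exec_WhileE)
    assume "\<not> bval b s1"
    with WhileTrue.hyps(1) show ?case by contradiction
  next
    fix r1 r r2 assume u: "u = Suc (bcost b + r1 + r2)"
      and c: "exec c s1 r1 r" and w: "exec (While b c) r r2 s''"
    have 1: "r1 = t1 \<and> r = s2" by (rule WhileTrue.IH(1)[OF c])
    with w have "exec (While b c) s2 r2 s''" by simp
    then have "r2 = t2 \<and> s'' = s3" by (rule WhileTrue.IH(2))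
    with 1 u show ?case by simp
  qed
qed


section \<open>Algorithms for the balanced connected bipartition problem on grids\<close>

text \<open>
  The weights are stored row by row in the array \<open>w\<close> from index 0 on: node \<open>(i, j)\<close> has index
  \<open>(i - 1) * n + (j - 1)\<close>. The result \<open>U\<close> is returned as its indicator array, in the same order.
  All other memory is initially zero.
\<close>

definition grid_input :: "nat \<Rightarrow> nat \<Rightarrow> (nat \<times> nat \<Rightarrow> nat) \<Rightarrow> state" where
  "grid_input m n w = \<lparr>
     reg = (\<lambda>_. 0)(''m'' := m, ''n'' := n),
     arr = (\<lambda>_ _. 0)(''w'' := (\<lambda>k. if k < m * n then w (k div n + 1, k mod n + 1) else 0)) \<rparr>"

text \<open>Input of an approximation scheme: the accuracy \<open>p / q\<close> is part of the input.\<close>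

definition scheme_input ::
    "nat \<Rightarrow> nat \<Rightarrow> nat \<Rightarrow> nat \<Rightarrow> (nat \<times> nat \<Rightarrow> nat) \<Rightarrow> state" where
  "scheme_input p q m n w =
     (let s = grid_input m n w in s\<lparr>reg := (reg s)(''p'' := p, ''q'' := q)\<rparr>)"

definition output_set :: "nat \<Rightarrow> nat \<Rightarrow> state \<Rightarrow> (nat \<times> nat) set" where
  "output_set m n s =
     {(i, j). (i, j) \<in> grid_nodes m n \<and> arr s ''U'' ((i - 1) * n + (j - 1)) \<noteq> 0}"

definition computes_approx ::
    "com \<Rightarrow> state \<Rightarrow> nat \<Rightarrow> nat \<Rightarrow> (nat \<times> nat \<Rightarrow> nat) \<Rightarrow> real \<Rightarrow> real \<Rightarrow> bool" where
  "computes_approx P s m n w \<epsilon> T \<longleftrightarrow>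
     (\<exists>t s'. exec P s t s' \<and> real t \<le> T \<and>
        connected_bipartition m n (output_set m n s') \<and>
        real (OPT m n w) \<le> (1 + \<epsilon>) * real (bipartition_value m n w (output_set m n s')))"

text \<open>Number of bits of the instance, all numbers being written in binary.\<close>

definition instance_size :: "nat \<Rightarrow> nat \<Rightarrow> (nat \<times> nat \<Rightarrow> nat) \<Rightarrow> nat" where
  "instance_size m n w =
     floorlog 2 m + floorlog 2 n + (\<Sum>v \<in> grid_nodes m n. floorlog 2 (w v))"

text \<open>
  A fully polynomial time approximation scheme for grids with \<open>m\<close> rows. Every polynomial in the
  instance size and \<open>1 / \<epsilon>\<close> is dominated by one of the form \<open>a * (size + 1 / \<epsilon>) ^ d\<close>, since the
  size is at least 1.
\<close>

definition fptas :: "nat \<Rightarrow> com \<Rightarrow> bool" where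
  "fptas m A \<longleftrightarrow>
     (\<exists>(a :: real) (d :: nat). \<forall>n w p q. grid_instance m n w \<longrightarrow> p > 0 \<longrightarrow> q > 0 \<longrightarrow>
        (let \<epsilon> = real p / real q in
         computes_approx A (scheme_input p q m n w) m n w \<epsilon>
           (a * (real (instance_size m n w) + 1 / \<epsilon>) ^ d)))"

end

theory Submission
  imports Defs
begin

text \<open>
  Number the cells column by column, so that cell \<open>l\<close> has the earlier neighbours \<open>l - m\<close> and, unless
  \<open>m\<close> divides \<open>l\<close>, \<open>l - 1\<close>. A two-colouring read in this order is a connected bipartition iff each
  colour ends up with exactly one component. A finite automaton decides this: it remembers the last
  \<open>m\<close> cells, the partition of these cells into components of the coloured prefix, and for each colour
  whether zero, one or more components have already left the window. The partition is noncrossing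
  in the window order, so it is determined by two bits per cell, namely whether its block has an earlier and whether
  it has a later member in the window. Hence \<open>16 * 8 ^ m\<close> states suffice.

  Let \<open>B\<close> be the total weight minus the largest weight. Any connected bipartition has a side without
  the heaviest cell, so \<open>OPT \<le> B\<close>; the prefixes of the column order are connected
  bipartitions, and one of them shows \<open>B \<le> 2 * OPT\<close>. With \<open>r\<close> the least integer
  at least \<open>1 / \<epsilon>\<close> and \<open>K = 2 * N * (1 + r)\<close>, weights are rounded down to multiples of \<open>B / K\<close>.
  Two sides with equal rounded weight differ in weight by at most \<open>N * B / K \<le> OPT / (1 + r)\<close>, so for the rounded
  weight of the lighter side of an optimum every connected bipartition attaining it is
  good enough. The program tabulates, from the last cell backwards, which (state, rounded weight) pairs
  can be completed, and then follows the automaton forwards once for each attainable rounded weight,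
  keeping the bipartition of largest true value.
\<close>

section \<open>Components of coloured prefixes\<close>

text \<open>Planarity is what makes the state small: arbitrary partitions of \<open>m\<close> cells
  are superexponentially many. The index of the next cell and the fill level of the window are
  functions of \<open>l\<close>, so they stay outside the state. The unit of rounding is tied to
  \<open>B\<close> and not to the total weight, because one huge cell can make the optimum tiny
  compared with the total, whereas the error must be a fraction of the optimum. The factor
  \<open>m\<close> in the running time pays for the transitions: one costs a constant times
  \<open>m * m\<close>, but it is computed once per layer, state and colour and then serves all
  \<open>K + 1\<close> rounded weights. As \<open>m \<le> N\<close> and \<open>N \<le> K\<close>,
  the square is dominated by \<open>m\<close> times the number of rounded weights. Most codes below
  \<open>16 * 8 ^ m\<close> encode no partition. They are tabulated like the others, so the program
  has to agree with \<open>delta\<close> on junk as well. That a positive table entry at the initial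
  state really has a completion is shown by the forward walk, which constructs it.\<close>

text \<open>
  Quick-find: cell \<open>l\<close> takes over the label of \<open>p\<close> if \<open>P\<close> holds and a fresh label otherwise; if \<open>Q\<close>
  holds, the class of \<open>q\<close> is then merged into its class.
\<close>

definition newlab :: "bool \<Rightarrow> bool \<Rightarrow> nat \<Rightarrow> nat \<Rightarrow> nat \<Rightarrow> (nat \<Rightarrow> nat) \<Rightarrow> nat \<Rightarrow> nat" where
  "newlab P Q p q l d a =
     (let e = if P then d p else l; v = if a = l then e else d a
      in if Q \<and> v = d q then e else v)"

primrec lab :: "nat \<Rightarrow> (nat \<Rightarrow> bool) \<Rightarrow> nat \<Rightarrow> nat \<Rightarrow> nat" where
  "lab m c 0 = id"
| "lab m c (Suc l) = newlab (m \<le> l \<and> c (l - m) = c l) (\<not> m dvd l \<and> c (l - 1) = c l)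
     (l - m) (l - 1) l (lab m c l)"

text \<open>The divisibility conditions cut the step from the last cell of a column to the first
  cell of the next one.\<close>

definition cell_edges :: "nat \<Rightarrow> (nat \<Rightarrow> bool) \<Rightarrow> nat \<Rightarrow> (nat \<times> nat) set" where
  "cell_edges m c l = {(a, b). a < l \<and> b < l \<and> c a = c b \<and>
     (b = a + m \<or> a = b + m \<or> b = Suc a \<and> \<not> m dvd b \<or> a = Suc b \<and> \<not> m dvd a)}"

text \<open>This bound makes \<open>l\<close> a label that no earlier cell carries, so that
  \<open>newlab\<close> really opens a new class when \<open>P\<close> fails.\<close>

lemma lab_less: "0 < m \<Longrightarrow> a < l \<Longrightarrow> lab m c l a < l"
proof (induction l arbitrary: a)
  case (Suc l)
  have *: "b < l \<Longrightarrow> lab m c l b < Suc l" for b using Suc.IH[of b] Suc.prems by simp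
  show ?case using Suc.prems * by (cases "a = l") (auto simp: newlab_def Let_def)
qed simp

lemma lab_eq_mono: "lab m c l a = lab m c l b \<Longrightarrow> a < l \<Longrightarrow> b < l \<Longrightarrow> lab m c (Suc l) a = lab m c (Suc l) b"
  by (auto simp: newlab_def Let_def)

lemma lab_edge:
  assumes m: "0 < m" shows "(a, b) \<in> cell_edges m c l \<Longrightarrow> lab m c l a = lab m c l b"
proof (induction l arbitrary: a b)
  case (Suc l)
  have dir: "lab m c (Suc l) a = lab m c (Suc l) b"
    if "a < Suc l" "b < Suc l" "c a = c b" "b = a + m \<or> b = Suc a \<and> \<not> m dvd b" for a b
  proof (cases "b = l")
    case True
    show ?thesis using that(4)
    proof
      assume "b = a + m"
      then have "a < l" "l - m = a" "m \<le> l" using m True by auto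
      then show ?thesis using that True by (auto simp: newlab_def Let_def)
    next
      assume "b = Suc a \<and> \<not> m dvd b"
      then have "a < l" "l - 1 = a" "\<not> m dvd l" using True by auto
      then show ?thesis using that True by (auto simp: newlab_def Let_def)
    qed
  next
    case False
    then have l: "a < l" "b < l" using that by auto
    have "(a, b) \<in> cell_edges m c l" using that l by (auto simp: cell_edges_def)
    then show ?thesis using lab_eq_mono[OF Suc.IH l] by simp
  qed
  have "a < Suc l" "b < Suc l" "c a = c b"
    "(b = a + m \<or> b = Suc a \<and> \<not> m dvd b) \<or> (a = b + m \<or> a = Suc b \<and> \<not> m dvd a)"
    using Suc.prems unfolding cell_edges_def by blast+
  then show ?case using dir[of a b] dir[of b a] by metis
qed (simp add: cell_edges_def)

lemma cell_edges_mono: "cell_edges m c l \<subseteq> cell_edges m c (Suc l)"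
  by (auto simp: cell_edges_def)

lemma sym_cell_edges: "sym (cell_edges m c l)"
  unfolding sym_def cell_edges_def by blast

text \<open>Every equality created at step \<open>l\<close> involves a class just attached to cell
  \<open>l\<close>: that of \<open>l - m\<close> through \<open>e\<close>, or that of
  \<open>l - 1\<close> through the merge. Both neighbours have an edge to \<open>l\<close>, so all
  new paths can be routed through \<open>l\<close>.\<close>

lemma lab_eq_imp_conn:
  assumes m: "0 < m"
  shows "a < l \<Longrightarrow> b < l \<Longrightarrow> lab m c l a = lab m c l b \<Longrightarrow> (a, b) \<in> (cell_edges m c l)\<^sup>*"
proof (induction l arbitrary: a b)
  case (Suc l)
  let ?R = "(cell_edges m c (Suc l))\<^sup>*"
  let ?D = "lab m c l"
  have sy: "(y, x) \<in> ?R" if "(x, y) \<in> ?R" for x y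
    using that sym_rtrancl[OF sym_cell_edges] by (meson symD)
  have tr: "(x, z) \<in> ?R" if "(x, y) \<in> ?R" "(y, z) \<in> ?R" for x y z
    using that by (rule rtrancl_trans)
  have old: "(x, y) \<in> ?R" if "x < l" "y < l" "?D x = ?D y" for x y
    using Suc.IH[OF that] rtrancl_mono[OF cell_edges_mono] by blast
  define P where "P \<longleftrightarrow> m \<le> l \<and> c (l - m) = c l"
  define Q where "Q \<longleftrightarrow> \<not> m dvd l \<and> c (l - 1) = c l"
  have eP: "(l - m, l) \<in> ?R" "l - m < l" if P
    using that m by (auto simp: P_def cell_edges_def intro!: r_into_rtrancl)
  have l0: "l \<noteq> 0" if Q using that by (metis Q_def dvd_0_right)
  have eQ: "(l - 1, l) \<in> ?R" "l - 1 < l" if Q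
    using that l0 by (auto simp: Q_def cell_edges_def intro!: r_into_rtrancl)
  define e where "e = (if P then ?D (l - m) else l)"
  \<comment> \<open>The labelling after the link to \<open>l - m\<close> and before the merge with
    the class of \<open>l - 1\<close>.\<close>
  define v where "v x = (if x = l then e else ?D x)" for x
  have lab': "lab m c (Suc l) x = (if Q \<and> v x = ?D (l - 1) then e else v x)" for x
    by (simp add: newlab_def Let_def e_def v_def P_def Q_def)
  have ve: "(x, l) \<in> ?R" if "x < Suc l" "v x = e" for x
  proof (cases "x = l")
    case False
    then have "x < l" "?D x = e" using that by (auto simp: v_def)
    moreover have "?D x \<noteq> l" using lab_less[OF m, of x l c] \<open>x < l\<close> by simp
    ultimately have "P" "?D x = ?D (l - m)" by (auto simp: e_def split: if_splits)
    then show ?thesis using old[OF \<open>x < l\<close> eP(2)] eP(1) tr by blast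
  qed simp
  have vq: "(x, l) \<in> ?R" if "x < Suc l" "Q" "v x = ?D (l - 1)" for x
  proof (cases "x = l")
    case False
    then show ?thesis using that old[of x "l - 1"] eQ tr by (auto simp: v_def)
  qed simp
  have vv: "(x, y) \<in> ?R" if "x < Suc l" "y < Suc l" "v x = v y" for x y
  proof (cases "x = l \<or> y = l")
    case True
    then show ?thesis using ve[of x] ve[of y] that sy by (auto simp: v_def)
  next
    case False
    then show ?thesis using old that by (auto simp: v_def)
  qed
  show ?case
    using Suc.prems vv[of a b] ve[of a] ve[of b] vq[of a] vq[of b] sy tr unfolding lab' by metis
qed simp

lemma lab_eq_iff_conn:
  assumes m: "0 < m" and "a < l" "b < l"
  shows "lab m c l a = lab m c l b \<longleftrightarrow> (a, b) \<in> (cell_edges m c l)\<^sup>*"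
proof
  assume "(a, b) \<in> (cell_edges m c l)\<^sup>*"
  then show "lab m c l a = lab m c l b"
    by (induction) (auto dest: lab_edge[OF m])
qed (use lab_eq_imp_conn[OF m] assms in blast)

lemma lab_eq_col:
  assumes m: "0 < m" and "a < l" "b < l" "lab m c l a = lab m c l b"
  shows "c a = c b"
proof -
  have "(a, b) \<in> (cell_edges m c l)\<^sup>*" using assms lab_eq_iff_conn by blast
  then show ?thesis by induction (auto simp: cell_edges_def)
qed

section \<open>The window automaton\<close>

definition noncrossing :: "(nat \<Rightarrow> nat) \<Rightarrow> nat \<Rightarrow> nat \<Rightarrow> bool" where
  "noncrossing f s l \<longleftrightarrow> (\<forall>x y z w. s \<le> x \<longrightarrow> x < y \<longrightarrow> y < z \<longrightarrow> z < w \<longrightarrow> w < l \<longrightarrow>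
     f x = f z \<longrightarrow> f y = f w \<longrightarrow> f x = f y)"

text \<open>
  The new cell is appended at the end of the window and can only be joined to the first and the
  last window cell, which are neighbours in the cyclic order.
\<close>

lemma noncrossing_newlab:
  assumes nc: "noncrossing d s l" and "s \<le> l" and less: "\<And>a. a < l \<Longrightarrow> d a < l"
    and P: "P \<Longrightarrow> s < l" and Q: "Q \<Longrightarrow> s < l"
  shows "noncrossing (newlab P Q s (l - 1) l d) s (Suc l)"
proof -
  have nc': "d x = d y" if "s \<le> x" "x < y" "y < z" "z < w" "w < l" "d x = d z" "d y = d w" for x y z w
    using nc that unfolding noncrossing_def by blast
  define e where "e = (if P then d s else l)"
  define v where "v x = (if x = l then e else d x)" for x
  have ne: "d a \<noteq> l" if "a < l" for a using less[OF that] by simp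
  \<comment> \<open>First link only. A crossing that ends at \<open>l\<close> forces
    \<open>P\<close>, and then \<open>s\<close> lies in the class of \<open>l\<close>; replacing
    \<open>l\<close> by \<open>s\<close> gives a crossing in the old labelling that starts at
    \<open>s\<close>.\<close>
  have ncv: "v x = v y"
    if h: "s \<le> x" "x < y" "y < z" "z < w" "w < Suc l" "v x = v z" "v y = v w" for x y z w
  proof (cases "w = l")
    case False
    then show ?thesis using h nc'[of x y z w] by (auto simp: v_def)
  next
    case True
    then have yl: "d y = e" "y < l" "d x = d z" using h by (auto simp: v_def)
    then have P "d y = d s" using ne by (auto simp: e_def split: if_splits)
    then have "x = s \<or> s < x" using h(1) by auto
    then have "d x = d y"
    proof
      assume "s < x"
      then have "d s = d x"
        using nc'[of s x y z] h yl \<open>d y = d s\<close> True by simp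
      then show ?thesis using \<open>d y = d s\<close> by simp
    qed (use \<open>d y = d s\<close> in simp)
    then show ?thesis using h True by (auto simp: v_def)
  qed
  show ?thesis
  proof (cases Q)
    case False
    then have "newlab P Q s (l - 1) l d = v" by (auto simp: newlab_def Let_def v_def e_def fun_eq_iff)
    then show ?thesis using ncv unfolding noncrossing_def by metis
  next
    case True
    then have sl: "s < l" using Q by blast
    define q where "q = l - 1"
    have q: "s \<le> q" "q < l" "Suc q = l" using sl by (auto simp: q_def)
    define g where "g x = (if v x = d q then e else v x)" for x
    have g: "newlab P Q s (l - 1) l d = g"
      using True by (auto simp: newlab_def Let_def v_def e_def g_def q_def fun_eq_iff)
    have vq: "v q = d q" and vl: "v l = e" using q by (auto simp: v_def)
    have vs: "P \<Longrightarrow> v s = e" using sl by (auto simp: v_def e_def)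
    have last: "x = l" if "v x = e" "\<not> P" "x < Suc l" for x
      using that ne[of x] by (auto simp: v_def e_def split: if_splits)
    have geq: "g x = g y \<longleftrightarrow> v x = v y \<or> (v x \<in> {e, d q} \<and> v y \<in> {e, d q})" for x y
      unfolding g_def by auto
    have key: "g x = g y"
      if h: "s \<le> x" "x < y" "y < z" "z < w" "w < Suc l" and xz: "g x = g z" and yw: "g y = g w" for x y z w
    proof (rule ccontr)
      assume n: "g x \<noteq> g y"
      let ?M = "{e, d q}"
      \<comment> \<open>A crossing that is new in \<open>g\<close> has one pair joined only by the
        merge of \<open>e\<close> with the class of \<open>q\<close>. The other pair avoids both
        classes, so the window ends, \<open>q\<close> and under \<open>P\<close> also
        \<open>s\<close>, are not among its members and can serve as the missing partner of a
        crossing in \<open>v\<close>.\<close>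
      consider "v x = v z" "v y = v w" | "v x \<in> ?M" "v z \<in> ?M" "v x \<noteq> v z" "v y = v w" "v y \<notin> ?M"
        | "v y \<in> ?M" "v w \<in> ?M" "v y \<noteq> v w" "v x = v z" "v x \<notin> ?M"
        using xz yw n unfolding geq by blast
      then show False
      proof cases
        case 1
        then show False using ncv[OF h] n geq by blast
      next
        case 2
        have wq: "w < q" 
        proof -
          have "w \<noteq> q" "w \<noteq> l" using 2 vq vl by auto
          then show ?thesis using h q by linarith
        qed
        have P
          using last[of x] last[of z] 2 h by auto
        have sx: "x \<noteq> s \<Longrightarrow> s < x" using h by simp
        from 2 have "v x = e \<and> v z = d q \<or> v x = d q \<and> v z = e" by auto
        then show False
        proof
          assume "v x = e \<and> v z = d q"
          then have "v y = v z" using ncv[of y z w q] h wq q vq 2 by auto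
          then show False using 2 by auto
        next
          assume a: "v x = d q \<and> v z = e"
          then have "x \<noteq> s" using 2 vs \<open>P\<close> by auto
          have "v y = v z" using ncv[of y z w q] ncv[of s y z w] h wq q vq vs \<open>P\<close> a 2 by auto
          then show False using 2 by auto
        qed
      next
        case 3
        show False
        proof (cases P)
          case True
          then have xs: "s < x" 
          proof -
            have "s \<noteq> x" using 3 vs True by auto
            then show ?thesis using h by linarith
          qed
          have zl: "z < q" 
          proof -
            have "z \<noteq> q" using 3 vq by auto
            then show ?thesis using h q by linarith
          qed
          from 3 have "v y = e \<or> v y = d q" by auto
          then show False
          proof
            assume "v y = e"
            then show False using ncv[of s x y z] xs h vs True 3 by auto
          next
            assume "v y = d q"
            then have "v x = v y" using ncv[of x y z q] h zl q vq 3 by auto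
            then show False using 3 by auto
          qed
        next
          case False
          then have "v y \<noteq> e" using last[of y] h by auto
          then have yq: "v y = d q" using 3 by auto
          have zl: "z < q" 
          proof -
            have "z \<noteq> q" using 3 vq by auto
            then show ?thesis using h q by linarith
          qed
          then have "v x = v y" using ncv[of x y z q] h zl q vq 3 yq by auto
          then show False using 3 by auto
        qed
      qed
    qed
    then show ?thesis unfolding g noncrossing_def by blast
  qed
qed

lemma noncrossing_lab:
  assumes m: "0 < m" shows "noncrossing (lab m c l) (l - m) l"
proof (induction l)
  case (Suc l)
  let ?P = "m \<le> l \<and> c (l - m) = c l" and ?Q = "\<not> m dvd l \<and> c (l - 1) = c l"
  have "l \<noteq> 0" if ?Q using that by (metis dvd_0_right)
  \<comment> \<open>The new cell is linked while \<open>l - m\<close> still belongs to the window;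
    the restriction to the later start comes afterwards.\<close>
  then have "noncrossing (lab m c (Suc l)) (l - m) (Suc l)"
    using noncrossing_newlab[of "lab m c l" "l - m" l ?P ?Q] Suc lab_less[OF m] m by auto
  then show ?case unfolding noncrossing_def
    by (meson diff_le_mono le_SucI le_trans order_refl)
qed (simp add: noncrossing_def)

section \<open>Block labels from two bits per cell\<close>

primrec last_open :: "(nat \<Rightarrow> bool) \<Rightarrow> nat \<Rightarrow> nat" where
  "last_open f 0 = 0"
| "last_open f (Suc j) = (if f j then j else last_open f j)"

text \<open>
  Reconstructs block labels from the two bits per cell. The first component marks the open cells, those
  whose block still has to continue; by noncrossingness a continuing cell belongs to
  the block of the last open cell. On bit patterns that encode no partition the result is junk.
\<close>

primrec decode :: "(nat \<Rightarrow> bool) \<Rightarrow> (nat \<Rightarrow> bool) \<Rightarrow> nat \<Rightarrow> (nat \<Rightarrow> bool) \<times> (nat \<Rightarrow> nat)" where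
  "decode hp hn 0 = ((\<lambda>_. False), (\<lambda>_. 0))"
| "decode hp hn (Suc k) =
     (let f = fst (decode hp hn k); d = snd (decode hp hn k); t = last_open f k
      in if hp k then (f(t := False, k := hn k), d(k := (d(k := k)) t))
         else (f(k := hn k), d(k := k)))"

lemma last_open_eq:
  "p < k \<Longrightarrow> f p \<Longrightarrow> (\<And>j. p < j \<Longrightarrow> j < k \<Longrightarrow> \<not> f j) \<Longrightarrow> last_open f k = p"
proof (induction k)
  case (Suc k)
  show ?case
  proof (cases "p = k")
    case False
    then have "p < k" "\<not> f k" using Suc.prems by auto
    then show ?thesis using Suc by auto
  qed (use Suc in auto)
qed simp

text \<open>The open cells form a stack: a continuing cell must attach to the topmost one, since an
  open cell above its true predecessor would start a crossing block. The bound
  \<open>snd (decode hp hn k) i \<le> i\<close> is carried along because it keeps decoded labels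
  below \<open>len\<close>, the fresh label of the next transition.\<close>

lemma decode_correct:
  assumes nc: "noncrossing g 0 len"
    and hp: "\<And>k. k < len \<Longrightarrow> hp k \<longleftrightarrow> (\<exists>j<k. g j = g k)"
    and hn: "\<And>k. k < len \<Longrightarrow> hn k \<longleftrightarrow> (\<exists>j. k < j \<and> j < len \<and> g j = g k)"
  shows "k \<le> len \<Longrightarrow>
    (\<forall>i<k. fst (decode hp hn k) i \<longleftrightarrow> hn i \<and> \<not> (\<exists>j. i < j \<and> j < k \<and> g j = g i)) \<and>
    (\<forall>i<k. snd (decode hp hn k) i \<le> i) \<and>
    (\<forall>i<k. \<forall>j<k. snd (decode hp hn k) i = snd (decode hp hn k) j \<longleftrightarrow> g i = g j)"
proof (induction k)
  case (Suc k)
  define f where "f = fst (decode hp hn k)"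
  define d where "d = snd (decode hp hn k)"
  have k: "k < len" using Suc.prems by simp
  have If: "\<And>i. i < k \<Longrightarrow> f i \<longleftrightarrow> hn i \<and> \<not> (\<exists>j. i < j \<and> j < k \<and> g j = g i)"
    and Id: "\<And>i. i < k \<Longrightarrow> d i \<le> i" and Ie: "\<And>i j. i < k \<Longrightarrow> j < k \<Longrightarrow> d i = d j \<longleftrightarrow> g i = g j"
    using Suc by (simp_all add: f_def d_def)
  show ?case
  proof (cases "hp k")
    case False
    then have new: "\<And>j. j < k \<Longrightarrow> g j \<noteq> g k" using hp[OF k] by auto
    have D: "decode hp hn (Suc k) = (f(k := hn k), d(k := k))"
      using False by (simp add: Let_def f_def d_def)
    have "\<And>i. i < Suc k \<Longrightarrow> (f(k := hn k)) i \<longleftrightarrow> hn i \<and> \<not> (\<exists>j. i < j \<and> j < Suc k \<and> g j = g i)"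
      using If new by (auto simp: less_Suc_eq) metis+
    moreover have "\<And>i. i < Suc k \<Longrightarrow> (d(k := k)) i \<le> i" using Id by auto
    moreover have "(d(k := k)) i = (d(k := k)) j \<longleftrightarrow> g i = g j" if "i < Suc k" "j < Suc k" for i j
      using that Id[of i] Id[of j] Ie[of i j] new[of i] new[of j] by (auto simp: less_Suc_eq)
    ultimately show ?thesis unfolding D by simp
  next
    case True
    \<comment> \<open>The immediate predecessor of \<open>k\<close> in its block, to be identified
      with the last open cell.\<close>
    define p where "p = (GREATEST j. j < k \<and> g j = g k)"
    have ex: "\<exists>j. j < k \<and> g j = g k" using hp[OF k] True by auto
    have p: "p < k" "g p = g k"
      using GreatestI_ex_nat[OF ex, of k] by (auto simp: p_def)
    have pmax: "j \<le> p" if "j < k" "g j = g k" for j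
      unfolding p_def using that by (intro Greatest_le_nat[where b = k]) auto
    have fp: "f p"
      using If[OF p(1)] hn[of p] p k pmax by (metis leD less_trans)
    \<comment> \<open>An open \<open>j\<close> between \<open>p\<close> and \<open>k\<close> has its
      next block member \<open>z\<close> after \<open>k\<close>, and \<open>p < j < k < z\<close>
      would be a crossing.\<close>
    have nf: "\<not> f j" if pj: "p < j" and jk: "j < k" for j
    proof
      assume "f j"
      then obtain z where z: "j < z" "z < len" "g z = g j" and nz: "\<not> z < k"
        using If[OF jk] hn[of j] jk k by auto
      have "g j \<noteq> g k" using pmax[of j] pj jk by auto
      then have "k < z" using z nz by (metis linorder_neqE_nat)
      then have "g p = g j" using nc pj jk z p unfolding noncrossing_def by (metis le0)
      then show False using \<open>g j \<noteq> g k\<close> p by simp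
    qed
    have lo: "last_open f k = p" using last_open_eq[OF p(1), of f] fp nf by blast
    have D: "decode hp hn (Suc k) = (f(p := False, k := hn k), d(k := d p))"
      using True lo p by (simp add: Let_def f_def[symmetric] d_def[symmetric])
    have "(f(p := False, k := hn k)) i \<longleftrightarrow> hn i \<and> \<not> (\<exists>j. i < j \<and> j < Suc k \<and> g j = g i)"
      if i: "i < Suc k" for i
    proof -
      consider "i = k" | "i = p" | "i < k" "i \<noteq> p" "g i = g k" | "i < k" "g i \<noteq> g k"
        using i p by (metis less_SucE)
      then show ?thesis
      proof cases
        case 3
        then have "i < p" using pmax[of i] by simp
        then have "\<not> f i" using If[of i] 3 p by auto
        then show ?thesis using 3 k by (auto intro!: exI[of _ k])
      next
        case 4
        then have "i \<noteq> p" using p by auto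
        then show ?thesis using 4 If[of i] by (auto simp: less_Suc_eq)
      qed (use p in auto)
    qed
    moreover have "\<And>i. i < Suc k \<Longrightarrow> (d(k := d p)) i \<le> i" using Id p
      by (auto simp: less_Suc_eq) (meson le_trans less_imp_le)
    moreover have "(d(k := d p)) i = (d(k := d p)) j \<longleftrightarrow> g i = g j" if "i < Suc k" "j < Suc k" for i j
      using that Ie[of i j] Ie[of i p] Ie[of p j] p by (auto simp: less_Suc_eq)
    ultimately show ?thesis unfolding D by simp
  qed
qed simp

text \<open>
  Layout of the \<open>3 * m + 4\<close> state bits: colours in \<open>[0, m)\<close>, ``has an earlier block member'' in \<open>[m, 2 * m)\<close>,
  ``has a later block member'' in \<open>[2 * m, 3 * m)\<close>, all indexed by window position starting from the oldest cell;
  then for each colour, first \<open>False\<close>, whether at least one and at least two of its components have left the window.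
  While \<open>l < m\<close> the window is not full and nothing is dropped.
\<close>

definition step_bits :: "nat \<Rightarrow> nat \<Rightarrow> bool \<Rightarrow> (nat \<Rightarrow> bool) \<Rightarrow> nat \<Rightarrow> bool" where
  "step_bits m l cl \<beta> t =
    (let len = min l m; full = (m \<le> l); off = (if full then 1 else 0);
       d = snd (decode (\<lambda>k. \<beta> (m + k)) (\<lambda>k. \<beta> (2 * m + k)) len);
       g = newlab (full \<and> \<beta> 0 = cl) (\<not> m dvd l \<and> \<beta> (len - 1) = cl) 0 (len - 1) len d;
       col = \<beta>(len := cl);
       drop = (full \<and> \<not> (\<exists>j. 0 < j \<and> j \<le> len \<and> g j = g 0))
     in if t < m then t + off \<le> len \<and> col (t + off)
        else if t < 2 * m then
          t - m + off \<le> len \<and> (\<exists>j. off \<le> j \<and> j < t - m + off \<and> g j = g (t - m + off))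
        else if t < 3 * m then
          t - 2 * m + off \<le> len \<and> (\<exists>j. t - 2 * m + off < j \<and> j \<le> len \<and> g j = g (t - 2 * m + off))
        else if t = 3 * m then \<beta> t \<or> drop \<and> \<not> \<beta> 0
        else if t = 3 * m + 1 then \<beta> t \<or> drop \<and> \<not> \<beta> 0 \<and> \<beta> (3 * m)
        else if t = 3 * m + 2 then \<beta> t \<or> drop \<and> \<beta> 0
        else t = 3 * m + 3 \<and> (\<beta> t \<or> drop \<and> \<beta> 0 \<and> \<beta> (3 * m + 2)))"

section \<open>Components that have left the window\<close>

definition dead :: "nat \<Rightarrow> (nat \<Rightarrow> bool) \<Rightarrow> nat \<Rightarrow> nat \<Rightarrow> bool" where
  "dead m c l a \<longleftrightarrow> a < l - m \<and> (\<forall>b. l - m \<le> b \<longrightarrow> b < l \<longrightarrow> lab m c l b \<noteq> lab m c l a)"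

definition dead1 :: "nat \<Rightarrow> (nat \<Rightarrow> bool) \<Rightarrow> nat \<Rightarrow> bool \<Rightarrow> bool" where
  "dead1 m c l col \<longleftrightarrow> (\<exists>a. dead m c l a \<and> c a = col)"

definition dead2 :: "nat \<Rightarrow> (nat \<Rightarrow> bool) \<Rightarrow> nat \<Rightarrow> bool \<Rightarrow> bool" where
  "dead2 m c l col \<longleftrightarrow> (\<exists>a b. dead m c l a \<and> dead m c l b \<and> c a = col \<and> c b = col \<and>
     lab m c l a \<noteq> lab m c l b)"

text \<open>The meaning of a state: the pattern that the automaton must carry after \<open>l\<close>
  cells, read off the true components. In contrast to this, \<open>step_bits\<close> sees only the
  previous pattern and the new colour.\<close>

definition enc_bits :: "nat \<Rightarrow> (nat \<Rightarrow> bool) \<Rightarrow> nat \<Rightarrow> nat \<Rightarrow> bool" where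
  "enc_bits m c l t =
    (let s = l - m; g = lab m c l
     in if t < m then s + t < l \<and> c (s + t)
        else if t < 2 * m then s + (t - m) < l \<and> (\<exists>j < t - m. g (s + j) = g (s + (t - m)))
        else if t < 3 * m then s + (t - 2 * m) < l \<and>
          (\<exists>j. t - 2 * m < j \<and> s + j < l \<and> g (s + j) = g (s + (t - 2 * m)))
        else if t = 3 * m then dead1 m c l False
        else if t = 3 * m + 1 then dead2 m c l False
        else if t = 3 * m + 2 then dead1 m c l True
        else t = 3 * m + 3 \<and> dead2 m c l True)"

text \<open>The automaton knows labels only up to renaming and counts positions from the start of
  the window. Since \<open>newlab\<close> uses labels only through equality tests, labellings with
  the same classes stay that way; the two bounds ensure that \<open>len\<close> and \<open>l\<close>
  are fresh on their sides.\<close>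

lemma newlab_shift:
  assumes s: "s + len = l" and d: "\<And>a. a < len \<Longrightarrow> d a < len" and D: "\<And>a. a < l \<Longrightarrow> D a < l"
    and eq: "\<And>j k. j < len \<Longrightarrow> k < len \<Longrightarrow> d j = d k \<longleftrightarrow> D (s + j) = D (s + k)"
    and P: "P \<Longrightarrow> 0 < len" and Q: "Q \<Longrightarrow> 0 < len" and j: "j \<le> len" and k: "k \<le> len"
  shows "newlab P Q 0 (len - 1) len d j = newlab P Q 0 (len - 1) len d k \<longleftrightarrow>
    newlab P Q s (l - 1) l D (s + j) = newlab P Q s (l - 1) l D (s + k)"
proof (cases "len = 0")
  case True
  then show ?thesis using P Q j k by simp
next
  case False
  define q where "q = len - 1"
  have q: "q < len" "l - 1 = s + q" using False s by (auto simp: q_def)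
  define v where "v a = (if a = len then if P then d 0 else len else d a)" for a
  define V where "V a = (if a = l then if P then D s else l else D a)" for a
  have kv: "v a = v b \<longleftrightarrow> V (s + a) = V (s + b)" if "a \<le> len" "b \<le> len" for a b
  proof -
    have 1: "d a = len \<longleftrightarrow> False" "D (s + a) = l \<longleftrightarrow> False" if "a < len" for a
      using d[OF that] D[of "s + a"] s that by auto
    have 2: "len = d a \<longleftrightarrow> False" "l = D (s + a) \<longleftrightarrow> False" if "a < len" for a
      using 1[OF that] by auto
    have 3: "s + a = l \<longleftrightarrow> a = len" for a using s by auto
    have 4: "d a = d 0 \<longleftrightarrow> D (s + a) = D s" "d 0 = d a \<longleftrightarrow> D s = D (s + a)" if "a < len" for a
      using that eq[of a 0] eq[of 0 a] by auto
    show ?thesis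
      using that d[of a] d[of b] unfolding v_def V_def 3 by (auto simp: le_less 1 2 4 eq)
  qed
  have "newlab P Q 0 (len - 1) len d a = (if Q \<and> v a = v q then v len else v a)" for a
    using q by (simp add: newlab_def Let_def v_def q_def)
  moreover have "newlab P Q s (l - 1) l D (s + a) =
      (if Q \<and> V (s + a) = V (s + q) then V (s + len) else V (s + a))" for a
    using q s by (simp add: newlab_def Let_def V_def q(2))
  ultimately show ?thesis
    using kv[of j k] kv[of j q] kv[of k q] kv[of len j] kv[of j len] kv[of len k] kv[of k len] j k q by auto
qed

text \<open>A component that has left the window never changes again.\<close>

lemma lab_Suc_dead:
  assumes m: "0 < m" and dead: "dead m c l a"
  shows "lab m c (Suc l) a = lab m c l a"
    and "b < Suc l \<Longrightarrow> lab m c (Suc l) b = lab m c (Suc l) a \<Longrightarrow> b < l \<and> lab m c l b = lab m c l a"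
proof -
  let ?D = "lab m c l"
  let ?P = "m \<le> l \<and> c (l - m) = c l" and ?Q = "\<not> m dvd l \<and> c (l - 1) = c l"
  have a: "a < l - m" and na: "\<And>b. l - m \<le> b \<Longrightarrow> b < l \<Longrightarrow> ?D b \<noteq> ?D a"
    using dead by (auto simp: dead_def)
  have al: "a < l" "a \<noteq> l" and ml: "m \<le> l" using a by auto
  have n1: "?D (l - m) \<noteq> ?D a" "?D (l - 1) \<noteq> ?D a" using na[of "l - m"] na[of "l - 1"] m ml a by auto
  have n2: "?D a \<noteq> l" using lab_less[OF m al(1), of c] by simp
  show eq: "lab m c (Suc l) a = ?D a" using n1 al by (auto simp: newlab_def Let_def)
  assume b: "b < Suc l" and "lab m c (Suc l) b = lab m c (Suc l) a"
  then have "lab m c (Suc l) b = ?D a" using eq by simp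
  then show "b < l \<and> ?D b = ?D a"
    using b n1 n2 by (cases "b = l") (auto simp: newlab_def Let_def split: if_splits)
qed

definition dropped :: "nat \<Rightarrow> (nat \<Rightarrow> bool) \<Rightarrow> nat \<Rightarrow> bool" where
  "dropped m c l \<longleftrightarrow> m \<le> l \<and>
     \<not> (\<exists>b. l - m < b \<and> b \<le> l \<and> lab m c (Suc l) b = lab m c (Suc l) (l - m))"

text \<open>A component dies as a whole, at the moment its last window cell \<open>l - m\<close>
  leaves, and a dead one can never be rejoined.\<close>

lemma dead_Suc:
  assumes m: "0 < m"
  shows "dead m c (Suc l) a \<longleftrightarrow>
    dead m c l a \<or> dropped m c l \<and> a \<le> l - m \<and> lab m c (Suc l) a = lab m c (Suc l) (l - m)"
proof (cases "m \<le> l")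
  case False
  then show ?thesis by (auto simp: dead_def dropped_def)
next
  case True
  then have s: "Suc l - m = Suc (l - m)" by simp
  show ?thesis
  proof
    assume d: "dead m c (Suc l) a"
    then have a: "a \<le> l - m"
      and na: "\<And>b. l - m < b \<Longrightarrow> b \<le> l \<Longrightarrow> lab m c (Suc l) b \<noteq> lab m c (Suc l) a"
      using s by (auto simp: dead_def)
    show "dead m c l a \<or> dropped m c l \<and> a \<le> l - m \<and> lab m c (Suc l) a = lab m c (Suc l) (l - m)"
    proof (cases "lab m c (Suc l) a = lab m c (Suc l) (l - m)")
      case t: True
      then show ?thesis using True a na unfolding dropped_def by metis
    next
      case False
      then have "a < l - m" using a by (metis le_neq_implies_less)
      moreover have "lab m c l b \<noteq> lab m c l a" if "l - m \<le> b" "b < l" for b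
      proof
        assume "lab m c l b = lab m c l a"
        then have "lab m c (Suc l) b = lab m c (Suc l) a"
          using lab_eq_mono[of m c l b a] that \<open>a < l - m\<close> by simp
        then show False using False na[of b] that by (cases "b = l - m") auto
      qed
      ultimately show ?thesis by (auto simp: dead_def)
    qed
  next
    assume "dead m c l a \<or> dropped m c l \<and> a \<le> l - m \<and> lab m c (Suc l) a = lab m c (Suc l) (l - m)"
    then show "dead m c (Suc l) a"
    proof
      assume d: "dead m c l a"
      then have "a < l - m" and na: "\<And>b. l - m \<le> b \<Longrightarrow> b < l \<Longrightarrow> lab m c l b \<noteq> lab m c l a"
        by (auto simp: dead_def)
      moreover have "lab m c (Suc l) b \<noteq> lab m c (Suc l) a" if "l - m < b" "b < Suc l" for b
        using lab_Suc_dead(2)[OF m d that(2)] na[of b] that by force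
      ultimately show ?thesis unfolding dead_def s by auto
    next
      assume "dropped m c l \<and> a \<le> l - m \<and> lab m c (Suc l) a = lab m c (Suc l) (l - m)"
      then show ?thesis unfolding dead_def s dropped_def by (auto simp: less_Suc_eq_le Suc_le_eq)
    qed
  qed
qed

lemma dead1_Suc:
  assumes m: "0 < m"
  shows "dead1 m c (Suc l) col \<longleftrightarrow> dead1 m c l col \<or> dropped m c l \<and> c (l - m) = col"
proof -
  have "c a = c (l - m)" if "a \<le> l - m" "lab m c (Suc l) a = lab m c (Suc l) (l - m)" for a
    using lab_eq_col[OF m _ _ that(2)] that(1) by simp
  then show ?thesis unfolding dead1_def dead_Suc[OF m] by blast
qed

text \<open>A component dropped now differs from all those dropped before, by
  \<open>lab_Suc_dead\<close>. So a second one appears exactly when one of this colour had already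
  left, which is why \<open>step_bits\<close> consults the old first flag.\<close>

lemma dead2_Suc:
  assumes m: "0 < m"
  shows "dead2 m c (Suc l) col \<longleftrightarrow>
    dead2 m c l col \<or> dead1 m c l col \<and> dropped m c l \<and> c (l - m) = col"
proof -
  let ?L = "lab m c (Suc l)" and ?D = "lab m c l"
  have col: "c a = c (l - m)" if "a \<le> l - m" "?L a = ?L (l - m)" for a
    using lab_eq_col[OF m _ _ that(2)] that(1) by simp
  have dd: "?L a = ?D a" if "dead m c l a" for a using lab_Suc_dead(1)[OF m that] .
  have dn: "?L a \<noteq> ?L (l - m)" if "dead m c l a" for a
    using lab_Suc_dead(2)[OF m that, of "l - m"] that m unfolding dead_def by force
  show ?thesis unfolding dead2_def dead1_def dead_Suc[OF m] 
  proof
    assume "\<exists>a b. (dead m c l a \<or> dropped m c l \<and> a \<le> l - m \<and> ?L a = ?L (l - m)) \<and>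
      (dead m c l b \<or> dropped m c l \<and> b \<le> l - m \<and> ?L b = ?L (l - m)) \<and>
      c a = col \<and> c b = col \<and> ?L a \<noteq> ?L b"
    then obtain a b where ab: "dead m c l a \<or> dropped m c l \<and> a \<le> l - m \<and> ?L a = ?L (l - m)"
      "dead m c l b \<or> dropped m c l \<and> b \<le> l - m \<and> ?L b = ?L (l - m)"
      "c a = col" "c b = col" "?L a \<noteq> ?L b" by blast
    from ab(1,2) show "(\<exists>a b. dead m c l a \<and> dead m c l b \<and> c a = col \<and> c b = col \<and> ?D a \<noteq> ?D b) \<or>
      (\<exists>a. dead m c l a \<and> c a = col) \<and> dropped m c l \<and> c (l - m) = col"
    proof (elim disjE conjE)
      assume "dead m c l a" "dead m c l b"
      then show ?thesis using dd[of a] dd[of b] ab by metis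
    next
      assume "dead m c l a" "dropped m c l" "b \<le> l - m" "?L b = ?L (l - m)"
      then show ?thesis using col[of b] ab by metis
    next
      assume "dead m c l b" "dropped m c l" "a \<le> l - m" "?L a = ?L (l - m)"
      then show ?thesis using col[of a] ab by metis
    qed (use ab in simp)
  next
    assume "(\<exists>a b. dead m c l a \<and> dead m c l b \<and> c a = col \<and> c b = col \<and> ?D a \<noteq> ?D b) \<or>
      (\<exists>a. dead m c l a \<and> c a = col) \<and> dropped m c l \<and> c (l - m) = col"
    then show "\<exists>a b. (dead m c l a \<or> dropped m c l \<and> a \<le> l - m \<and> ?L a = ?L (l - m)) \<and>
      (dead m c l b \<or> dropped m c l \<and> b \<le> l - m \<and> ?L b = ?L (l - m)) \<and>
      c a = col \<and> c b = col \<and> ?L a \<noteq> ?L b"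
    proof
      assume "\<exists>a b. dead m c l a \<and> dead m c l b \<and> c a = col \<and> c b = col \<and> ?D a \<noteq> ?D b"
      then show ?thesis using dd by metis
    next
      assume "(\<exists>a. dead m c l a \<and> c a = col) \<and> dropped m c l \<and> c (l - m) = col"
      then show ?thesis using dn order_refl by metis
    qed
  qed
qed

section \<open>Correctness of one transition\<close>

lemma step_bits_enc_bits:
  assumes m: "0 < m"
  shows "step_bits m l (c l) (enc_bits m c l) t = enc_bits m c (Suc l) t"
proof -
  define \<beta> where "\<beta> = enc_bits m c l"
  define len where "len = min l m"
  define s where "s = l - m"
  \<comment> \<open>Once the window is full, position \<open>0\<close> is discarded and every later
    position moves down by one.\<close>
  define off where "off = (if m \<le> l then 1 else 0 :: nat)"
  define D where "D = lab m c l"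
  define L where "L = lab m c (Suc l)"
  have sl: "s + len = l" "len \<le> m" by (auto simp: s_def len_def)
  have s': "Suc l - m = s + off" by (auto simp: s_def off_def)
  have b0: "\<beta> k = c (s + k)" if "k < len" for k
    using that sl by (simp add: \<beta>_def enc_bits_def Let_def s_def)
  have b1: "\<beta> (m + k) \<longleftrightarrow> (\<exists>j<k. D (s + j) = D (s + k))" if "k < len" for k
    using that sl by (simp add: \<beta>_def enc_bits_def Let_def s_def D_def)
  have b2: "\<beta> (2 * m + k) \<longleftrightarrow> (\<exists>j. k < j \<and> j < len \<and> D (s + j) = D (s + k))" if "k < len" for k
  proof -
    have "s + j < l \<longleftrightarrow> j < len" for j using sl by auto
    then show ?thesis using that sl by (simp add: \<beta>_def enc_bits_def Let_def s_def[symmetric] D_def)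
  qed
  define d where "d = snd (decode (\<lambda>k. \<beta> (m + k)) (\<lambda>k. \<beta> (2 * m + k)) len)"
  have nc: "noncrossing (\<lambda>k. D (s + k)) 0 len"
    unfolding noncrossing_def
  proof (intro allI impI)
    fix x y z w assume "x < y" "y < z" "z < w" "w < len" "D (s + x) = D (s + z)" "D (s + y) = D (s + w)"
    then show "D (s + x) = D (s + y)"
      using noncrossing_lab[OF m, of c l, folded s_def D_def, unfolded noncrossing_def,
          rule_format, of "s + x" "s + y" "s + z" "s + w"] sl by simp
  qed
  have dec: "\<And>i. i < len \<Longrightarrow> d i \<le> i"
    "\<And>i j. i < len \<Longrightarrow> j < len \<Longrightarrow> d i = d j \<longleftrightarrow> D (s + i) = D (s + j)"
    using decode_correct[OF nc, of "\<lambda>k. \<beta> (m + k)" "\<lambda>k. \<beta> (2 * m + k)" len, OF b1 b2]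
    unfolding d_def by auto
  define P where "P \<longleftrightarrow> m \<le> l \<and> c s = c l"
  define Q where "Q \<longleftrightarrow> \<not> m dvd l \<and> c (l - 1) = c l"
  have Pe: "m \<le> l \<and> \<beta> 0 = c l \<longleftrightarrow> P" using b0[of 0] m by (auto simp: P_def len_def)
  have Q0: "\<not> m dvd l \<Longrightarrow> 0 < len" using m by (cases "l = 0") (auto simp: len_def)
  have Qe: "\<not> m dvd l \<and> \<beta> (len - 1) = c l \<longleftrightarrow> Q"
  proof (cases "m dvd l")
    case False
    then have "0 < len" by (rule Q0)
    then have "s + (len - 1) = l - 1" using sl by simp
    then show ?thesis using b0[of "len - 1"] \<open>0 < len\<close> by (simp add: Q_def)
  qed (simp add: Q_def)
  define g where "g = newlab P Q 0 (len - 1) len d"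
  have L: "L = newlab P Q s (l - 1) l D" by (simp add: L_def P_def Q_def s_def D_def)
  have gL: "g j = g k \<longleftrightarrow> L (s + j) = L (s + k)" if "j \<le> len" "k \<le> len" for j k
    unfolding g_def L
  proof (rule newlab_shift[OF sl(1)])
    show "d a = d b \<longleftrightarrow> D (s + a) = D (s + b)" if "a < len" "b < len" for a b
      using that by (rule dec(2))
    show "j \<le> len" "k \<le> len" by fact+
    show "d a < len" if "a < len" for a using dec(1)[OF that] that by simp
    show "D a < l" if "a < l" for a using lab_less[OF m that] by (simp add: D_def)
    show "0 < len" if P using that m by (simp add: P_def len_def)
    show "0 < len" if Q using that Q0 by (simp add: Q_def)
  qed
  have step: "step_bits m l (c l) \<beta> t =
     (if t < m then t + off \<le> len \<and> (\<beta>(len := c l)) (t + off)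
        else if t < 2 * m then
          t - m + off \<le> len \<and> (\<exists>j. off \<le> j \<and> j < t - m + off \<and> g j = g (t - m + off))
        else if t < 3 * m then
          t - 2 * m + off \<le> len \<and> (\<exists>j. t - 2 * m + off < j \<and> j \<le> len \<and> g j = g (t - 2 * m + off))
        else if t = 3 * m then \<beta> t \<or> (m \<le> l \<and> \<not> (\<exists>j. 0 < j \<and> j \<le> len \<and> g j = g 0)) \<and> \<not> \<beta> 0
        else if t = 3 * m + 1 then \<beta> t \<or> (m \<le> l \<and> \<not> (\<exists>j. 0 < j \<and> j \<le> len \<and> g j = g 0)) \<and> \<not> \<beta> 0 \<and> \<beta> (3 * m)
        else if t = 3 * m + 2 then \<beta> t \<or> (m \<le> l \<and> \<not> (\<exists>j. 0 < j \<and> j \<le> len \<and> g j = g 0)) \<and> \<beta> 0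
        else t = 3 * m + 3 \<and> (\<beta> t \<or> (m \<le> l \<and> \<not> (\<exists>j. 0 < j \<and> j \<le> len \<and> g j = g 0)) \<and> \<beta> 0 \<and> \<beta> (3 * m + 2)))"
    unfolding step_bits_def Let_def len_def[symmetric] d_def[symmetric] Pe Qe g_def[symmetric] off_def
    by simp
  have drop: "(m \<le> l \<and> \<not> (\<exists>j. 0 < j \<and> j \<le> len \<and> g j = g 0)) \<longleftrightarrow> dropped m c l"
  proof -
    have "(\<exists>j. 0 < j \<and> j \<le> len \<and> g j = g 0) \<longleftrightarrow> (\<exists>b. s < b \<and> b \<le> l \<and> L b = L s)"
    proof
      assume "\<exists>j. 0 < j \<and> j \<le> len \<and> g j = g 0"
      then obtain j where "0 < j" "j \<le> len" "g j = g 0" by blast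
      then show "\<exists>b. s < b \<and> b \<le> l \<and> L b = L s" using gL[of j 0] sl by (intro exI[of _ "s + j"]) auto
    next
      assume "\<exists>b. s < b \<and> b \<le> l \<and> L b = L s"
      then obtain b where "s < b" "b \<le> l" "L b = L s" by blast
      then show "\<exists>j. 0 < j \<and> j \<le> len \<and> g j = g 0" using gL[of "b - s" 0] sl by (intro exI[of _ "b - s"]) auto
    qed
    then show ?thesis by (simp add: dropped_def s_def L_def)
  qed
  have bs: "\<beta> (3 * m) = dead1 m c l False" "\<beta> (3 * m + 1) = dead2 m c l False"
    "\<beta> (3 * m + 2) = dead1 m c l True" "\<beta> (3 * m + 3) = dead2 m c l True"
    by (simp_all add: \<beta>_def enc_bits_def Let_def)
  have bc: "dropped m c l \<Longrightarrow> \<beta> 0 = c (l - m)" using b0[of 0] m by (simp add: dropped_def len_def s_def)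
  have enc: "enc_bits m c (Suc l) t =
     (if t < m then s + off + t < Suc l \<and> c (s + off + t)
        else if t < 2 * m then s + off + (t - m) < Suc l \<and> (\<exists>j < t - m. L (s + off + j) = L (s + off + (t - m)))
        else if t < 3 * m then s + off + (t - 2 * m) < Suc l \<and>
          (\<exists>j. t - 2 * m < j \<and> s + off + j < Suc l \<and> L (s + off + j) = L (s + off + (t - 2 * m)))
        else if t = 3 * m then dead1 m c (Suc l) False
        else if t = 3 * m + 1 then dead2 m c (Suc l) False
        else if t = 3 * m + 2 then dead1 m c (Suc l) True
        else t = 3 * m + 3 \<and> dead2 m c (Suc l) True)"
    unfolding enc_bits_def Let_def s' L_def ..
  have in1: "s + off + k < Suc l \<longleftrightarrow> k + off \<le> len" for k using sl by auto
  consider "t < m" | "m \<le> t" "t < 2 * m" | "2 * m \<le> t" "t < 3 * m" | "3 * m \<le> t" by linarith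
  then have "step_bits m l (c l) \<beta> t = enc_bits m c (Suc l) t"
  proof cases
    case 1
    have "(\<beta>(len := c l)) (t + off) = c (s + off + t)" if "t + off \<le> len"
      using that b0[of "t + off"] sl by (cases "t + off = len") (auto simp: ac_simps)
    then show ?thesis unfolding step enc in1 using 1 by auto
  next
    case 2
    define k where "k = t - m"
    have "(\<exists>j. off \<le> j \<and> j < k + off \<and> g j = g (k + off)) \<longleftrightarrow> (\<exists>j<k. L (s + off + j) = L (s + off + k))"
      if k: "k + off \<le> len"
    proof
      assume "\<exists>j. off \<le> j \<and> j < k + off \<and> g j = g (k + off)"
      then obtain j where "off \<le> j" "j < k + off" "g j = g (k + off)" by blast
      then show "\<exists>j<k. L (s + off + j) = L (s + off + k)"
        using gL[of j "k + off"] k by (intro exI[of _ "j - off"]) (auto simp: ac_simps)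
    next
      assume "\<exists>j<k. L (s + off + j) = L (s + off + k)"
      then obtain j where "j < k" "L (s + off + j) = L (s + off + k)" by blast
      then show "\<exists>j. off \<le> j \<and> j < k + off \<and> g j = g (k + off)"
        using gL[of "j + off" "k + off"] k by (intro exI[of _ "j + off"]) (auto simp: ac_simps)
    qed
    then show ?thesis unfolding step enc in1 k_def[symmetric] using 2 by auto
  next
    case 3
    define k where "k = t - 2 * m"
    have "(\<exists>j. k + off < j \<and> j \<le> len \<and> g j = g (k + off)) \<longleftrightarrow>
       (\<exists>j. k < j \<and> j + off \<le> len \<and> L (s + off + j) = L (s + off + k))"
      if k: "k + off \<le> len"
    proof
      assume "\<exists>j. k + off < j \<and> j \<le> len \<and> g j = g (k + off)"
      then obtain j where "k + off < j" "j \<le> len" "g j = g (k + off)" by blast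
      then show "\<exists>j. k < j \<and> j + off \<le> len \<and> L (s + off + j) = L (s + off + k)"
        using gL[of j "k + off"] k by (intro exI[of _ "j - off"]) (auto simp: ac_simps)
    next
      assume "\<exists>j. k < j \<and> j + off \<le> len \<and> L (s + off + j) = L (s + off + k)"
      then obtain j where "k < j" "j + off \<le> len" "L (s + off + j) = L (s + off + k)" by blast
      then show "\<exists>j. k + off < j \<and> j \<le> len \<and> g j = g (k + off)"
        using gL[of "j + off" "k + off"] k by (intro exI[of _ "j + off"]) (auto simp: ac_simps)
    qed
    then show ?thesis unfolding step enc in1 k_def[symmetric] using 3 by auto
  next
    case 4
    then show ?thesis unfolding step enc drop dead1_Suc[OF m] dead2_Suc[OF m] using bs bc by auto
  qed
  then show ?thesis by (simp add: \<beta>_def)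
qed

text \<open>A block without an earlier member is counted at its first cell.\<close>

definition accept :: "nat \<Rightarrow> (nat \<Rightarrow> bool) \<Rightarrow> bool" where
  "accept m \<beta> \<longleftrightarrow> \<not> \<beta> (3 * m + 1) \<and> \<not> \<beta> (3 * m + 3) \<and>
     card {k. k < m \<and> \<not> \<beta> k \<and> \<not> \<beta> (m + k)} + of_bool (\<beta> (3 * m)) = 1 \<and>
     card {k. k < m \<and> \<beta> k \<and> \<not> \<beta> (m + k)} + of_bool (\<beta> (3 * m + 2)) = 1"

text \<open>The components of a colour are those that have left and those still present, and the
  latter correspond to their first window cells. Having a single component means one departed and no
  first cell, or one first cell and none departed.\<close>

lemma one_class_iff:
  assumes m: "0 < m" and N: "m \<le> N"
  shows "\<not> dead2 m c N col \<and>
     card {k. k < m \<and> c (N - m + k) = col \<and>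
       \<not> (\<exists>j<k. lab m c N (N - m + j) = lab m c N (N - m + k))} + of_bool (dead1 m c N col) = 1 \<longleftrightarrow>
     (\<exists>a<N. c a = col) \<and> (\<forall>a<N. \<forall>b<N. c a = col \<longrightarrow> c b = col \<longrightarrow> lab m c N a = lab m c N b)"
proof -
  define s where "s = N - m"
  define D where "D = lab m c N"
  define H where "H = {k. k < m \<and> c (s + k) = col \<and> \<not> (\<exists>j<k. D (s + j) = D (s + k))}"
  have fin: "finite H" by (simp add: H_def)
  have sN: "s + m = N" using N by (simp add: s_def)
  have dead: "dead m c N a \<longleftrightarrow> a < s \<and> (\<forall>b. s \<le> b \<longrightarrow> b < N \<longrightarrow> D b \<noteq> D a)" for a
    by (simp add: dead_def s_def D_def)
  have head: "\<exists>h\<in>H. D (s + h) = D a" if a: "a < N" "c a = col" "\<not> dead m c N a" for a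
  proof -
    have "\<exists>k. k < m \<and> D (s + k) = D a"
    proof (cases "a < s")
      case True
      then obtain b where b: "s \<le> b" "b < N" "D b = D a" using a dead by auto
      then show ?thesis using sN by (intro exI[of _ "b - s"]) auto
    next
      case False
      then show ?thesis using sN a by (intro exI[of _ "a - s"]) auto
    qed
    then have ex: "\<exists>k. k < m \<and> D (s + k) = D a" .
    define h where "h = (LEAST k. k < m \<and> D (s + k) = D a)"
    have h: "h < m" "D (s + h) = D a" using LeastI_ex[OF ex] by (auto simp: h_def)
    have "\<not> (\<exists>j<h. D (s + j) = D (s + h))"
      using not_less_Least[of _ "\<lambda>k. k < m \<and> D (s + k) = D a"] h unfolding h_def
      by (metis (mono_tags, lifting) less_trans)
    moreover have "c (s + h) = col"
      using lab_eq_col[OF m, of "s + h" N a c] h a sN by (simp add: D_def)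
    ultimately show ?thesis using h by (auto simp: H_def)
  qed
  have inj: "h = h'" if "h \<in> H" "h' \<in> H" "D (s + h) = D (s + h')" for h h'
    using that unfolding H_def by (metis (mono_tags, lifting) mem_Collect_eq linorder_neqE_nat)
  have HN: "s + h < N" "c (s + h) = col" if "h \<in> H" for h using that sN by (auto simp: H_def)
  have Hd: "D (s + h) \<noteq> D a" if "h \<in> H" "dead m c N a" for h a
    using that HN[of h] unfolding dead by auto
  have deadN: "a < N" if "dead m c N a" for a using that sN by (auto simp: dead)
  have "\<not> dead2 m c N col \<and> card H + of_bool (dead1 m c N col) = 1 \<longleftrightarrow>
     (\<exists>a<N. c a = col) \<and> (\<forall>a<N. \<forall>b<N. c a = col \<longrightarrow> c b = col \<longrightarrow> D a = D b)"
  proof (cases "dead1 m c N col")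
    case True
    then obtain x where x: "dead m c N x" "c x = col" by (auto simp: dead1_def)
    have "card H + of_bool (dead1 m c N col) = 1 \<longleftrightarrow> H = {}" using True fin by simp
    moreover have "\<not> dead2 m c N col \<and> H = {} \<longleftrightarrow>
       (\<forall>a<N. \<forall>b<N. c a = col \<longrightarrow> c b = col \<longrightarrow> D a = D b)"
    proof
      assume "\<not> dead2 m c N col \<and> H = {}"
      then show "\<forall>a<N. \<forall>b<N. c a = col \<longrightarrow> c b = col \<longrightarrow> D a = D b"
        using head unfolding dead2_def D_def by blast
    next
      assume all: "\<forall>a<N. \<forall>b<N. c a = col \<longrightarrow> c b = col \<longrightarrow> D a = D b"
      have "H = {}" using all HN Hd x deadN by blast
      then show "\<not> dead2 m c N col \<and> H = {}" using all deadN unfolding dead2_def D_def by blast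
    qed
    ultimately show ?thesis using x deadN by blast
  next
    case False
    then have nd: "\<not> dead m c N a" if "c a = col" for a using that by (auto simp: dead1_def)
    then have "\<not> dead2 m c N col" by (auto simp: dead2_def)
    moreover have "card H = 1 \<longleftrightarrow> (\<exists>h. H = {h})" using card_1_singleton_iff by auto
    moreover have "(\<exists>h. H = {h}) \<longleftrightarrow>
       (\<exists>a<N. c a = col) \<and> (\<forall>a<N. \<forall>b<N. c a = col \<longrightarrow> c b = col \<longrightarrow> D a = D b)" (is "_ \<longleftrightarrow> ?R")
    proof
      assume "\<exists>h. H = {h}"
      then obtain h where h: "H = {h}" by blast
      have "D a = D (s + h)" if "a < N" "c a = col" for a using head[OF that] nd[OF that(2)] h by auto
      moreover have "s + h < N" "c (s + h) = col" using HN[of h] h by auto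
      ultimately show ?R by metis
    next
      assume R: ?R
      then obtain a h where "h \<in> H" using head nd by blast
      then have "H = {h}" using R HN inj by blast
      then show "\<exists>h. H = {h}" by blast
    qed
    ultimately show ?thesis using False by simp
  qed
  then show ?thesis unfolding H_def D_def s_def .
qed

lemma accept_enc_bits:
  assumes m: "0 < m" and N: "m \<le> N"
  shows "accept m (enc_bits m c N) \<longleftrightarrow>
     (\<forall>col. (\<exists>a<N. c a = col) \<and>
       (\<forall>a<N. \<forall>b<N. c a = col \<longrightarrow> c b = col \<longrightarrow> (a, b) \<in> (cell_edges m c N)\<^sup>*))"
proof -
  have e: "enc_bits m c N k = c (N - m + k)"
    "enc_bits m c N (m + k) \<longleftrightarrow> (\<exists>j<k. lab m c N (N - m + j) = lab m c N (N - m + k))" if "k < m" for k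
    using that N by (auto simp: enc_bits_def Let_def)
  have b: "enc_bits m c N (3 * m) = dead1 m c N False" "enc_bits m c N (3 * m + 1) = dead2 m c N False"
    "enc_bits m c N (3 * m + 2) = dead1 m c N True" "enc_bits m c N (3 * m + 3) = dead2 m c N True"
    by (simp_all add: enc_bits_def Let_def)
  have h: "{k. k < m \<and> \<not> enc_bits m c N k \<and> \<not> enc_bits m c N (m + k)} =
      {k. k < m \<and> c (N - m + k) = False \<and>
       \<not> (\<exists>j<k. lab m c N (N - m + j) = lab m c N (N - m + k))}"
    "{k. k < m \<and> enc_bits m c N k \<and> \<not> enc_bits m c N (m + k)} =
      {k. k < m \<and> c (N - m + k) = True \<and>
       \<not> (\<exists>j<k. lab m c N (N - m + j) = lab m c N (N - m + k))}"
    using e by auto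
  have all_bool_eq: "(\<forall>col. R col) \<longleftrightarrow> R False \<and> R True" for R :: "bool \<Rightarrow> bool"
    by (metis (full_types))
  have "accept m (enc_bits m c N) \<longleftrightarrow>
     (\<forall>col. (\<exists>a<N. c a = col) \<and>
       (\<forall>a<N. \<forall>b<N. c a = col \<longrightarrow> c b = col \<longrightarrow> lab m c N a = lab m c N b))"
    
    unfolding accept_def b h all_bool_eq
      one_class_iff[OF m N, of c False, symmetric] one_class_iff[OF m N, of c True, symmetric]
    by blast
  then show ?thesis using lab_eq_iff_conn[OF m] by (metis (no_types, lifting))
qed

section \<open>States as numbers\<close>

definition code :: "nat \<Rightarrow> (nat \<Rightarrow> bool) \<Rightarrow> nat" where
  "code T P = (\<Sum>t<T. of_bool (P t) * 2 ^ t)"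

text \<open>Known facts on the bits of Horner sums then give the bits of a code.\<close>

lemma code_horner: "code T P = horner_sum of_bool 2 (map P [0..<T])"
  unfolding code_def horner_sum_eq_sum by (rule sum.cong) (auto)

lemma code_less: "code T P < 2 ^ T"
proof (induction T)
  case (Suc T)
  have "code (Suc T) P = code T P + of_bool (P T) * 2 ^ T" by (simp add: code_def)
  then show ?case using Suc by (cases "P T") auto
qed (simp add: code_def)

lemma bit_code: "bit (code T P) t \<longleftrightarrow> t < T \<and> P t"
  unfolding code_horner by (auto simp: bit_horner_sum_bit_iff)

definition delta :: "nat \<Rightarrow> nat \<Rightarrow> bool \<Rightarrow> nat \<Rightarrow> nat" where
  "delta m l col i = code (3 * m + 4) (step_bits m l col (bit i))"

definition enc :: "nat \<Rightarrow> (nat \<Rightarrow> bool) \<Rightarrow> nat \<Rightarrow> nat" where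
  "enc m c l = code (3 * m + 4) (enc_bits m c l)"

lemma bit_enc: "bit (enc m c l) = enc_bits m c l"
  by (rule ext) (auto simp: enc_def bit_code enc_bits_def Let_def)

lemma delta_enc: "0 < m \<Longrightarrow> delta m l (c l) (enc m c l) = enc m c (Suc l)"
  unfolding delta_def bit_enc unfolding enc_def by (rule arg_cong[where f = "code (3 * m + 4)"]) (rule ext, rule step_bits_enc_bits)

lemma delta_less: "delta m l col i < 2 ^ (3 * m + 4)"
  by (simp add: delta_def code_less)

lemma enc_less: "enc m c l < 2 ^ (3 * m + 4)"
  by (simp add: enc_def code_less)

lemma enc_0: "enc m c 0 = 0"
  by (auto simp: enc_def code_def enc_bits_def Let_def dead1_def dead2_def dead_def)

text \<open>Here \<open>r\<close> is the number of cells still to be read, so the next one is \<open>N - r\<close>.\<close>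

primrec feas :: "nat \<Rightarrow> nat \<Rightarrow> (nat \<Rightarrow> nat) \<Rightarrow> nat \<Rightarrow> nat \<Rightarrow> nat \<Rightarrow> bool" where
  "feas m N ws 0 i x \<longleftrightarrow> accept m (bit i) \<and> x = 0"
| "feas m N ws (Suc r) i x \<longleftrightarrow>
     feas m N ws r (delta m (N - Suc r) False i) x \<or>
     ws (N - Suc r) \<le> x \<and> feas m N ws r (delta m (N - Suc r) True i) (x - ws (N - Suc r))"

text \<open>Backward induction along the run of \<open>c\<close>: its own colour at each cell
  witnesses one of the two alternatives of \<open>feas\<close>, and its acceptance settles the base
  case.\<close>

lemma feas_enc:
  assumes m: "0 < m" and acc: "accept m (enc_bits m c N)"
  shows "r \<le> N \<Longrightarrow> feas m N ws r (enc m c (N - r)) (\<Sum>a\<in>{N - r..<N}. of_bool (c a) * ws a)"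
proof (induction r)
  case 0
  then show ?case using acc by (simp add: bit_enc)
next
  case (Suc r)
  define l where "l = N - Suc r"
  have l: "Suc l = N - r" "l < N" using Suc.prems by (auto simp: l_def)
  have IH: "feas m N ws r (enc m c (Suc l)) (\<Sum>a\<in>{Suc l..<N}. of_bool (c a) * ws a)"
    using Suc l by simp
  have "(\<Sum>a\<in>{l..<N}. of_bool (c a) * ws a) = of_bool (c l) * ws l + (\<Sum>a\<in>{Suc l..<N}. of_bool (c a) * ws a)"
    by (rule sum.atLeast_Suc_lessThan[OF l(2)])
  then show ?case
    using IH delta_enc[OF m, of l c] by (cases "c l") (auto simp: l_def[symmetric])
qed

section \<open>Total correctness with running time\<close>

text \<open>Symbolic execution of straight-line code. The clauses for \<open>While\<close> in
  \<open>run\<close> and in \<open>cost\<close> are placeholders; results about both are stated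
  under \<open>loop_free\<close>.\<close>

primrec run :: "com \<Rightarrow> state \<Rightarrow> state" where
  "run Skip s = s"
| "run (Assign x e) s = s\<lparr>reg := (reg s)(x := aval e s)\<rparr>"
| "run (Store a e1 e2) s = s\<lparr>arr := (arr s)(a := (arr s a)(aval e1 s := aval e2 s))\<rparr>"
| "run (Seq c1 c2) s = run c2 (run c1 s)"
| "run (If b c1 c2) s = (if bval b s then run c1 s else run c2 s)"
| "run (While b c) s = s"

primrec loop_free :: "com \<Rightarrow> bool" where
  "loop_free Skip = True"
| "loop_free (Assign x e) = True"
| "loop_free (Store a e1 e2) = True"
| "loop_free (Seq c1 c2) = (loop_free c1 \<and> loop_free c2)"
| "loop_free (If b c1 c2) = (loop_free c1 \<and> loop_free c2)"
| "loop_free (While b c) = False"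

primrec cost :: "com \<Rightarrow> nat" where
  "cost Skip = 1"
| "cost (Assign x e) = 1 + acost e"
| "cost (Store a e1 e2) = 1 + acost e1 + acost e2"
| "cost (Seq c1 c2) = cost c1 + cost c2"
| "cost (If b c1 c2) = 1 + bcost b + max (cost c1) (cost c2)"
| "cost (While b c) = 0"

primrec mod_regs :: "com \<Rightarrow> vname set" where
  "mod_regs Skip = {}"
| "mod_regs (Assign x e) = {x}"
| "mod_regs (Store a e1 e2) = {}"
| "mod_regs (Seq c1 c2) = mod_regs c1 \<union> mod_regs c2"
| "mod_regs (If b c1 c2) = mod_regs c1 \<union> mod_regs c2"
| "mod_regs (While b c) = mod_regs c"

primrec mod_arrs :: "com \<Rightarrow> vname set" where
  "mod_arrs Skip = {}"
| "mod_arrs (Assign x e) = {}"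
| "mod_arrs (Store a e1 e2) = {a}"
| "mod_arrs (Seq c1 c2) = mod_arrs c1 \<union> mod_arrs c2"
| "mod_arrs (If b c1 c2) = mod_arrs c1 \<union> mod_arrs c2"
| "mod_arrs (While b c) = mod_arrs c"

definition agree :: "vname set \<Rightarrow> vname set \<Rightarrow> state \<Rightarrow> state \<Rightarrow> bool" where
  "agree R A s u \<longleftrightarrow> (\<forall>x. x \<notin> R \<longrightarrow> reg u x = reg s x) \<and> (\<forall>a. a \<notin> A \<longrightarrow> arr u a = arr s a)"

abbreviation frame :: "com \<Rightarrow> state \<Rightarrow> state \<Rightarrow> bool" where
  "frame c \<equiv> agree (mod_regs c) (mod_arrs c)"

abbreviation loop_frame :: "vname \<Rightarrow> com \<Rightarrow> state \<Rightarrow> state \<Rightarrow> bool" where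
  "loop_frame i c \<equiv> agree (insert i (mod_regs c)) (mod_arrs c)"

text \<open>A \<open>For\<close> loop increments its counter after the body, so the body must
  establish the invariant for the state in which the counter has already advanced.\<close>

abbreviation loop_post :: "vname \<Rightarrow> nat \<Rightarrow> (nat \<Rightarrow> state \<Rightarrow> bool) \<Rightarrow> state \<Rightarrow> bool" where
  "loop_post i k I \<equiv> \<lambda>v. I (Suc k) (v\<lparr>reg := (reg v)(i := Suc k)\<rparr>)"

lemma agree_reg: "agree R A s u \<Longrightarrow> x \<notin> R \<Longrightarrow> reg u x = reg s x"
  and agree_arr: "agree R A s u \<Longrightarrow> a \<notin> A \<Longrightarrow> arr u a = arr s a"
  by (auto simp: agree_def)

lemma exec_agree: "exec c s t s' \<Longrightarrow> frame c s s'"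
  by (induction rule: exec.induct) (auto simp: agree_def)

text \<open>A total-correctness triple whose precondition is a concrete start state. Facts about
  \<open>s\<close> remain available in the context, and whatever a program part does not touch is
  recovered from \<open>frame\<close>.\<close>

definition ht :: "state \<Rightarrow> com \<Rightarrow> nat \<Rightarrow> (state \<Rightarrow> bool) \<Rightarrow> bool" where
  "ht s c T Q \<longleftrightarrow> (\<exists>t s'. exec c s t s' \<and> t \<le> T \<and> Q s')"

lemma exec_run: "loop_free c \<Longrightarrow> \<exists>t \<le> cost c. exec c s t (run c s)"
proof (induction c arbitrary: s)
  case (Seq c1 c2)
  then obtain t1 t2 where "t1 \<le> cost c1" "exec c1 s t1 (run c1 s)"
    "t2 \<le> cost c2" "exec c2 (run c1 s) t2 (run c2 (run c1 s))" by (metis loop_free.simps(4))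
  then show ?case by (intro exI[of _ "t1 + t2"]) (auto intro: exec.Seq)
next
  case (If b c1 c2)
  then obtain t1 t2 where "t1 \<le> cost c1" "exec c1 s t1 (run c1 s)"
    "t2 \<le> cost c2" "exec c2 s t2 (run c2 s)" by (metis loop_free.simps(5))
  then show ?case
    using exec.IfTrue[of b s c1 t1 "run c1 s" c2] exec.IfFalse[of b s c2 t2 "run c2 s" c1]
    by (intro exI[of _ "1 + bcost b + (if bval b s then t1 else t2)"]) (auto simp: le_max_iff_disj)
qed (use exec.Skip exec.Assign exec.Store in \<open>fastforce\<close>)+

lemma ht_run: "loop_free c \<Longrightarrow> Q (run c s) \<Longrightarrow> cost c \<le> T \<Longrightarrow> ht s c T Q"
  unfolding ht_def using exec_run[of c s] le_trans by blast

lemma ht_sub: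
  "ht s c T Q \<Longrightarrow> (\<And>u. Q u \<Longrightarrow> frame c s u \<Longrightarrow> Q' u) \<Longrightarrow> T \<le> T' \<Longrightarrow> ht s c T' Q'"
  unfolding ht_def using exec_agree by (meson le_trans)

lemma ht_seq:
  assumes "ht s c1 T1 Q1"
    and "\<And>u. Q1 u \<Longrightarrow> frame c1 s u \<Longrightarrow> ht u c2 T2 Q"
    and "T1 + T2 \<le> T"
  shows "ht s (Seq c1 c2) T Q"
proof -
  obtain t1 u where 1: "exec c1 s t1 u" "t1 \<le> T1" "Q1 u" using assms(1) by (auto simp: ht_def)
  obtain t2 v where 2: "exec c2 u t2 v" "t2 \<le> T2" "Q v"
    using assms(2)[OF 1(3) exec_agree[OF 1(1)]] by (auto simp: ht_def)
  show ?thesis unfolding ht_def using exec.Seq[OF 1(1) 2(1)] 1 2 assms(3) by force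
qed

lemma ht_seq_run:
  "loop_free c1 \<Longrightarrow> ht (run c1 s) c2 T2 Q \<Longrightarrow> cost c1 + T2 \<le> T \<Longrightarrow> ht s (Seq c1 c2) T Q"
  by (rule ht_seq[OF ht_run[where Q = "\<lambda>u. u = run c1 s"]]) auto

lemma ht_if:
  assumes "bval b s \<Longrightarrow> ht s c1 T1 Q" "\<not> bval b s \<Longrightarrow> ht s c2 T1 Q" "1 + bcost b + T1 \<le> T"
  shows "ht s (If b c1 c2) T Q"
proof (cases "bval b s")
  case True
  then obtain t u where "exec c1 s t u" "t \<le> T1" "Q u" using assms(1) by (auto simp: ht_def)
  then show ?thesis unfolding ht_def using exec.IfTrue[OF True, of c1 t u c2] assms(3) by fastforce
next
  case False
  then obtain t u where "exec c2 s t u" "t \<le> T1" "Q u" using assms(2) by (auto simp: ht_def)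
  then show ?thesis unfolding ht_def using exec.IfFalse[OF False, of c2 t u c1] assms(3) by fastforce
qed

text \<open>The number of iterations is known exactly, so the guard is tested \<open>n + 1\<close>
  times. The induction is on the number of iterations left.\<close>

lemma ht_while:
  assumes step: "\<And>k u. k < n \<Longrightarrow> I k u \<Longrightarrow> bval b u \<and> ht u c T (I (Suc k))"
    and stop: "\<And>u. I n u \<Longrightarrow> \<not> bval b u"
    and init: "I 0 s"
    and T': "n * (T + 1 + bcost b) + 1 + bcost b \<le> T'"
  shows "ht s (While b c) T' (I n)"
proof -
  have "I (n - k) u \<Longrightarrow> k \<le> n \<Longrightarrow> ht u (While b c) (k * (T + 1 + bcost b) + 1 + bcost b) (I n)" for k u
  proof (induction k arbitrary: u)
    case 0
    then show ?case unfolding ht_def using exec.WhileFalse[OF stop[of u], of c] by auto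
  next
    case (Suc k)
    have b: "bval b u" and c: "ht u c T (I (n - k))"
      using step[of "n - Suc k" u] Suc.prems by (auto simp: Suc_diff_Suc)
    obtain t1 v where 1: "exec c u t1 v" "t1 \<le> T" "I (n - k) v" using c by (auto simp: ht_def)
    obtain t2 w where 2: "exec (While b c) v t2 w" "t2 \<le> k * (T + 1 + bcost b) + 1 + bcost b" "I n w"
      using Suc.IH[OF 1(3)] Suc.prems by (auto simp: ht_def)
    show ?case unfolding ht_def using exec.WhileTrue[OF b 1(1) 2(1)] 1 2 by (fastforce simp: algebra_simps)
  qed
  from this[of n s] init have "ht s (While b c) (n * (T + 1 + bcost b) + 1 + bcost b) (I n)" by simp
  then show ?thesis by (rule ht_sub[OF _ _ T'])
qed

definition For :: "vname \<Rightarrow> vname \<Rightarrow> com \<Rightarrow> com" where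
  "For i b c = Seq (Assign i (Const 0)) (While (Less (Reg i) (Reg b))
     (Seq c (Assign i (Plus (Reg i) (Const 1)))))"

lemma mod_For [simp]:
  "mod_regs (For i b c) = insert i (mod_regs c)" "mod_arrs (For i b c) = mod_arrs c"
  by (auto simp: For_def)

text \<open>Each round adds \<open>8\<close> steps to the body: \<open>4\<close> for the test and
  \<open>4\<close> for the increment. The remaining \<open>6\<close> are the initial assignment and
  the final failing test.\<close>

lemma ht_for:
  assumes b: "reg s b = n" "b \<notin> mod_regs c" "b \<noteq> i" and i: "i \<notin> mod_regs c"
    and init: "I 0 (s\<lparr>reg := (reg s)(i := 0)\<rparr>)"
    and step: "\<And>k u. k < n \<Longrightarrow> loop_frame i c s u \<Longrightarrow> reg u i = k \<Longrightarrow> I k u \<Longrightarrow>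
      ht u c T (\<lambda>v. I (Suc k) (v\<lparr>reg := (reg v)(i := Suc k)\<rparr>))"
    and fin: "\<And>u. loop_frame i c s u \<Longrightarrow> reg u i = n \<Longrightarrow> I n u \<Longrightarrow> Q u"
    and T': "n * (T + 8) + 6 \<le> T'"
  shows "ht s (For i b c) T' Q"
proof -
  let ?R = "insert i (mod_regs c)" and ?A = "mod_arrs c"
  define J where "J k u \<longleftrightarrow> agree ?R ?A s u \<and> reg u i = k \<and> I k u" for k u
  have bn: "reg u b = n" if "agree ?R ?A s u" for u using that b by (auto simp: agree_def)
  have "ht (s\<lparr>reg := (reg s)(i := 0)\<rparr>) (While (Less (Reg i) (Reg b)) (Seq c (Assign i (Plus (Reg i) (Const 1)))))
    (n * (T + 8) + 4) (J n)"
  proof (rule ht_while[where T = "T + 4"])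
    show "J 0 (s\<lparr>reg := (reg s)(i := 0)\<rparr>)" using init by (auto simp: J_def agree_def)
    show "\<not> bval (Less (Reg i) (Reg b)) u" if "J n u" for u using that bn by (auto simp: J_def)
    fix k u assume k: "k < n" and Jk: "J k u"
    have ag: "agree ?R ?A s u" and ui: "reg u i = k" and Ik: "I k u" using Jk by (auto simp: J_def)
    have "ht u (Seq c (Assign i (Plus (Reg i) (Const 1)))) (T + 4) (J (Suc k))"
    proof (rule ht_seq[OF step[OF k ag ui Ik]])
      fix v assume v: "I (Suc k) (v\<lparr>reg := (reg v)(i := Suc k)\<rparr>)" and agv: "frame c u v"
      have vi: "reg v i = k" using agv i ui by (auto simp: agree_def)
      show "ht v (Assign i (Plus (Reg i) (Const 1))) 4 (J (Suc k))"
        by (rule ht_run) (use v ag agv vi in \<open>auto simp: J_def agree_def\<close>)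
    qed simp
    then show "bval (Less (Reg i) (Reg b)) u \<and> ht u (Seq c (Assign i (Plus (Reg i) (Const 1)))) (T + 4) (J (Suc k))"
      using k ui bn[OF ag] by simp
  qed (simp add: algebra_simps)
  then have "ht s (For i b c) (n * (T + 8) + 6) (J n)"
    unfolding For_def by (intro ht_seq_run[where ?T2.0 = "n * (T + 8) + 4"]) auto
  then show ?thesis by (rule ht_sub) (use fin T' in \<open>auto simp: J_def\<close>)
qed

section \<open>One automaton step as a program\<close>

abbreviation assign :: "vname \<Rightarrow> aexp \<Rightarrow> com" (infix "::=" 61) where "x ::= e \<equiv> Assign x e"
abbreviation seq :: "com \<Rightarrow> com \<Rightarrow> com" (infixr ";;" 60) where "c1 ;; c2 \<equiv> Seq c1 c2"
abbreviation "when b c \<equiv> com.If b c Skip"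

text \<open>
  A state code \<open>i\<close> is stored as \<open>i * Kp\<close>, its offset into a table with \<open>Kp\<close> entries per state. The
  array \<open>K\<close> holds the offsets of the single bits, so that coding and decoding need no multiplication.
\<close>

definition senv :: "nat \<Rightarrow> nat \<Rightarrow> nat \<Rightarrow> state \<Rightarrow> bool" where
  "senv m N Kp s \<longleftrightarrow> reg s ''m'' = m \<and> reg s ''T'' = 3 * m + 4 \<and>
     (\<forall>t<3 * m + 4. arr s ''K'' t = 2 ^ t * Kp) \<and> (\<forall>l<N. arr s ''R'' l = l mod m)"

lemma senv_agree:
  "agree R A s u \<Longrightarrow> ''m'' \<notin> R \<Longrightarrow> ''T'' \<notin> R \<Longrightarrow> ''K'' \<notin> A \<Longrightarrow> ''R'' \<notin> A \<Longrightarrow> senv m N Kp s \<Longrightarrow> senv m N Kp u"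
  by (simp add: senv_def agree_def)

section \<open>Unpacking a state code\<close>

abbreviation decode_bits_body :: com where
  "decode_bits_body \<equiv>
     ''t'' ::= Minus (Reg ''t'') (Const 1) ;;
     com.If (Less (Reg ''u'') (Fetch ''K'' (Reg ''t'')))
       (Store ''b'' (Reg ''t'') (Const 0))
       (''u'' ::= Minus (Reg ''u'') (Fetch ''K'' (Reg ''t'')) ;; Store ''b'' (Reg ''t'') (Const 1))"

definition decode_bits :: com where
  "decode_bits =
     (''u'' ::= Reg ''y'' ;; ''t'' ::= Reg ''T'') ;; For ''i'' ''T'' decode_bits_body"

lemma mod_decode_bits [simp]: "mod_regs decode_bits = {''u'', ''t'', ''i''}" "mod_arrs decode_bits = {''b''}"
  by (auto simp: decode_bits_def)

text \<open>Binary digits from the top by comparison and subtraction. The remainder before bit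
  \<open>t\<close> is \<open>take_bit (Suc t) i * Kp\<close>, and because \<open>Kp\<close> is
  positive it reaches \<open>2 ^ t * Kp\<close> exactly when that bit is set.\<close>

lemma ht_decode_bits:
  assumes env: "senv m N Kp s" and y: "reg s ''y'' = i * Kp" and i: "i < 2 ^ (3 * m + 4)" and Kp: "0 < Kp"
  shows "ht s decode_bits (40 * (3 * m + 4) + 20) (\<lambda>u. \<forall>t<3 * m + 4. arr u ''b'' t = of_bool (bit i t))"
proof -
  define T where "T = 3 * m + 4"
  let ?I = "\<lambda>k u. reg u ''t'' = T - k \<and> reg u ''u'' = take_bit (T - k) i * Kp \<and>
    (\<forall>t. T - k \<le> t \<longrightarrow> t < T \<longrightarrow> arr u ''b'' t = of_bool (bit i t))"
  have sT: "reg s ''T'' = T" using env by (simp add: senv_def T_def)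
  have iT: "take_bit T i = i" using i by (simp add: T_def take_bit_nat_eq_self)
  show ?thesis
    unfolding decode_bits_def T_def[symmetric]
  proof (rule ht_seq_run)
    let ?s = "run (''u'' ::= Reg ''y'' ;; ''t'' ::= Reg ''T'') s"
    show "ht ?s (For ''i'' ''T'' decode_bits_body)
        (40 * T + 10) (\<lambda>u. \<forall>t<T. arr u ''b'' t = of_bool (bit i t))"
    proof (rule ht_for[where n = T and I = ?I and T = 30])
      fix k u assume k: "k < T"
        and ag: "loop_frame ''i'' decode_bits_body ?s u"
        and ui: "reg u ''i'' = k" and I: "?I k u"
      define t where "t = T - Suc k"
      have t: "T - k = Suc t" "t < T" using k by (auto simp: t_def)
      have K: "arr u ''K'' t = 2 ^ t * Kp"
        using agree_arr[OF ag] env t by (simp add: senv_def T_def)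
      have tb: "take_bit (Suc t) i = 2 ^ t * of_bool (bit i t) + take_bit t i"
        by (rule take_bit_Suc_from_most)
      have lt: "take_bit t i * Kp < 2 ^ t * Kp" using Kp by simp
      have bitt: "take_bit (Suc t) i * Kp < 2 ^ t * Kp \<longleftrightarrow> \<not> bit i t"
        using lt unfolding tb by (cases "bit i t") (auto simp: algebra_simps)
      have all: "Suc t \<le> x \<or> x = t" if "t \<le> x" for x using that by auto
      show "ht u decode_bits_body 30 (loop_post ''i'' k ?I)"
        by (rule ht_run) (use I K bitt in \<open>auto simp: t t_def[symmetric] tb algebra_simps dest: all\<close>)
    qed (use sT iT y in auto)
  qed auto
qed

lemma last_open_bound: "last_open f k < k \<or> last_open f k = 0"
  by (induction k) auto

abbreviation last_open_body :: com where
  "last_open_body \<equiv> when (Equal (Fetch ''o'' (Reg ''j'')) (Const 1)) (''x'' ::= Reg ''j'')"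

abbreviation decode_labels_body :: com where
  "decode_labels_body \<equiv>
     (Store ''d'' (Reg ''k'') (Reg ''k'') ;; ''x'' ::= Const 0) ;;
     For ''j'' ''k'' last_open_body ;;
     (when (Equal (Fetch ''b'' (Plus (Reg ''m'') (Reg ''k''))) (Const 1))
        (Store ''o'' (Reg ''x'') (Const 0) ;; Store ''d'' (Reg ''k'') (Fetch ''d'' (Reg ''x''))) ;;
      Store ''o'' (Reg ''k'') (Fetch ''b'' (Plus (Reg ''m'') (Plus (Reg ''m'') (Reg ''k'')))))"

definition decode_labels :: com where "decode_labels = For ''k'' ''L'' decode_labels_body"

lemma mod_decode_labels [simp]: "mod_regs decode_labels = {''k'', ''x'', ''j''}" "mod_arrs decode_labels = {''d'', ''o''}"
  by (auto simp: decode_labels_def)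

text \<open>The bit pattern is arbitrary, because the table is filled for junk codes too. Storing
  \<open>k\<close> at \<open>d[k]\<close> before the lookup reproduces \<open>decode\<close> in the
  case \<open>k = 0\<close>, where the default value \<open>0\<close> of \<open>last_open\<close> is
  the current cell itself.\<close>

lemma ht_decode_labels:
  assumes m: "reg s ''m'' = m" and len: "reg s ''L'' = len" "len \<le> m"
    and b: "\<And>t. t < 3 * m + 4 \<Longrightarrow> arr s ''b'' t = of_bool (\<beta> t)"
  shows "ht s decode_labels (m * (20 * m + 100) + 10) (\<lambda>u. \<forall>k<len. arr u ''d'' k =
    snd (decode (\<lambda>k. \<beta> (m + k)) (\<lambda>k. \<beta> (2 * m + k)) len) k)"
proof -
  let ?dec = "decode (\<lambda>k. \<beta> (m + k)) (\<lambda>k. \<beta> (2 * m + k))"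
  let ?I = "\<lambda>k u. \<forall>i<k. arr u ''o'' i = of_bool (fst (?dec k) i) \<and> arr u ''d'' i = snd (?dec k) i"
  show ?thesis unfolding decode_labels_def
  proof (rule ht_for[where n = len and I = ?I and T = "20 * m + 80"])
    fix k u assume k: "k < len"
      and ag: "loop_frame ''k'' decode_labels_body s u"
      and uk: "reg u ''k'' = k" and I: "?I k u"
    have um: "reg u ''m'' = m" using agree_reg[OF ag] m by simp
    have ub: "arr u ''b'' = arr s ''b''" using agree_arr[OF ag] by simp
    have "m + k < 3 * m + 4" "m + (m + k) < 3 * m + 4" "2 * m + k = m + (m + k)" using k len(2) by linarith+
    then have bk: "arr u ''b'' (m + k) = of_bool (\<beta> (m + k))" "arr u ''b'' (m + (m + k)) = of_bool (\<beta> (2 * m + k))"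
      by (simp_all only: ub b)
    let ?u = "run (Store ''d'' (Reg ''k'') (Reg ''k'') ;; ''x'' ::= Const 0) u"
    let ?t = "last_open (fst (?dec k)) k"
    have tk: "?t < k \<or> ?t = 0" by (rule last_open_bound)
    show "ht u decode_labels_body (20 * m + 80) (loop_post ''k'' k ?I)"
    proof (rule ht_seq_run)
      show "ht ?u (For ''j'' ''k'' last_open_body ;;
          (when (Equal (Fetch ''b'' (Plus (Reg ''m'') (Reg ''k''))) (Const 1))
            (Store ''o'' (Reg ''x'') (Const 0) ;; Store ''d'' (Reg ''k'') (Fetch ''d'' (Reg ''x''))) ;;
           Store ''o'' (Reg ''k'') (Fetch ''b'' (Plus (Reg ''m'') (Plus (Reg ''m'') (Reg ''k''))))))
        (20 * m + 60) (loop_post ''k'' k ?I)"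
      proof (rule ht_seq)
        show "ht ?u (For ''j'' ''k'' last_open_body) (20 * m + 10) (\<lambda>v. reg v ''x'' = ?t)"
        proof (rule ht_for[where n = k and T = 10 and
              I = "\<lambda>j v. reg v ''x'' = last_open (fst (?dec k)) j"])
          fix j v assume j: "j < k"
            and agv: "loop_frame ''j'' last_open_body ?u v"
            and vj: "reg v ''j'' = j" "reg v ''x'' = last_open (fst (?dec k)) j"
          have vo: "arr v ''o'' j = of_bool (fst (?dec k) j)"
            using agree_arr[OF agv] I j by simp
          show "ht v last_open_body 10 (\<lambda>w. reg (w\<lparr>reg := (reg w)(''j'' := Suc j)\<rparr>) ''x'' =
              last_open (fst (?dec k)) (Suc j))"
            by (rule ht_run) (use vo vj in auto)
        qed (use uk k len in auto)
      next
        fix v assume vx: "reg v ''x'' = ?t"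
          and agv: "frame (For ''j'' ''k'' last_open_body) ?u v"
        have v: "reg v ''k'' = k" "reg v ''m'' = m" "arr v = arr ?u"
          using agree_reg[OF agv, of "''k''"] agree_reg[OF agv, of "''m''"] agree_arr[OF agv] uk um by auto
        show "ht v (when (Equal (Fetch ''b'' (Plus (Reg ''m'') (Reg ''k''))) (Const 1))
            (Store ''o'' (Reg ''x'') (Const 0) ;; Store ''d'' (Reg ''k'') (Fetch ''d'' (Reg ''x''))) ;;
           Store ''o'' (Reg ''k'') (Fetch ''b'' (Plus (Reg ''m'') (Plus (Reg ''m'') (Reg ''k'')))))
           50 (loop_post ''k'' k ?I)"
          by (rule ht_run) (use I v vx uk bk tk in \<open>auto simp: Let_def less_Suc_eq\<close>)
      qed simp
    qed simp_all
  next
    show "len * (20 * m + 80 + 8) + 6 \<le> m * (20 * m + 100) + 10"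
      using mult_le_mono[OF len(2), of "20 * m + 80 + 8" "20 * m + 100"] by linarith
  qed (use len in auto)
qed

section \<open>Linking the new cell\<close>

abbreviation link_full :: com where
  "link_full \<equiv>
     ''e'' ::= Reg ''L'' ;;
     when (And (Equal (Reg ''f'') (Const 1)) (Equal (Fetch ''b'' (Const 0)) (Reg ''c'')))
       (''e'' ::= Fetch ''d'' (Const 0))"

abbreviation link_last :: com where
  "link_last \<equiv>
     ''h'' ::= Const 0 ;;
     when (And (bexp.Not (Equal (Fetch ''R'' (Reg ''l'')) (Const 0)))
         (Equal (Fetch ''b'' (Minus (Reg ''L'') (Const 1))) (Reg ''c'')))
       (''h'' ::= Const 1 ;; ''a'' ::= Fetch ''d'' (Minus (Reg ''L'') (Const 1)))"

abbreviation new_labels_body :: com where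
  "new_labels_body \<equiv>
     com.If (And (Equal (Reg ''h'') (Const 1)) (Equal (Fetch ''d'' (Reg ''k'')) (Reg ''a'')))
       (Store ''g'' (Reg ''k'') (Reg ''e'')) (Store ''g'' (Reg ''k'') (Fetch ''d'' (Reg ''k''))) ;;
     Store ''c'' (Reg ''k'') (Fetch ''b'' (Reg ''k''))"

definition new_labels :: com where
  "new_labels = (link_full ;; link_last) ;; For ''k'' ''L'' new_labels_body ;;
     (Store ''g'' (Reg ''L'') (Reg ''e'') ;; Store ''c'' (Reg ''L'') (Reg ''c''))"

lemma mod_new_labels [simp]: "mod_regs new_labels = {''e'', ''h'', ''a'', ''k''}" "mod_arrs new_labels = {''g'', ''c''}"
  by (auto simp: new_labels_def)

lemma ht_new_labels:
  assumes m: "0 < m" and L: "reg s ''L'' = min l m" and f: "reg s ''f'' = (if m \<le> l then 1 else 0)"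
    and l: "reg s ''l'' = l" and c: "reg s ''c'' = of_bool col" and R: "arr s ''R'' l = l mod m"
    and b: "\<And>t. t < 3 * m + 4 \<Longrightarrow> arr s ''b'' t = of_bool (\<beta> t)"
    and d: "\<And>k. k < min l m \<Longrightarrow> arr s ''d'' k = d k"
  shows "ht s new_labels (50 * m + 100) (\<lambda>u. \<forall>k \<le> min l m.
    arr u ''g'' k = newlab (m \<le> l \<and> \<beta> 0 = col) (\<not> m dvd l \<and> \<beta> (min l m - 1) = col) 0 (min l m - 1) (min l m) d k \<and>
    arr u ''c'' k = of_bool ((\<beta>(min l m := col)) k))"
proof -
  define len where "len = min l m"
  define P where "P \<longleftrightarrow> m \<le> l \<and> \<beta> 0 = col"
  define Q where "Q \<longleftrightarrow> \<not> m dvd l \<and> \<beta> (len - 1) = col"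
  define e where "e = (if P then d 0 else len)"
  define g where "g = newlab P Q 0 (len - 1) len d"
  have len: "len \<le> m" by (simp add: len_def)
  have ge: "g len = e" "\<And>k. k < len \<Longrightarrow> g k = (if Q \<and> d k = d (len - 1) then e else d k)"
    by (auto simp: g_def e_def newlab_def Let_def)
  \<comment> \<open>Whenever a neighbour is consulted the window is nonempty, so the entries at
    \<open>0\<close> and \<open>len - 1\<close> are genuine labels.\<close>
  have len0: "0 < len" if "m \<le> l \<or> \<not> m dvd l" using that m by (cases "l = 0") (auto simp: len_def)
  let ?u = "run (link_full ;; link_last) s"
  have bl: "arr s ''b'' 0 = of_bool (\<beta> 0)" "arr s ''b'' (len - Suc 0) = of_bool (\<beta> (len - 1))"
    using b[of 0] b[of "len - 1"] len by auto
  have dl: "m \<le> l \<or> \<not> m dvd l \<Longrightarrow> arr s ''d'' 0 = d 0"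
     "m \<le> l \<or> \<not> m dvd l \<Longrightarrow> arr s ''d'' (len - Suc 0) = d (len - 1)"
    using len0 d[of 0] d[of "len - 1"] by (auto simp: len_def[symmetric])
  let ?v = "run link_full s"
  have ve: "reg ?v ''e'' = e"
    using bl(1) dl(1) L f c by (cases "m \<le> l"; cases "\<beta> 0"; cases col) (simp_all add: e_def P_def len_def[symmetric])
  have v: "reg ?v ''L'' = len" "reg ?v ''c'' = of_bool col" "reg ?v ''l'' = l" "arr ?v = arr s"
    using L c l by (simp_all add: len_def)
  have "l mod m = 0 \<longleftrightarrow> m dvd l" by auto
  then have w: "reg (run link_last w) ''h'' = of_bool Q" "Q \<Longrightarrow> reg (run link_last w) ''a'' = d (len - 1)"
      "reg (run link_last w) ''e'' = reg w ''e''" "reg (run link_last w) ''L'' = reg w ''L''"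
      "reg (run link_last w) ''c'' = reg w ''c''" "arr (run link_last w) = arr w"
    if "reg w ''L'' = len" "reg w ''c'' = of_bool col" "reg w ''l'' = l" "arr w = arr s" for w
    using that bl(2) dl(2) R by (cases "m dvd l"; cases "\<beta> (len - 1)"; cases col; simp add: Q_def)+
  have init: "reg ?u ''e'' = e" "reg ?u ''h'' = of_bool Q" "Q \<Longrightarrow> reg ?u ''a'' = d (len - 1)"
    "reg ?u ''L'' = len" "reg ?u ''c'' = of_bool col" "arr ?u = arr s"
    using w[OF v] ve v by (simp_all only: run.simps(4))
  note u = init(4-6)
  let ?I = "\<lambda>k u. \<forall>i<k. arr u ''g'' i = g i \<and> arr u ''c'' i = of_bool (\<beta> i)"
  show ?thesis unfolding new_labels_def len_def[symmetric] P_def[symmetric] Q_def[symmetric] g_def[symmetric]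
  proof (rule ht_seq_run)
    show "ht ?u (For ''k'' ''L'' new_labels_body ;; (Store ''g'' (Reg ''L'') (Reg ''e'') ;; Store ''c'' (Reg ''L'') (Reg ''c'')))
      (40 * m + 30) (\<lambda>u. \<forall>k\<le>len. arr u ''g'' k = g k \<and> arr u ''c'' k = of_bool ((\<beta>(len := col)) k))"
    proof (rule ht_seq)
      show "ht ?u (For ''k'' ''L'' new_labels_body) (40 * m + 10) (?I len)"
      proof (rule ht_for[where n = len and I = ?I and T = 30])
        fix k u assume k: "k < len"
          and ag: "loop_frame ''k'' new_labels_body ?u u"
          and uk: "reg u ''k'' = k" and I: "?I k u"
        have r: "reg u ''e'' = e" "reg u ''h'' = of_bool Q" "Q \<Longrightarrow> reg u ''a'' = d (len - 1)"
          using agree_reg[OF ag, of "''e''"] agree_reg[OF ag, of "''h''"] agree_reg[OF ag, of "''a''"] init by auto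
        have a: "arr u ''d'' k = d k" "arr u ''b'' k = of_bool (\<beta> k)"
          using agree_arr[OF ag, of "''d''"] agree_arr[OF ag, of "''b''"] u(3) d[of k] b[of k] k len
          by (auto simp: len_def)
        show "ht u new_labels_body 30 (loop_post ''k'' k ?I)"
          by (rule ht_run) (use uk r a I ge(2)[OF k] in \<open>auto simp: less_Suc_eq\<close>)
      qed (use u len in auto)
    next
      fix v assume I: "?I len v" and ag: "frame (For ''k'' ''L'' new_labels_body) ?u v"
      have v: "reg v ''L'' = len" "reg v ''c'' = of_bool col" "reg v ''e'' = e"
        using agree_reg[OF ag, of "''L''"] agree_reg[OF ag, of "''c''"] agree_reg[OF ag, of "''e''"] u init by auto
      show "ht v (Store ''g'' (Reg ''L'') (Reg ''e'') ;; Store ''c'' (Reg ''L'') (Reg ''c'')) 20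
         (\<lambda>u. \<forall>k\<le>len. arr u ''g'' k = g k \<and> arr u ''c'' k = of_bool ((\<beta>(len := col)) k))"
        by (rule ht_run) (use v I ge(1) in \<open>auto simp: le_less\<close>)
    qed simp
  qed auto
qed

section \<open>Encoding the shifted window\<close>

abbreviation links_body :: com where
  "links_body \<equiv>
     when (Equal (Fetch ''g'' (Reg ''j'')) (Fetch ''g'' (Reg ''k'')))
       (com.If (Less (Reg ''j'') (Reg ''k''))
         (com.If (Less (Reg ''j'') (Reg ''f'')) Skip (''u'' ::= Const 1))
         (when (Less (Reg ''k'') (Reg ''j'')) (''x'' ::= Const 1)))"

abbreviation add_bit :: "bexp \<Rightarrow> aexp \<Rightarrow> com" where
  "add_bit b e \<equiv> when b (''z'' ::= Plus (Reg ''z'') (Fetch ''K'' e))"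

text \<open>The discarded cell, position \<open>0\<close> of a full window, emits no bits. It only
  decides in \<open>D\<close> whether its block is lost, namely when no later cell shares its
  label.\<close>

abbreviation window_emit :: com where
  "window_emit \<equiv>
     com.If (Less (Reg ''k'') (Reg ''f''))
       (''D'' ::= Minus (Const 1) (Reg ''x''))
       (''t'' ::= Minus (Reg ''k'') (Reg ''f'') ;;
        add_bit (Equal (Fetch ''c'' (Reg ''k'')) (Const 1)) (Reg ''t'') ;;
        add_bit (Equal (Reg ''u'') (Const 1)) (Plus (Reg ''m'') (Reg ''t'')) ;;
        add_bit (Equal (Reg ''x'') (Const 1)) (Plus (Reg ''m'') (Plus (Reg ''m'') (Reg ''t''))))"

abbreviation window_body :: com where
  "window_body \<equiv> (''u'' ::= Const 0 ;; ''x'' ::= Const 0) ;; For ''j'' ''M'' links_body ;; window_emit"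

definition new_window :: com where
  "new_window = (''M'' ::= Plus (Reg ''L'') (Const 1) ;; ''z'' ::= Const 0 ;; ''D'' ::= Const 0) ;;
     For ''k'' ''M'' window_body"

lemma mod_new_window [simp]: "mod_regs new_window = {''M'', ''z'', ''D'', ''k'', ''j'', ''u'', ''x'', ''t''}" "mod_arrs new_window = {}"
  by (auto simp: new_window_def)

lemma ht_new_window:
  assumes env: "senv m N Kp s" and L: "reg s ''L'' = len" and f: "reg s ''f'' = off" "off \<le> 1" "off \<le> len"
    "Suc len - off \<le> m"
    and g: "\<And>k. k \<le> len \<Longrightarrow> arr s ''g'' k = g k" and c: "\<And>k. k \<le> len \<Longrightarrow> arr s ''c'' k = of_bool (col k)"
  shows "ht s new_window ((m + 1) * (40 * m + 200) + 30) (\<lambda>u.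
    reg u ''z'' = (\<Sum>k<Suc len. if k < off then 0 else
       (of_bool (col k) * 2 ^ (k - off) +
        of_bool (\<exists>j. off \<le> j \<and> j < k \<and> g j = g k) * 2 ^ (m + (k - off)) +
        of_bool (\<exists>j. k < j \<and> j \<le> len \<and> g j = g k) * 2 ^ (2 * m + (k - off)))) * Kp \<and>
    reg u ''D'' = of_bool (off = 1 \<and> \<not> (\<exists>j. 0 < j \<and> j \<le> len \<and> g j = g 0)))"
proof -
  define w :: "nat \<Rightarrow> nat" where "w k = (if k < off then 0 else
       (of_bool (col k) * 2 ^ (k - off) +
        of_bool (\<exists>j. off \<le> j \<and> j < k \<and> g j = g k) * 2 ^ (m + (k - off)) +
        of_bool (\<exists>j. k < j \<and> j \<le> len \<and> g j = g k) * 2 ^ (2 * m + (k - off))))" for k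
  have lm: "len \<le> m" using f by linarith
  let ?u = "run (''M'' ::= Plus (Reg ''L'') (Const 1) ;; ''z'' ::= Const 0 ;; ''D'' ::= Const 0) s"
  let ?D = "of_bool (off = 1 \<and> \<not> (\<exists>j. 0 < j \<and> j \<le> len \<and> g j = g 0)) :: nat"
  \<comment> \<open>Register \<open>D\<close> is settled in round \<open>0\<close>: either cell
    \<open>0\<close> is discarded there, or the window is not full and the value stays
    \<open>0\<close>.\<close>
  let ?I = "\<lambda>k u. reg u ''z'' = (\<Sum>i<k. w i) * Kp \<and> reg u ''D'' = (if k = 0 then 0 else ?D)"
  have s0: "reg ?u ''M'' = Suc len" "reg ?u ''f'' = off" "arr ?u = arr s" "reg ?u ''m'' = m"
    using L f env by (auto simp: senv_def)
  show ?thesis unfolding new_window_def w_def[symmetric]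
  proof (rule ht_seq_run)
    show "ht ?u (For ''k'' ''M'' window_body) ((m + 1) * (40 * m + 200) + 10)
      (\<lambda>u. reg u ''z'' = (\<Sum>i<Suc len. w i) * Kp \<and> reg u ''D'' = ?D)"
    proof (rule ht_for[where n = "Suc len" and I = ?I and T = "40 * m + 190"])
      fix k u assume k: "k < Suc len"
        and ag: "loop_frame ''k'' window_body ?u u"
        and uk: "reg u ''k'' = k" and I: "?I k u"
      have u: "reg u ''M'' = Suc len" "reg u ''f'' = off" "arr u = arr s" "reg u ''m'' = m"
        using agree_reg[OF ag, of "''M''"] agree_reg[OF ag, of "''f''"] agree_reg[OF ag, of "''m''"]
          agree_arr[OF ag] s0 by auto
      let ?v = "run (''u'' ::= Const 0 ;; ''x'' ::= Const 0) u"
      show "ht u window_body (40 * m + 190) (loop_post ''k'' k ?I)"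
      proof (rule ht_seq_run)
        show "ht ?v (For ''j'' ''M'' links_body ;; window_emit) (40 * m + 180)
          (loop_post ''k'' k ?I)"
        proof (rule ht_seq)
          let ?J = "\<lambda>j v. reg v ''u'' = of_bool (\<exists>i<j. off \<le> i \<and> i < k \<and> g i = g k) \<and>
             reg v ''x'' = of_bool (\<exists>i<j. k < i \<and> g i = g k)"
          show "ht ?v (For ''j'' ''M'' links_body) (40 * m + 60) (?J (Suc len))"
          proof (rule ht_for[where n = "Suc len" and I = ?J and T = 30])
            fix j v assume j: "j < Suc len"
              and agv: "loop_frame ''j'' links_body ?v v"
              and vj: "reg v ''j'' = j" and J: "?J j v"
            have v: "reg v ''k'' = k" "reg v ''f'' = off" "arr v ''g'' j = g j" "arr v ''g'' k = g k"
              using agree_reg[OF agv, of "''k''"] agree_reg[OF agv, of "''f''"] agree_arr[OF agv] u uk g j k by auto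
            define A where "A \<longleftrightarrow> (\<exists>i<j. off \<le> i \<and> i < k \<and> g i = g k)"
            define B where "B \<longleftrightarrow> (\<exists>i<j. k < i \<and> g i = g k)"
            have "(\<exists>i<Suc j. off \<le> i \<and> i < k \<and> g i = g k) \<longleftrightarrow> A \<or> off \<le> j \<and> j < k \<and> g j = g k"
              "(\<exists>i<Suc j. k < i \<and> g i = g k) \<longleftrightarrow> B \<or> k < j \<and> g j = g k"
              unfolding A_def B_def by (auto simp: less_Suc_eq)
            moreover have "reg v ''u'' = of_bool A" "reg v ''x'' = of_bool B" using J unfolding A_def B_def by auto
            ultimately show "ht v links_body 30 (loop_post ''j'' j ?J)"
              by (intro ht_run) (use v vj in auto)
          next
            show "Suc len * (30 + 8) + 6 \<le> 40 * m + 60" using lm by simp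
          qed (use u in auto)
        next
          fix v assume J: "reg v ''u'' = of_bool (\<exists>i<Suc len. off \<le> i \<and> i < k \<and> g i = g k) \<and>
             reg v ''x'' = of_bool (\<exists>i<Suc len. k < i \<and> g i = g k)"
            and agv: "frame (For ''j'' ''M'' links_body) ?v v"
          define H1 where "H1 \<longleftrightarrow> (\<exists>j. off \<le> j \<and> j < k \<and> g j = g k)"
          define H2 where "H2 \<longleftrightarrow> (\<exists>j. k < j \<and> j \<le> len \<and> g j = g k)"
          have J': "reg v ''u'' = of_bool H1" "reg v ''x'' = of_bool H2"
            using J k unfolding H1_def H2_def by (auto simp: less_Suc_eq_le)
          have v: "reg v ''k'' = k" "reg v ''f'' = off" "reg v ''m'' = m" "arr v = arr s"
            "reg v ''z'' = (\<Sum>i<k. w i) * Kp" "reg v ''D'' = (if k = 0 then 0 else ?D)"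
            using agree_reg[OF agv, of "''k''"] agree_reg[OF agv, of "''f''"] agree_reg[OF agv, of "''m''"]
              agree_reg[OF agv, of "''z''"] agree_reg[OF agv, of "''D''"] agree_arr[OF agv] u uk I by auto
          have vc: "arr s ''c'' k = of_bool (col k)" using c k by simp
          have K: "arr s ''K'' (k - off) = 2 ^ (k - off) * Kp" "arr s ''K'' (m + (k - off)) = 2 ^ (m + (k - off)) * Kp"
            "arr s ''K'' (m + (m + (k - off))) = 2 ^ (2 * m + (k - off)) * Kp" if "\<not> k < off"
          proof -
            have "k - off < 3 * m + 4" "m + (k - off) < 3 * m + 4" "m + (m + (k - off)) < 3 * m + 4"
              "m + (m + (k - off)) = 2 * m + (k - off)" using f k that by linarith+
            then show "arr s ''K'' (k - off) = 2 ^ (k - off) * Kp" "arr s ''K'' (m + (k - off)) = 2 ^ (m + (k - off)) * Kp"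
              "arr s ''K'' (m + (m + (k - off))) = 2 ^ (2 * m + (k - off)) * Kp" using env unfolding senv_def by auto
          qed
          show "ht v window_emit 100 (loop_post ''k'' k ?I)"
          proof (cases "k < off")
            case True
            then have "k = 0" "off = 1" using f by auto
            moreover have "reg v ''x'' = of_bool (\<exists>j. 0 < j \<and> j \<le> len \<and> g j = g 0)"
              using J'(2) \<open>k = 0\<close> by (simp add: H2_def)
            ultimately show ?thesis by (intro ht_run) (use v in \<open>auto simp: w_def\<close>)
          next
            case False
            have w: "w k = of_bool (col k) * 2 ^ (k - off) + of_bool H1 * 2 ^ (m + (k - off)) + of_bool H2 * 2 ^ (2 * m + (k - off))"
              using False by (simp add: w_def H1_def H2_def)
            have D: "reg v ''D'' = ?D" using v(6) False by (cases "k = 0") auto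
            have z: "reg v ''z'' = (\<Sum>i<k. w i) * Kp" by (rule v(5))
            show ?thesis
              by (rule ht_run)
                (use False v(1-4) z D J' vc K in \<open>auto simp: w algebra_simps\<close>)
          qed
        qed simp
      qed simp_all
    next
      show "Suc len * (40 * m + 190 + 8) + 6 \<le> (m + 1) * (40 * m + 200) + 10"
        using mult_le_mono[of "Suc len" "m + 1" "40 * m + 190 + 8" "40 * m + 200"] lm by linarith
    qed (use s0 in auto)
  qed simp_all
qed

text \<open>A saturating counter with the values zero, one and at least two. The second flag
  \<open>x\<close> is updated before \<open>u\<close>, so that it sees the old first flag.\<close>

definition fin_flags :: "nat \<Rightarrow> com" where
  "fin_flags col =
     ''u'' ::= Fetch ''b'' (Reg ''t'') ;; ''x'' ::= Fetch ''b'' (Plus (Reg ''t'') (Const 1)) ;;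
     when (And (Equal (Reg ''D'') (Const 1)) (Equal (Fetch ''b'' (Const 0)) (Const col)))
       (when (Equal (Reg ''u'') (Const 1)) (''x'' ::= Const 1) ;; ''u'' ::= Const 1) ;;
     add_bit (Equal (Reg ''u'') (Const 1)) (Reg ''t'') ;;
     add_bit (Equal (Reg ''x'') (Const 1)) (Plus (Reg ''t'') (Const 1))"

lemma mod_fin_flags [simp]: "mod_regs (fin_flags col) = {''z'', ''u'', ''x''}" "mod_arrs (fin_flags col) = {}"
  by (auto simp: fin_flags_def)

lemma ht_fin_flags:
  assumes "reg s ''t'' = t" "reg s ''D'' = of_bool dr" "arr s ''b'' 0 = of_bool C"
    "arr s ''b'' t = of_bool A" "arr s ''b'' (t + 1) = of_bool B"
  shows "ht s (fin_flags (of_bool col)) 80 (\<lambda>u. reg u ''z'' = reg s ''z'' +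
     of_bool (A \<or> dr \<and> C = col) * arr s ''K'' t + of_bool (B \<or> dr \<and> C = col \<and> A) * arr s ''K'' (t + 1))"
  by (rule ht_run; cases A; cases B; cases C; cases dr; cases col) (use assms in \<open>simp_all add: fin_flags_def\<close>)

definition new_flags :: com where
  "new_flags = (''t'' ::= Plus (Reg ''m'') (Plus (Reg ''m'') (Reg ''m''))) ;; fin_flags 0 ;;
     (''t'' ::= Plus (Reg ''t'') (Const 2)) ;; fin_flags 1"

lemma mod_new_flags [simp]: "mod_regs new_flags = {''z'', ''u'', ''x'', ''t''}" "mod_arrs new_flags = {}"
  by (auto simp: new_flags_def)

lemma ht_new_flags:
  assumes env: "senv m N Kp s" and D: "reg s ''D'' = of_bool dr"
    and b: "\<And>t. t < 3 * m + 4 \<Longrightarrow> arr s ''b'' t = of_bool (\<beta> t)"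
    and z: "reg s ''z'' = Z * Kp" and t: "t = 3 * m"
  shows "ht s new_flags 200 (\<lambda>u. reg u ''z'' = (Z + of_bool (\<beta> t \<or> dr \<and> \<not> \<beta> 0) * 2 ^ t +
     of_bool (\<beta> (t + 1) \<or> dr \<and> \<not> \<beta> 0 \<and> \<beta> t) * 2 ^ (t + 1) +
     of_bool (\<beta> (t + 2) \<or> dr \<and> \<beta> 0) * 2 ^ (t + 2) +
     of_bool (\<beta> (t + 3) \<or> dr \<and> \<beta> 0 \<and> \<beta> (t + 2)) * 2 ^ (t + 3)) * Kp)" (is "ht _ _ _ ?Q")
proof -
  have m: "reg s ''m'' = m" "m + (m + m) = t" using env by (simp_all add: senv_def t)
  have bt: "arr s ''b'' 0 = of_bool (\<beta> 0)" "arr s ''b'' t = of_bool (\<beta> t)" "arr s ''b'' (t + 1) = of_bool (\<beta> (t + 1))"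
    "arr s ''b'' (t + 2) = of_bool (\<beta> (t + 2))" "arr s ''b'' (t + 2 + 1) = of_bool (\<beta> (t + 3))"
    using b[of 0] b[of t] b[of "t + 1"] b[of "t + 2"] b[of "t + 3"] by (simp_all add: t numeral_eq_Suc)
  have K: "arr s ''K'' t = 2 ^ t * Kp" "arr s ''K'' (t + 1) = 2 ^ (t + 1) * Kp"
    "arr s ''K'' (t + 2) = 2 ^ (t + 2) * Kp" "arr s ''K'' (t + 2 + 1) = 2 ^ (t + 3) * Kp"
    using env by (simp_all add: senv_def t numeral_eq_Suc)
  let ?u = "run (''t'' ::= Plus (Reg ''m'') (Plus (Reg ''m'') (Reg ''m''))) s"
  show ?thesis unfolding new_flags_def
  proof (rule ht_seq_run[where ?T2.0 = 190], goal_cases)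
    case 2
    show ?case
    proof (rule ht_seq[OF ht_fin_flags[of _ t dr "\<beta> 0" "\<beta> t" "\<beta> (t + 1)" False, simplified of_bool_eq], where ?T2.0 = 100], goal_cases)
      case (6 v)
      have v: "reg v ''t'' = t" "reg v ''D'' = of_bool dr" "arr v = arr s"
        using agree_reg[OF 6(2), of "''t''"] agree_reg[OF 6(2), of "''D''"] agree_arr[OF 6(2)] m D by auto
      let ?v = "run (''t'' ::= Plus (Reg ''t'') (Const 2)) v"
      show ?case
      proof (rule ht_seq_run[where ?T2.0 = 80], goal_cases)
        case 2
        have "ht ?v (fin_flags (of_bool True)) 80 (\<lambda>u. reg u ''z'' = reg ?v ''z'' +
           of_bool (\<beta> (t + 2) \<or> dr \<and> \<beta> 0 = True) * arr ?v ''K'' (t + 2) +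
           of_bool (\<beta> (t + 3) \<or> dr \<and> \<beta> 0 = True \<and> \<beta> (t + 2)) * arr ?v ''K'' (t + 2 + 1))"
          by (rule ht_fin_flags) (use v bt in simp_all)
        note h = this[unfolded of_bool_eq]
        have vz: "reg ?v ''z'' = Z * Kp + of_bool (\<beta> t \<or> dr \<and> \<not> \<beta> 0) * (2 ^ t * Kp) +
          of_bool (\<beta> (t + 1) \<or> dr \<and> \<not> \<beta> 0 \<and> \<beta> t) * (2 ^ (t + 1) * Kp)"
          using 6(1) z K by simp
        have av: "arr ?v = arr s" using v by simp
        show ?case
          by (rule ht_sub[OF h], simp_all only: vz av K eq_True, simp_all only: add_mult_distrib mult.assoc add.assoc order_refl)
      qed simp_all
    qed (use m D bt in simp_all)
  qed simp_all
qed

text \<open>Reindexing by \<open>k = t + off\<close>: \<open>step_bits\<close> runs over positions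
  \<open>t\<close> of the new window, the program over cells \<open>k\<close> of the old one, where
  the discarded cell contributes nothing.\<close>

lemma sum_shift_guard:
  fixes w :: "nat \<Rightarrow> nat"
  assumes "Suc len - off \<le> m" "off \<le> Suc len"
  shows "(\<Sum>t<m. of_bool (t + off \<le> len \<and> R (t + off)) * w t) =
    (\<Sum>k<Suc len. if k < off then 0 else of_bool (R k) * w (k - off))"
proof -
  define n where "n = Suc len - off"
  have n: "n \<le> m" "Suc len = off + n" using assms by (auto simp: n_def)
  have "(\<Sum>t<m. of_bool (t + off \<le> len \<and> R (t + off)) * w t) =
    (\<Sum>t<n. of_bool (t + off \<le> len \<and> R (t + off)) * w t)"
    by (rule sum.mono_neutral_right) (use n in auto)
  also have "\<dots> = (\<Sum>t<n. of_bool (R (off + t)) * w t)"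
    by (rule sum.cong) (use n in \<open>auto simp: add.commute\<close>)
  also have "\<dots> = (\<Sum>k<off. 0) + (\<Sum>k\<in>{off..<off + n}. of_bool (R k) * w (k - off))"
    by (simp add: sum.shift_bounds_nat_ivl[of _ 0 off n, simplified] lessThan_atLeast0 add.commute)
  also have "\<dots> = (\<Sum>k<off. if k < off then 0 else of_bool (R k) * w (k - off)) +
     (\<Sum>k\<in>{off..<off + n}. if k < off then 0 else of_bool (R k) * w (k - off))"
    by (intro arg_cong2[where f = "(+)"] sum.cong) auto
  also have "\<dots> = (\<Sum>k<off + n. if k < off then 0 else of_bool (R k) * w (k - off))"
    unfolding lessThan_atLeast0 by (rule sum.atLeastLessThan_concat) auto
  finally show ?thesis by (simp add: n(2))
qed

lemma code_split:
  "code (3 * m + 4) P = (\<Sum>t<m. of_bool (P t) * 2 ^ t) + (\<Sum>t<m. of_bool (P (m + t)) * 2 ^ (m + t)) +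
     (\<Sum>t<m. of_bool (P (2 * m + t)) * 2 ^ (2 * m + t)) + of_bool (P (3 * m)) * 2 ^ (3 * m) +
     of_bool (P (3 * m + 1)) * 2 ^ (3 * m + 1) + of_bool (P (3 * m + 2)) * 2 ^ (3 * m + 2) +
     of_bool (P (3 * m + 3)) * 2 ^ (3 * m + 3)"
proof -
  let ?f = "\<lambda>t. of_bool (P t) * 2 ^ t :: nat"
  have sh: "sum ?f {a..<a + m} = (\<Sum>t<m. ?f (a + t))" for a
    using sum.shift_bounds_nat_ivl[of ?f 0 a m] by (simp add: lessThan_atLeast0 add.commute)
  have "sum ?f {..<3 * m} = sum ?f {0..<m} + sum ?f {m..<m + m} + sum ?f {2 * m..<2 * m + m}"
    unfolding lessThan_atLeast0
    using sum.atLeastLessThan_concat[of 0 m "2 * m" ?f] sum.atLeastLessThan_concat[of 0 "2 * m" "3 * m" ?f]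
    by (simp add: mult_2 numeral_3_eq_3 add.assoc)
  then show ?thesis unfolding code_def sh
    by (simp add: numeral_eq_Suc lessThan_atLeast0)
qed

text \<open>The successor code arranged as the program accumulates it: three bits for each surviving
  window cell, then the four flags.\<close>

lemma delta_eq:
  fixes m l i :: nat and cl :: bool
  assumes m: "0 < m"
  defines "len \<equiv> min l m"
  defines "off \<equiv> (if m \<le> l then 1 else 0 :: nat)"
  defines "g \<equiv> newlab (m \<le> l \<and> bit i 0 = cl) (\<not> m dvd l \<and> bit i (len - 1) = cl) 0 (len - 1) len
     (snd (decode (\<lambda>k. bit i (m + k)) (\<lambda>k. bit i (2 * m + k)) len))"
  defines "dr \<equiv> (off = 1 \<and> \<not> (\<exists>j. 0 < j \<and> j \<le> len \<and> g j = g 0))"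
  shows "delta m l cl i = (\<Sum>k<Suc len. if k < off then 0 else
       (of_bool (((bit i)(len := cl)) k) * 2 ^ (k - off) +
        of_bool (\<exists>j. off \<le> j \<and> j < k \<and> g j = g k) * 2 ^ (m + (k - off)) +
        of_bool (\<exists>j. k < j \<and> j \<le> len \<and> g j = g k) * 2 ^ (2 * m + (k - off)))) +
     of_bool (bit i (3 * m) \<or> dr \<and> \<not> bit i 0) * 2 ^ (3 * m) +
     of_bool (bit i (3 * m + 1) \<or> dr \<and> \<not> bit i 0 \<and> bit i (3 * m)) * 2 ^ (3 * m + 1) +
     of_bool (bit i (3 * m + 2) \<or> dr \<and> bit i 0) * 2 ^ (3 * m + 2) +
     of_bool (bit i (3 * m + 3) \<or> dr \<and> bit i 0 \<and> bit i (3 * m + 2)) * 2 ^ (3 * m + 3)"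
proof -
  let ?P = "step_bits m l cl (bit i)"
  let ?col = "(bit i)(len := cl)"
  have off: "Suc len - off \<le> m" "off \<le> Suc len" by (auto simp: len_def off_def)
  have dr: "(m \<le> l \<and> \<not> (\<exists>j>0. j \<le> len \<and> g j = g 0)) \<longleftrightarrow> dr" by (simp add: dr_def off_def)
  have P: "?P t = (if t < m then t + off \<le> len \<and> ?col (t + off)
        else if t < 2 * m then
          t - m + off \<le> len \<and> (\<exists>j. off \<le> j \<and> j < t - m + off \<and> g j = g (t - m + off))
        else if t < 3 * m then
          t - 2 * m + off \<le> len \<and> (\<exists>j. t - 2 * m + off < j \<and> j \<le> len \<and> g j = g (t - 2 * m + off))
        else if t = 3 * m then bit i t \<or> dr \<and> \<not> bit i 0
        else if t = 3 * m + 1 then bit i t \<or> dr \<and> \<not> bit i 0 \<and> bit i (3 * m)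
        else if t = 3 * m + 2 then bit i t \<or> dr \<and> bit i 0
        else t = 3 * m + 3 \<and> (bit i t \<or> dr \<and> bit i 0 \<and> bit i (3 * m + 2)))" for t
    unfolding step_bits_def Let_def len_def[symmetric] off_def[symmetric] g_def[symmetric] dr ..
  have P0: "(\<Sum>t<m. of_bool (?P t) * 2 ^ t) =
      (\<Sum>k<Suc len. if k < off then 0 else of_bool (?col k) * 2 ^ (k - off) :: nat)"
    by (subst sum_shift_guard[OF off, symmetric]) (rule sum.cong, simp_all add: P)
  have P1: "(\<Sum>t<m. of_bool (?P (m + t)) * 2 ^ (m + t)) =
      (\<Sum>k<Suc len. if k < off then 0 else of_bool (\<exists>j. off \<le> j \<and> j < k \<and> g j = g k) * 2 ^ (m + (k - off)) :: nat)"
    by (subst sum_shift_guard[OF off, symmetric]) (rule sum.cong, simp_all add: P)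
  have P2: "(\<Sum>t<m. of_bool (?P (2 * m + t)) * 2 ^ (2 * m + t)) =
      (\<Sum>k<Suc len. if k < off then 0 else of_bool (\<exists>j. k < j \<and> j \<le> len \<and> g j = g k) * 2 ^ (2 * m + (k - off)) :: nat)"
    by (subst sum_shift_guard[OF off, symmetric]) (rule sum.cong, simp_all add: P)
  have P3: "?P (3 * m) \<longleftrightarrow> bit i (3 * m) \<or> dr \<and> \<not> bit i 0"
    "?P (3 * m + 1) \<longleftrightarrow> bit i (3 * m + 1) \<or> dr \<and> \<not> bit i 0 \<and> bit i (3 * m)"
    "?P (3 * m + 2) \<longleftrightarrow> bit i (3 * m + 2) \<or> dr \<and> bit i 0"
    "?P (3 * m + 3) \<longleftrightarrow> bit i (3 * m + 3) \<or> dr \<and> bit i 0 \<and> bit i (3 * m + 2)"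
    unfolding P using m by simp_all
  show ?thesis unfolding delta_def code_split P0 P1 P2 P3 sum.distrib[symmetric]
    by (intro arg_cong2[where f = "(+)"] sum.cong refl) auto
qed

definition step :: com where
  "step = decode_bits ;;
     com.If (Less (Reg ''l'') (Reg ''m'')) (''L'' ::= Reg ''l'' ;; ''f'' ::= Const 0) (''L'' ::= Reg ''m'' ;; ''f'' ::= Const 1) ;;
     decode_labels ;; new_labels ;; new_window ;; new_flags"

lemma mod_step [simp]:
  "mod_regs step = {''u'', ''t'', ''i'', ''L'', ''f'', ''k'', ''x'', ''j'', ''e'', ''h'', ''a'', ''M'', ''z'', ''D''}"
  "mod_arrs step = {''b'', ''d'', ''o'', ''g'', ''c''}"
  by (auto simp: step_def)

text \<open>The square comes from the two nested scans, for the last open cell and for equal labels.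
  All other parts are linear in \<open>m\<close>.\<close>

lemma ht_step:
  assumes m: "0 < m" and env: "senv m N Kp s" and y: "reg s ''y'' = i * Kp" and i: "i < 2 ^ (3 * m + 4)"
    and Kp: "0 < Kp" and l: "reg s ''l'' = l" "l < N" and c: "reg s ''c'' = of_bool cl"
  shows "ht s step (2000 * (m * m)) (\<lambda>u. reg u ''z'' = delta m l cl i * Kp)"
proof -
  define len where "len = min l m"
  define off where "off = (if m \<le> l then 1 else 0 :: nat)"
  define d where "d = snd (decode (\<lambda>k. bit i (m + k)) (\<lambda>k. bit i (2 * m + k)) len)"
  define g where "g = newlab (m \<le> l \<and> bit i 0 = cl) (\<not> m dvd l \<and> bit i (len - 1) = cl) 0 (len - 1) len d"
  define dr where "dr \<longleftrightarrow> off = 1 \<and> \<not> (\<exists>j. 0 < j \<and> j \<le> len \<and> g j = g 0)"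
  define Z where "Z = (\<Sum>k<Suc len. if k < off then 0 else
       (of_bool (((bit i)(len := cl)) k) * 2 ^ (k - off) +
        of_bool (\<exists>j. off \<le> j \<and> j < k \<and> g j = g k) * 2 ^ (m + (k - off)) +
        of_bool (\<exists>j. k < j \<and> j \<le> len \<and> g j = g k) * 2 ^ (2 * m + (k - off)) :: nat))"
  have off: "off \<le> 1" "off \<le> len" "Suc len - off \<le> m" using m by (auto simp: off_def len_def)
  have cost: "40 * (3 * m + 4) + 20 + (30 + (m * (20 * m + 100) + 10 +
     ((50 * m + 100) + ((m + 1) * (40 * m + 200) + 30 + 200)))) \<le> 2000 * (m * m)"
  proof -
    obtain k where "m = Suc k" using m by (cases m) auto
    then show ?thesis by (simp add: algebra_simps)
  qed
  let ?c = "com.If (Less (Reg ''l'') (Reg ''m'')) (''L'' ::= Reg ''l'' ;; ''f'' ::= Const 0) (''L'' ::= Reg ''m'' ;; ''f'' ::= Const 1)"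
  show ?thesis unfolding step_def
  proof (rule ht_seq[OF ht_decode_bits[OF env y i Kp] _ cost], goal_cases)
    case (1 s1)
    have env1: "senv m N Kp s1" by (rule senv_agree[OF 1(2) _ _ _ _ env]) simp_all
    have r1: "reg s1 ''l'' = l" "reg s1 ''c'' = of_bool cl" "reg s1 ''m'' = m"
      using agree_reg[OF 1(2)] l c env by (simp_all add: senv_def)
    have b1: "\<And>t. t < 3 * m + 4 \<Longrightarrow> arr s1 ''b'' t = of_bool (bit i t)" using 1(1) by simp
    have c1: "ht s1 ?c 30 (\<lambda>u. reg u ''L'' = len \<and> reg u ''f'' = off)"
      by (rule ht_run) (use r1 in \<open>auto simp: len_def off_def\<close>)
    show ?case
    proof (rule ht_seq[OF c1 _ order_refl], goal_cases)
      case (1 s2)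
      have env2: "senv m N Kp s2" by (rule senv_agree[OF 1(2) _ _ _ _ env1]) simp_all
      have r2: "reg s2 ''l'' = l" "reg s2 ''c'' = of_bool cl" "reg s2 ''m'' = m" "reg s2 ''L'' = len" "reg s2 ''f'' = off"
        using agree_reg[OF 1(2)] r1 1(1) by simp_all
      have b2: "\<And>t. t < 3 * m + 4 \<Longrightarrow> arr s2 ''b'' t = of_bool (bit i t)" using agree_arr[OF 1(2)] b1 by simp
      have dl: "ht s2 decode_labels (m * (20 * m + 100) + 10) (\<lambda>u. \<forall>k<len. arr u ''d'' k = d k)"
        using ht_decode_labels[OF r2(3,4) _ b2] unfolding d_def by (simp add: len_def)
      show ?case
      proof (rule ht_seq[OF dl _ order_refl], goal_cases)
        case (1 s3)
        have env3: "senv m N Kp s3" by (rule senv_agree[OF 1(2) _ _ _ _ env2]) simp_all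
        have r3: "reg s3 ''l'' = l" "reg s3 ''c'' = of_bool cl" "reg s3 ''m'' = m" "reg s3 ''L'' = len" "reg s3 ''f'' = off"
          using agree_reg[OF 1(2)] r2 by simp_all
        have b3: "\<And>t. t < 3 * m + 4 \<Longrightarrow> arr s3 ''b'' t = of_bool (bit i t)" using agree_arr[OF 1(2)] b2 by simp
        have R3: "arr s3 ''R'' l = l mod m" using env3 l by (simp add: senv_def)
        have nl: "ht s3 new_labels (50 * m + 100) (\<lambda>u. \<forall>k \<le> len.
            arr u ''g'' k = g k \<and> arr u ''c'' k = of_bool (((bit i)(len := cl)) k))"
          unfolding g_def len_def
          by (rule ht_new_labels[OF m]) (use r3 R3 b3 1(1) in \<open>auto simp: len_def off_def\<close>)
        show ?case
        proof (rule ht_seq[OF nl _ order_refl], goal_cases)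
          case (1 s4)
          have env4: "senv m N Kp s4" by (rule senv_agree[OF 1(2) _ _ _ _ env3]) simp_all
          have r4: "reg s4 ''L'' = len" "reg s4 ''f'' = off" using agree_reg[OF 1(2)] r3 by simp_all
          have b4: "\<And>t. t < 3 * m + 4 \<Longrightarrow> arr s4 ''b'' t = of_bool (bit i t)" using agree_arr[OF 1(2)] b3 by simp
          have nw: "ht s4 new_window ((m + 1) * (40 * m + 200) + 30) (\<lambda>u. reg u ''z'' = Z * Kp \<and> reg u ''D'' = of_bool dr)"
            unfolding Z_def dr_def by (rule ht_new_window[OF env4 r4(1,2) off]) (use 1(1) in auto)
          show ?case
          proof (rule ht_seq[OF nw _ order_refl], goal_cases)
            case (1 s5)
            have env5: "senv m N Kp s5" by (rule senv_agree[OF 1(2) _ _ _ _ env4]) simp_all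
            have b5: "\<And>t. t < 3 * m + 4 \<Longrightarrow> arr s5 ''b'' t = of_bool (bit i t)" using agree_arr[OF 1(2)] b4 by simp
            show ?case
              unfolding delta_eq[OF m, of l cl i, folded len_def, folded off_def d_def, folded g_def, folded dr_def Z_def]
              using ht_new_flags[OF env5 conjunct2[OF 1(1)] b5 conjunct1[OF 1(1)] refl] by simp
          qed
        qed
      qed
    qed
  qed
qed

section \<open>Grid bipartitions, bounds on the optimum, and rounding\<close>

definition node :: "nat \<Rightarrow> nat \<Rightarrow> nat \<times> nat" where
  "node m a = (a mod m + 1, a div m + 1)"

lemma inj_node: "0 < m \<Longrightarrow> inj_on (node m) A"
  by (rule inj_onI) (metis Suc_eq_plus1 mod_mult_div_eq nat.inject node_def prod.inject)

lemma node_image: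
  assumes m: "0 < m" shows "node m ` {..<m * n} = grid_nodes m n"
proof (intro equalityI subsetI)
  fix x assume "x \<in> node m ` {..<m * n}"
  then obtain a where a: "a < m * n" "x = node m a" by auto
  have "a div m < n" using a m by (simp add: less_mult_imp_div_less mult.commute)
  moreover have "a mod m < m" using m by simp
  ultimately show "x \<in> grid_nodes m n" using a by (auto simp: node_def grid_nodes_def)
next
  fix x assume "x \<in> grid_nodes m n"
  then obtain i j where x: "x = (i + 1, j + 1)" "i < m" "j < n"
    unfolding grid_nodes_def by (cases x) (auto, metis Suc_diff_le Suc_le_lessD Suc_pred' diff_Suc_1 less_eq_Suc_le)
  have "j * m + i < (j + 1) * m" using x by simp
  also have "\<dots> \<le> n * m" using x by (intro mult_le_mono1) simp
  finally have "j * m + i < m * n" by (simp add: mult.commute)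
  moreover have "node m (j * m + i) = x" using x by (simp add: node_def)
  ultimately show "x \<in> node m ` {..<m * n}" by (metis image_eqI lessThan_iff)
qed

definition cell_adj :: "nat \<Rightarrow> nat \<Rightarrow> nat \<Rightarrow> bool" where
  "cell_adj m a b \<longleftrightarrow> b = a + m \<or> a = b + m \<or> b = Suc a \<and> \<not> m dvd b \<or> a = Suc b \<and> \<not> m dvd a"

lemma node_adj:
  assumes m: "0 < m" and ab: "a < m * n" "b < m * n"
  shows "(node m a, node m b) \<in> parcs (grid_graph m n) \<longleftrightarrow> cell_adj m a b"
proof -
  have row: "a mod m = b mod m \<and> b div m = Suc (a div m) \<longleftrightarrow> b = a + m" for a b
  proof
    assume h: "a mod m = b mod m \<and> b div m = Suc (a div m)"
    have "b = m * (b div m) + b mod m" by simp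
    also have "\<dots> = m * (a div m) + a mod m + m" using h by (metis add.assoc add.commute mult_Suc_right)
    finally show "b = a + m" by simp
  next
    assume "b = a + m"
    then show "a mod m = b mod m \<and> b div m = Suc (a div m)" using m by simp
  qed
  have col: "a div m = b div m \<and> b mod m = Suc (a mod m) \<longleftrightarrow> b = Suc a \<and> \<not> m dvd b" for a b
  proof
    assume h: "a div m = b div m \<and> b mod m = Suc (a mod m)"
    have "b = m * (b div m) + b mod m" by simp
    also have "\<dots> = Suc (m * (a div m) + a mod m)" using h by simp
    finally have "b = Suc a" by simp
    then show "b = Suc a \<and> \<not> m dvd b" using h by (auto simp: dvd_eq_mod_eq_0)
  next
    assume h: "b = Suc a \<and> \<not> m dvd b"
    then have "Suc (a mod m) \<noteq> m" by (auto simp: mod_Suc dvd_eq_mod_eq_0)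
    then show "a div m = b div m \<and> b mod m = Suc (a mod m)"
      using h by (auto simp: mod_Suc div_Suc)
  qed
  have "node m a \<in> grid_nodes m n" "node m b \<in> grid_nodes m n" using node_image[OF m, of n] ab by auto
  then have "(node m a, node m b) \<in> parcs (grid_graph m n) \<longleftrightarrow>
     (a mod m = b mod m \<and> (b div m = Suc (a div m) \<or> a div m = Suc (b div m)) \<or>
      a div m = b div m \<and> (b mod m = Suc (a mod m) \<or> a mod m = Suc (b mod m)))"
    by (simp add: grid_graph_def node_def consecutive_def)
  also have "\<dots> \<longleftrightarrow> cell_adj m a b"
    unfolding cell_adj_def using row[of a b] row[of b a] col[of a b] col[of b a] by metis
  finally show ?thesis .
qed

text \<open>Connectedness is strong connectedness of the symmetric closure, with paths confined to
  the vertex set. For end points in \<open>U\<close> the confined closure is the ordinary one, as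
  all arcs of the induced graph stay inside \<open>U\<close>.\<close>

lemma connected_induced_iff:
  "Digraph_Component.connected (with_proj G \<restriction> U) \<longleftrightarrow>
     U \<noteq> {} \<and> (\<forall>u\<in>U. \<forall>v\<in>U. (u, v) \<in> {(x, y). x \<in> U \<and> y \<in> U \<and> ((x, y) \<in> parcs G \<or> (y, x) \<in> parcs G)}\<^sup>*)"
proof -
  let ?E = "{(x, y). x \<in> U \<and> y \<in> U \<and> ((x, y) \<in> parcs G \<or> (y, x) \<in> parcs G)}"
  have ends: "parcs (mk_symmetric (with_proj G \<restriction> U)) = ?E"
    by (auto simp: mk_symmetric_def induce_subgraph_def)
  have verts: "pverts (mk_symmetric (with_proj G \<restriction> U)) = U"
    by (simp add: mk_symmetric_def)
  have "(u, v) \<in> rtrancl_on U ?E \<longleftrightarrow> (u, v) \<in> ?E\<^sup>*" if "u \<in> U" "v \<in> U" for u v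
    using that rtrancl_on_rtranclI[of u v U ?E] rtrancl_consistent_rtrancl_on[of u v ?E U] by blast
  then show ?thesis
    unfolding connected_def strongly_connected_def reachable_def with_proj_simps ends verts by blast
qed

text \<open>Edges in \<open>cell_edges\<close> are monochromatic, so a path that starts in a colour
  class never leaves it. Paths among all cells and paths in the induced subgraph therefore
  correspond under \<open>node\<close>.\<close>

lemma connected_cells_iff:
  assumes m: "0 < m" and N: "N = m * n"
  shows "Digraph_Component.connected (with_proj (grid_graph m n) \<restriction> (node m ` {a. a < N \<and> c a = col})) \<longleftrightarrow>
    (\<exists>a<N. c a = col) \<and> (\<forall>a<N. \<forall>b<N. c a = col \<longrightarrow> c b = col \<longrightarrow> (a, b) \<in> (cell_edges m c N)\<^sup>*)"
proof -
  define S where "S = {a. a < N \<and> c a = col}"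
  define E where "E = {(x, y). x \<in> node m ` S \<and> y \<in> node m ` S \<and>
    ((x, y) \<in> parcs (grid_graph m n) \<or> (y, x) \<in> parcs (grid_graph m n))}"
  have adj: "(node m a, node m b) \<in> E \<longleftrightarrow> (a, b) \<in> cell_edges m c N" if "a \<in> S" "b \<in> S" for a b
  proof -
    have "cell_adj m a b \<longleftrightarrow> cell_adj m b a" by (auto simp: cell_adj_def)
    then show ?thesis
      using that node_adj[OF m, of a n b] node_adj[OF m, of b n a]
      by (auto simp: E_def S_def N cell_edges_def cell_adj_def)
  qed
  have 1: "(node m a, node m b) \<in> E\<^sup>* \<and> b \<in> S" if "(a, b) \<in> (cell_edges m c N)\<^sup>*" "a \<in> S" for a b
    using that
  proof (induction rule: rtrancl_induct)
    case (step b d)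
    then have "d \<in> S" by (auto simp: S_def cell_edges_def)
    then show ?case using step adj[of b d] by (meson rtrancl.rtrancl_into_rtrancl)
  qed simp
  have 2: "\<exists>b\<in>S. y = node m b \<and> (a, b) \<in> (cell_edges m c N)\<^sup>*" if "(node m a, y) \<in> E\<^sup>*" "a \<in> S" for a y
    using that
  proof (induction rule: rtrancl_induct)
    case (step y z)
    then obtain b where b: "b \<in> S" "y = node m b" "(a, b) \<in> (cell_edges m c N)\<^sup>*" by auto
    obtain d where d: "d \<in> S" "z = node m d" using step by (auto simp: E_def)
    have "(b, d) \<in> cell_edges m c N" using adj[OF b(1) d(1)] step b d by simp
    with b(3) have "(a, d) \<in> (cell_edges m c N)\<^sup>*" by (rule rtrancl.rtrancl_into_rtrancl)
    then show ?case using d by blast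
  qed auto
  have eq: "(node m a, node m b) \<in> E\<^sup>* \<longleftrightarrow> (a, b) \<in> (cell_edges m c N)\<^sup>*" if "a \<in> S" "b \<in> S" for a b
    using 1[of a b] 2[of a "node m b"] inj_node[OF m, of UNIV] that by (metis UNIV_I inj_onD)
  show ?thesis
    unfolding connected_induced_iff S_def[symmetric] E_def[symmetric] using eq by (auto simp: S_def)
qed

definition cells_of :: "nat \<Rightarrow> nat \<Rightarrow> (nat \<Rightarrow> bool) \<Rightarrow> (nat \<times> nat) set" where
  "cells_of m N c = node m ` {a. a < N \<and> c a}"

lemma cells_of_compl:
  assumes m: "0 < m" and N: "N = m * n"
  shows "grid_nodes m n - cells_of m N c = node m ` {a. a < N \<and> \<not> c a}"
proof -
  have "grid_nodes m n = node m ` {..<N}" using node_image[OF m, of n] N by simp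
  then have "grid_nodes m n - cells_of m N c = node m ` ({..<N} - {a. a < N \<and> c a})"
    unfolding cells_of_def by (simp add: image_set_diff[OF inj_node[OF m, of UNIV]])
  also have "{..<N} - {a. a < N \<and> c a} = {a. a < N \<and> \<not> c a}" by auto
  finally show ?thesis .
qed

lemma connected_bipartition_iff_accept:
  assumes m: "0 < m" and n: "0 < n" and N: "N = m * n"
  shows "connected_bipartition m n (cells_of m N c) \<longleftrightarrow> accept m (enc_bits m c N)"
proof -
  have mN: "m \<le> N" using n N by simp
  have sub: "cells_of m N c \<subseteq> grid_nodes m n" using node_image[OF m, of n] N by (auto simp: cells_of_def)
  have T: "cells_of m N c = node m ` {a. a < N \<and> c a = True}" by (simp add: cells_of_def)
  have F: "grid_nodes m n - cells_of m N c = node m ` {a. a < N \<and> c a = False}"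
    using cells_of_compl[OF m N] by simp
  have ne: "Digraph_Component.connected (with_proj G \<restriction> U) \<Longrightarrow> U \<noteq> {}" for G :: "(nat \<times> nat) pair_pre_digraph" and U
    by (simp add: connected_induced_iff)
  have ab: "(\<forall>col. R col) \<longleftrightarrow> R True \<and> R False" for R :: "bool \<Rightarrow> bool"
    by (metis (full_types))
  have "connected_bipartition m n (cells_of m N c) \<longleftrightarrow>
    Digraph_Component.connected (with_proj (grid_graph m n) \<restriction> (cells_of m N c)) \<and>
     Digraph_Component.connected (with_proj (grid_graph m n) \<restriction> (grid_nodes m n - cells_of m N c))"
    unfolding connected_bipartition_def using sub ne by blast
  also have "\<dots> \<longleftrightarrow> accept m (enc_bits m c N)"
    unfolding F accept_enc_bits[OF m mN] ab connected_cells_iff[OF m N, of c True, folded T] connected_cells_iff[OF m N, of c False] ..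
  finally show ?thesis .
qed

lemma ex_coloring:
  assumes m: "0 < m" and N: "N = m * n" and U: "U \<subseteq> grid_nodes m n"
  shows "\<exists>c. U = cells_of m N c"
proof (intro exI)
  show "U = cells_of m N (\<lambda>a. node m a \<in> U)" 
    using U unfolding cells_of_def node_image[OF m, of n, symmetric] N by blast
qed

section \<open>Values of colourings\<close>

definition cval :: "nat \<Rightarrow> (nat \<Rightarrow> nat) \<Rightarrow> (nat \<Rightarrow> bool) \<Rightarrow> nat" where
  "cval N v c = min (\<Sum>a<N. of_bool (c a) * v a) ((\<Sum>a<N. v a) - (\<Sum>a<N. of_bool (c a) * v a))"

lemma sum_compl:
  fixes v :: "nat \<Rightarrow> nat"
  shows "(\<Sum>a<N. of_bool (c a) * v a) + (\<Sum>a<N. of_bool (\<not> c a) * v a) = (\<Sum>a<N. v a)"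
  unfolding sum.distrib[symmetric] by (rule sum.cong) auto

lemma bipartition_value_cells:
  assumes m: "0 < m" and N: "N = m * n"
  shows "bipartition_value m n w (cells_of m N c) = cval N (\<lambda>a. w (node m a)) c"
proof -
  have s: "sum w (node m ` {a. a < N \<and> P a}) = (\<Sum>a<N. of_bool (P a) * w (node m a))" for P
  proof -
    have "sum w (node m ` {a. a < N \<and> P a}) = (\<Sum>a\<in>{a. a < N \<and> P a}. w (node m a))"
      by (subst sum.reindex[OF inj_node[OF m]]) simp
    also have "\<dots> = (\<Sum>a<N. of_bool (P a) * w (node m a))"
      by (rule sum.mono_neutral_cong_left) auto
    finally show ?thesis .
  qed
  show ?thesis
    unfolding bipartition_value_def cells_of_compl[OF m N] cval_def
    using s[of c] s[of "\<lambda>a. \<not> c a"] sum_compl[of c "\<lambda>a. w (node m a)" N] by (simp add: cells_of_def)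
qed

definition good :: "nat \<Rightarrow> nat \<Rightarrow> (nat \<Rightarrow> bool) \<Rightarrow> bool" where
  "good m N c \<longleftrightarrow> accept m (enc_bits m c N)"

lemma good_iff:
  assumes m: "0 < m" and N: "m \<le> N"
  shows "good m N c \<longleftrightarrow> (\<forall>col. (\<exists>a<N. c a = col) \<and>
       (\<forall>a<N. \<forall>b<N. c a = col \<longrightarrow> c b = col \<longrightarrow> (a, b) \<in> (cell_edges m c N)\<^sup>*))"
  unfolding good_def by (rule accept_enc_bits[OF m N])

lemma good_compl:
  assumes m: "0 < m" and N: "m \<le> N" and c: "good m N c"
  shows "good m N (\<lambda>a. \<not> c a)"
proof -
  have "cell_edges m (\<lambda>a. \<not> c a) N = cell_edges m c N" by (auto simp: cell_edges_def)
  moreover have "(\<not> c a) = col \<longleftrightarrow> c a = (\<not> col)" for a col by auto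
  ultimately show ?thesis using c unfolding good_iff[OF m N] by (metis (no_types))
qed

text \<open>From any cell of the prefix one can walk to cell \<open>0\<close>, moving by
  \<open>m\<close> to the previous column and, in the first column, by one; all cells on the way are
  smaller. The rest walks to cell \<open>N - 1\<close> in the mirrored fashion.\<close>

lemma good_prefix:
  assumes m: "0 < m" and n: "0 < n" and N: "N = m * n" and k: "0 < k" "k < N"
  shows "good m N (\<lambda>a. a < k)"
proof -
  let ?c = "\<lambda>a. a < k"
  let ?R = "(cell_edges m ?c N)\<^sup>*"
  have mN: "m \<le> N" using n N by simp
  have sy: "(y, x) \<in> ?R" if "(x, y) \<in> ?R" for x y
    using that sym_rtrancl[OF sym_cell_edges] by (meson symD)
  have lo: "(a, 0) \<in> ?R" if "a < k" for a
    using that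
  proof (induction a rule: less_induct)
    case (less a)
    show ?case
    proof (cases "a = 0")
      case False
      define b where "b = (if m \<le> a then a - m else a - 1)"
      have b: "b < a" using False m by (auto simp: b_def)
      have "\<not> m dvd a" if "a < m" using that False by (auto dest: dvd_imp_le)
      then have "(a, b) \<in> cell_edges m ?c N"
        using less.prems b k False m unfolding b_def cell_edges_def by (auto split: if_splits)
      then show ?thesis using less.IH[OF b] b less.prems by (meson converse_rtrancl_into_rtrancl less_trans)
    qed simp
  qed
  \<comment> \<open>Here \<open>a\<close> is the distance to the last cell, so the same descent from
    \<open>a\<close> to \<open>b\<close> can be reused.\<close>
  have hi: "(N - Suc a, N - 1) \<in> ?R" if "a < N" "k \<le> N - Suc a" for a
    using that
  proof (induction a rule: less_induct)
    case (less a)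
    show ?case
    proof (cases "a = 0")
      case False
      define b where "b = (if m \<le> a then a - m else a - 1)"
      have b: "b < a" using False m by (auto simp: b_def)
      have ab: "N - Suc b = (if m \<le> a then N - Suc a + m else Suc (N - Suc a))"
        using False less.prems m by (auto simp: b_def)
      have "\<not> m dvd N - a" if "a < m"
      proof
        assume "m dvd N - a"
        moreover have "m dvd N" by (simp add: N)
        ultimately have "m dvd a" using less.prems(1) by (metis dvd_diffD1 less_imp_le)
        then show False using that False by (auto dest: dvd_imp_le)
      qed
      moreover have "Suc (N - Suc a) = N - a" using less.prems by simp
      ultimately have "(N - Suc a, N - Suc b) \<in> cell_edges m ?c N"
        using less.prems b k False m unfolding ab cell_edges_def by auto
      then show ?thesis using less.IH[OF b] b less.prems
        by (meson converse_rtrancl_into_rtrancl diff_le_mono2 le_trans less_imp_le less_trans Suc_le_mono)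
    qed simp
  qed
  have hi': "(a, N - 1) \<in> ?R" if "a < N" "k \<le> a" for a
    using hi[of "N - Suc a"] that by simp
  show ?thesis unfolding good_iff[OF m mN]
  proof
    fix col
    have "\<exists>a<N. (a < k) = col" using k by (cases col) (auto intro: exI[of _ 0] exI[of _ k])
    moreover have "(a, b) \<in> ?R" if "a < N" "b < N" "(a < k) = col" "(b < k) = col" for a b
    proof (cases col)
      case True
      then show ?thesis using lo[of a] lo[of b] sy that by (meson rtrancl_trans)
    next
      case False
      then show ?thesis using hi'[of a] hi'[of b] sy that by (meson not_less rtrancl_trans)
    qed
    ultimately show "(\<exists>a<N. (a < k) = col) \<and> (\<forall>a<N. \<forall>b<N. (a < k) = col \<longrightarrow> (b < k) = col \<longrightarrow> (a, b) \<in> ?R)"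
      by blast
  qed
qed

section \<open>Bounds on the optimum\<close>

lemma OPT_props:
  fixes w :: "nat \<times> nat \<Rightarrow> nat"
  assumes m: "0 < m" and n: "0 < n" and N: "N = m * n" "2 \<le> N"
  defines "v \<equiv> \<lambda>a. w (node m a)"
  shows "\<exists>c. good m N c \<and> OPT m n w = cval N v c" and "\<And>c. good m N c \<Longrightarrow> cval N v c \<le> OPT m n w"
proof -
  let ?S = "{bipartition_value m n w U |U. connected_bipartition m n U}"
  have S: "?S = {cval N v c |c. good m N c}"
  proof (intro equalityI subsetI)
    fix x assume "x \<in> ?S"
    then obtain U where U: "x = bipartition_value m n w U" "connected_bipartition m n U" by blast
    obtain c where "U = cells_of m N c"
      using ex_coloring[OF m N(1), of U] U(2) by (auto simp: connected_bipartition_def)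
    then show "x \<in> {cval N v c |c. good m N c}"
      using U bipartition_value_cells[OF m N(1), of w c] connected_bipartition_iff_accept[OF m n N(1), of c]
      unfolding v_def good_def by auto
  next
    fix x assume "x \<in> {cval N v c |c. good m N c}"
    then obtain c where "x = cval N v c" "good m N c" by blast
    then have "x = bipartition_value m n w (cells_of m N c)" "connected_bipartition m n (cells_of m N c)"
      using bipartition_value_cells[OF m N(1), of w c] connected_bipartition_iff_accept[OF m n N(1), of c]
      unfolding v_def good_def by auto
    then show "x \<in> ?S" by blast
  qed
  have fin: "finite {cval N v c |c. good m N c}"
    by (rule finite_subset[of _ "{..\<Sum>a<N. v a}"]) (auto simp: cval_def)
  have ne: "{cval N v c |c. good m N c} \<noteq> {}" using good_prefix[OF m n N(1), of 1] N(2) by auto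
  show "\<exists>c. good m N c \<and> OPT m n w = cval N v c" using Max_in[OF fin ne] unfolding OPT_def S by auto
  show "cval N v c \<le> OPT m n w" if "good m N c" for c
    unfolding OPT_def S using Max_ge[OF fin] that by blast
qed

text \<open>For the last bound take the shortest prefix that weighs at least half of
  \<open>B\<close>. Its last cell weighs at most \<open>v h\<close>, so the prefix stays below
  \<open>v h\<close> plus half of \<open>B\<close>; out of the total \<open>B + v h\<close>, more
  than half of \<open>B\<close> remains for the other side.\<close>

lemma OPT_bounds:
  fixes w :: "nat \<times> nat \<Rightarrow> nat"
  assumes m: "0 < m" and n: "0 < n" and N: "N = m * n" "2 \<le> N"
  defines "v \<equiv> \<lambda>a. w (node m a)"
  assumes pos: "\<And>a. a < N \<Longrightarrow> 0 < v a" and h: "h < N" and max: "\<And>a. a < N \<Longrightarrow> v a \<le> v h"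
  defines "B \<equiv> (\<Sum>a<N. v a) - v h"
  shows "0 < B" and "OPT m n w \<le> B" and "B \<le> 2 * OPT m n w"
proof -
  define W where "W = (\<Sum>a<N. v a)"
  have Wh: "W = v h + (\<Sum>a\<in>{..<N} - {h}. v a)" unfolding W_def using h by (subst sum.remove[of _ h]) auto
  have "\<exists>a<N. a \<noteq> h" using N(2) by (intro exI[of _ "if h = 0 then 1 else 0"]) auto
  then obtain a where a: "a < N" "a \<noteq> h" by blast
  have "v a \<le> (\<Sum>a\<in>{..<N} - {h}. v a)" using a by (intro member_le_sum) auto
  then show B0: "0 < B" using pos[OF a(1)] Wh by (simp add: B_def W_def[symmetric])
  have BW: "W = B + v h" using Wh by (simp add: B_def W_def[symmetric])
  obtain c where c: "good m N c" "OPT m n w = cval N v c" using OPT_props(1)[OF m n N, of w] unfolding v_def by blast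
  have "cval N v c \<le> B"
  proof -
    have le: "v h \<le> (\<Sum>a<N. of_bool (P a) * v a)" if "P h" for P
      using member_le_sum[of h "{..<N}" "\<lambda>a. of_bool (P a) * v a"] h that by simp
    show ?thesis using le[of c] le[of "\<lambda>a. \<not> c a"] sum_compl[of c v N] BW
      unfolding cval_def W_def[symmetric] by (cases "c h") auto
  qed
  then show "OPT m n w \<le> B" using c by simp
  define k where "k = (LEAST k. B \<le> 2 * (\<Sum>a<k. v a))"
  have kN: "B \<le> 2 * (\<Sum>a<N. v a)" using BW by (simp add: W_def)
  then have k: "B \<le> 2 * (\<Sum>a<k. v a)" unfolding k_def by (rule LeastI)
  have k0: "0 < k" using k B0 by (cases k) auto
  have kmin: "2 * (\<Sum>a<k - 1. v a) < B" using not_less_Least[of "k - 1" "\<lambda>k. B \<le> 2 * (\<Sum>a<k. v a)"] k0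
    unfolding k_def by auto
  have kle: "k \<le> N" unfolding k_def using kN by (rule Least_le)
  have sk: "(\<Sum>a<k. v a) = (\<Sum>a<k - 1. v a) + v (k - 1)" using k0 by (cases k) auto
  have up: "2 * (\<Sum>a<k. v a) < B + 2 * v h" 
  proof -
    have "v (k - 1) \<le> v h" by (rule max) (use kle k0 in linarith)
    then show ?thesis using kmin sk by linarith
  qed
  \<comment> \<open>For \<open>k = N\<close> the left side of \<open>up\<close> would be
    \<open>2 * B + 2 * v h\<close>, which is too large as \<open>B\<close> is positive.\<close>
  have "k \<noteq> N" using up BW B0 unfolding W_def by auto
  then have kl: "k < N" using kle by simp
  have "(\<Sum>a<N. of_bool (a < k) * v a) = (\<Sum>a<k. v a)"
    by (rule sum.mono_neutral_cong_right) (use kl in auto)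
  then have "B \<le> 2 * cval N v (\<lambda>a. a < k)" using k up BW unfolding cval_def W_def[symmetric] by auto
  then show "B \<le> 2 * OPT m n w"
    using OPT_props(2)[OF m n N good_prefix[OF m n N(1) k0 kl], of w] unfolding v_def by simp
qed

text \<open>
  For \<open>x \<le> K\<close> this says that \<open>x\<close> is \<open>v * K / B\<close> rounded down (up to the boundary case); a larger \<open>x\<close>, only possible for
  \<open>v > B\<close>, marks a cell that cannot lie on the lighter side of an optimum.
\<close>

definition rounded :: "nat \<Rightarrow> nat \<Rightarrow> nat \<Rightarrow> nat \<Rightarrow> bool" where
  "rounded K B v x \<longleftrightarrow> x * B \<le> v * K \<and> (x \<le> K \<longrightarrow> v * K \<le> (x + 1) * B)"

text \<open>Each cell loses at most \<open>B / K\<close>, so equal rounded weights determine the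
  true weight up to \<open>N * B / K\<close>. The factor \<open>2\<close> in \<open>K\<close>
  cancels the factor lost in \<open>B \<le> 2 * Opt\<close>. The weight of \<open>d\<close> is thus
  close to \<open>Opt\<close> from both sides, and each side of \<open>d\<close> needs one of the
  two estimates.\<close>

lemma rounding_bound:
  fixes v ws :: "nat \<Rightarrow> nat"
  assumes W: "W = (\<Sum>a<N. v a)" and B: "0 < B" "Opt \<le> B" "B \<le> 2 * Opt" and K: "K = 2 * N * (1 + k)" and N: "0 < N"
    and ws: "\<And>a. a < N \<Longrightarrow> rounded K B (v a) (ws a)"
    and opt: "(\<Sum>a<N. of_bool (c a) * v a) = Opt" "2 * Opt \<le> W"
  shows "(\<Sum>a<N. of_bool (c a) * ws a) \<le> K"
    and "(\<Sum>a<N. of_bool (d a) * ws a) = (\<Sum>a<N. of_bool (c a) * ws a) \<Longrightarrow> k * Opt \<le> (1 + k) * cval N v d"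
proof -
  have ws1: "ws a * B \<le> v a * K" and ws2: "ws a \<le> K \<Longrightarrow> v a * K \<le> (ws a + 1) * B" if "a < N" for a
    using ws[OF that] by (auto simp: rounded_def)
  have lower: "(\<Sum>a<N. of_bool (c a) * ws a) * B \<le> (\<Sum>a<N. of_bool (c a) * v a) * K" for c
    unfolding sum_distrib_right by (rule sum_mono) (use ws1 in auto)
  define X where "X = (\<Sum>a<N. of_bool (c a) * ws a)"
  have XB: "X * B \<le> Opt * K" using lower[of c] opt by (simp add: X_def)
  also have "\<dots> \<le> B * K" using B by simp
  finally show XK: "(\<Sum>a<N. of_bool (c a) * ws a) \<le> K" using B by (simp add: X_def mult.commute)
  assume d: "(\<Sum>a<N. of_bool (d a) * ws a) = (\<Sum>a<N. of_bool (c a) * ws a)"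
  define A where "A = (\<Sum>a<N. of_bool (d a) * v a)"
  \<comment> \<open>A rounded total of at most \<open>K\<close> bounds every selected
    \<open>ws a\<close> by \<open>K\<close>, which rules out capped entries and makes the upper half
    of \<open>rounded\<close> applicable.\<close>
  have upper: "(\<Sum>a<N. of_bool (c a) * v a) * K \<le> ((\<Sum>a<N. of_bool (c a) * ws a) + N) * B"
    if le: "(\<Sum>a<N. of_bool (c a) * ws a) \<le> K" for c
  proof -
    have "of_bool (c a) * v a * K \<le> (of_bool (c a) * ws a + 1) * B" if a: "a < N" for a
    proof (cases "c a")
      case True
      have "of_bool (c a) * ws a \<le> (\<Sum>a<N. of_bool (c a) * ws a)" using a by (intro member_le_sum) auto
      then have "ws a \<le> K" using True le by simp
      then show ?thesis using ws2[OF a] True by simp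
    qed simp
    then have "(\<Sum>a<N. of_bool (c a) * v a) * K \<le> (\<Sum>a<N. (of_bool (c a) * ws a + 1) * B)"
      unfolding sum_distrib_right by (intro sum_mono) auto
    also have "\<dots> = ((\<Sum>a<N. of_bool (c a) * ws a) + N) * B"
      unfolding sum_distrib_right[symmetric] sum.distrib by simp
    finally show ?thesis .
  qed
  have o: "Opt * K \<le> X * B + N * B" using upper[OF XK] opt by (simp add: X_def algebra_simps)
  have a1: "X * B \<le> A * K" using lower[of d] d by (simp add: X_def A_def)
  have a2: "A * K \<le> X * B + N * B" using upper[of d] XK d by (simp add: X_def A_def algebra_simps)
  have NB: "N * B \<le> 2 * N * Opt" using B N by simp
  \<comment> \<open>Division by \<open>2 * N\<close>, after which the rounding error is a single
    \<open>Opt\<close>.\<close>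
  have cancel: "x * (1 + k) \<le> y * (1 + k) + Opt" if "x * K \<le> y * K + N * B" for x y
  proof -
    have "(2 * N) * (x * (1 + k)) \<le> (2 * N) * (y * (1 + k) + Opt)"
    proof -
      have "(2 * N) * (x * (1 + k)) = x * K" "(2 * N) * (y * (1 + k) + Opt) = y * K + 2 * N * Opt"
        unfolding K by (simp_all add: algebra_simps)
      then show ?thesis using that NB by linarith
    qed
    then show ?thesis using N by simp
  qed
  have 1: "Opt * (1 + k) \<le> A * (1 + k) + Opt" by (rule cancel) (use o a1 in linarith)
  have 2: "A * (1 + k) \<le> Opt * (1 + k) + Opt" by (rule cancel) (use a2 XB in linarith)
  have "k * Opt \<le> (1 + k) * A" using 1 by (simp add: algebra_simps)
  \<comment> \<open>The complement must not become too light either: \<open>A\<close> exceeds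
    \<open>Opt\<close> by at most \<open>Opt / (1 + k)\<close>, while the total is at least
    \<open>2 * Opt\<close>.\<close>
  moreover have "k * Opt \<le> (1 + k) * (W - A)"
  proof -
    have "A \<le> W" unfolding A_def W by (rule sum_mono) simp
    then obtain D where D: "W = A + D" using le_Suc_ex by blast
    have "2 * Opt * (1 + k) \<le> (A + D) * (1 + k)" using opt(2) D by (intro mult_le_mono1) simp
    then have "k * Opt \<le> (1 + k) * D" using 2 by (simp add: algebra_simps)
    then show ?thesis using D by simp
  qed
  ultimately show "k * Opt \<le> (1 + k) * cval N v d"
    unfolding cval_def A_def[symmetric] W[symmetric] by (simp add: min_def)
qed

text \<open>Invariant of the outer search after the rounded weights below \<open>x\<close>. As long
  as \<open>V = 0\<close> no colouring need have been stored, so the array is meaningful only for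
  positive \<open>V\<close>.\<close>

definition best_found :: "nat \<Rightarrow> nat \<Rightarrow> (nat \<Rightarrow> nat) \<Rightarrow> (nat \<Rightarrow> nat) \<Rightarrow> (nat \<Rightarrow> nat) \<Rightarrow> nat \<Rightarrow> nat \<Rightarrow> (nat \<Rightarrow> nat) \<Rightarrow> bool" where
  "best_found m N ws v pos x V U \<longleftrightarrow>
     (\<forall>x'<x. feas m N ws N 0 x' \<longrightarrow> (\<exists>c. good m N c \<and> (\<Sum>a<N. of_bool (c a) * ws a) = x' \<and> cval N v c \<le> V)) \<and>
     (0 < V \<longrightarrow> (\<exists>c. good m N c \<and> cval N v c = V \<and> (\<forall>a<N. U (pos a) = of_bool (c a))))"

lemma best_found_skip:
  "best_found m N ws v pos x V U \<Longrightarrow> \<not> feas m N ws N 0 x \<Longrightarrow> best_found m N ws v pos (Suc x) V U"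
  by (auto simp: best_found_def less_Suc_eq)

lemma best_found_update:
  assumes b: "best_found m N ws v pos x V U" and c: "good m N c" "(\<Sum>a<N. of_bool (c a) * ws a) = x"
    and V': "V' = max V (cval N v c)"
    and U': "if V < cval N v c then \<forall>a<N. U' (pos a) = of_bool (c a) else U' = U"
  shows "best_found m N ws v pos (Suc x) V' U'"
  unfolding best_found_def
proof (intro conjI allI impI)
  fix x' assume x': "x' < Suc x" "feas m N ws N 0 x'"
  show "\<exists>c. good m N c \<and> (\<Sum>a<N. of_bool (c a) * ws a) = x' \<and> cval N v c \<le> V'"
  proof (cases "x' = x")
    case True
    then show ?thesis using c V' by (intro exI[of _ c]) auto
  next
    case False
    then obtain d where "good m N d" "(\<Sum>a<N. of_bool (d a) * ws a) = x'" "cval N v d \<le> V"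
      using b x' unfolding best_found_def by (metis less_SucE)
    then show ?thesis using V' by (intro exI[of _ d]) auto
  qed
next
  assume "0 < V'"
  then show "\<exists>c. good m N c \<and> cval N v c = V' \<and> (\<forall>a<N. U' (pos a) = of_bool (c a))"
    using b c V' U' unfolding best_found_def by (cases "V < cval N v c") (auto intro!: exI[of _ c])
qed

lemma best_found_approx:
  fixes w :: "nat \<times> nat \<Rightarrow> nat"
  assumes m: "0 < m" and n: "0 < n" and N: "N = m * n" "2 \<le> N" and v_def: "\<And>a. v a = w (node m a)"
    and vpos: "\<And>a. a < N \<Longrightarrow> 0 < v a" and h: "h < N" "\<And>a. a < N \<Longrightarrow> v a \<le> v h" and r: "0 < r"
    and K: "K = 2 * N * (1 + r)" and ws: "\<And>a. a < N \<Longrightarrow> rounded K ((\<Sum>a<N. v a) - v h) (v a) (ws a)"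
    and best: "best_found m N ws v pos (K + 1) V U"
  shows "\<exists>f. good m N f \<and> (\<forall>a<N. U (pos a) = of_bool (f a)) \<and> r * OPT m n w \<le> (1 + r) * cval N v f"
proof -
  have bounds: "0 < (\<Sum>a<N. v a) - v h" "OPT m n w \<le> (\<Sum>a<N. v a) - v h" "(\<Sum>a<N. v a) - v h \<le> 2 * OPT m n w"
    using OPT_bounds[OF m n N, of w h, folded v_def] vpos h by blast+
  have mN: "m \<le> N" and N0: "0 < N" using m n N by simp_all
  obtain c0 where c0: "good m N c0" "OPT m n w = cval N v c0"
    using OPT_props(1)[OF m n N, of w, folded v_def] by blast
  \<comment> \<open>An optimal colouring, complemented if necessary, so that the selected side is
    the lighter one and weighs exactly the optimum.\<close>
  obtain c where c: "good m N c" "(\<Sum>a<N. of_bool (c a) * v a) = OPT m n w" "2 * OPT m n w \<le> (\<Sum>a<N. v a)"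
  proof -
    define A where "A = (\<Sum>a<N. of_bool (c0 a) * v a)"
    define A' where "A' = (\<Sum>a<N. of_bool (\<not> c0 a) * v a)"
    define W where "W = (\<Sum>a<N. v a)"
    have AA: "A + A' = W" using sum_compl[of c0 v N] by (simp only: A_def A'_def W_def)
    have Opt: "OPT m n w = min A (W - A)" unfolding c0(2) cval_def A_def W_def ..
    show ?thesis
    proof (cases "A \<le> A'")
      case True
      then have "A = OPT m n w" "2 * OPT m n w \<le> W" using AA Opt by auto
      then show ?thesis using that[OF c0(1)] unfolding A_def W_def by blast
    next
      case False
      then have "A' = OPT m n w" "2 * OPT m n w \<le> W" using AA Opt by auto
      then show ?thesis using that[OF good_compl[OF m mN c0(1)]] unfolding A'_def W_def by blast
    qed
  qed
  note rb = rounding_bound[OF refl bounds K N0 ws c(2,3)]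
  have "feas m N ws N 0 (\<Sum>a<N. of_bool (c a) * ws a)"
    using feas_enc[OF m c(1)[unfolded good_def], of N ws] by (simp add: enc_0 lessThan_atLeast0)
  moreover have "(\<Sum>a<N. of_bool (c a) * ws a) \<le> K" by (rule rb(1))
  ultimately obtain d where d: "good m N d" "(\<Sum>a<N. of_bool (d a) * ws a) = (\<Sum>a<N. of_bool (c a) * ws a)" "cval N v d \<le> V"
    using best unfolding best_found_def by (metis less_Suc_eq_le Suc_eq_plus1)
  have "r * OPT m n w \<le> (1 + r) * cval N v d" by (rule rb(2)[OF _ d(2)])
  also have "\<dots> \<le> (1 + r) * V" using d(3) by (rule mult_le_mono2)
  finally have ap: "r * OPT m n w \<le> (1 + r) * V" .
  \<comment> \<open>Positivity of the optimum carries over to \<open>V\<close>, which certifies that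
    the output array holds a colouring.\<close>
  have "0 < OPT m n w" using bounds by linarith
  then have "0 < V" using ap r by (cases V) auto
  then show ?thesis using best ap unfolding best_found_def by blast
qed

section \<open>The dynamic program\<close>

text \<open>Determinism of the automaton: each state is \<open>delta\<close> of its predecessor and
  of one colour, so the colours read so far determine it.\<close>

lemma enc_cong: "0 < m \<Longrightarrow> (\<And>a. a < l \<Longrightarrow> c a = c' a) \<Longrightarrow> enc m c l = enc m c' l"
proof (induction l)
  case (Suc l)
  have "enc m c l = enc m c' l" using Suc.IH Suc.prems by simp
  then show ?case
    using delta_enc[OF Suc.prems(1), of l c] delta_enc[OF Suc.prems(1), of l c'] Suc.prems(2)[of l]
    by simp
qed (simp add: enc_0)

section \<open>Testing acceptance\<close>

abbreviation check_body :: com where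
  "check_body \<equiv>
     when (Equal (Fetch ''b'' (Plus (Reg ''m'') (Reg ''k''))) (Const 0))
       (com.If (Equal (Fetch ''b'' (Reg ''k'')) (Const 1))
         (''x'' ::= Plus (Reg ''x'') (Const 1)) (''u'' ::= Plus (Reg ''u'') (Const 1)))"

abbreviation check_end :: com where
  "check_end \<equiv>
     ''t'' ::= Plus (Reg ''m'') (Plus (Reg ''m'') (Reg ''m'')) ;; ''e'' ::= Const 0 ;;
     when (And (And (Equal (Fetch ''b'' (Plus (Reg ''t'') (Const 1))) (Const 0))
            (Equal (Fetch ''b'' (Plus (Reg ''t'') (Const 3))) (Const 0)))
          (And (Equal (Plus (Reg ''u'') (Fetch ''b'' (Reg ''t''))) (Const 1))
            (Equal (Plus (Reg ''x'') (Fetch ''b'' (Plus (Reg ''t'') (Const 2)))) (Const 1))))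
       (''e'' ::= Const 1)"

definition check :: com where
  "check = decode_bits ;; (''u'' ::= Const 0 ;; ''x'' ::= Const 0) ;; For ''k'' ''m'' check_body ;; check_end"

lemma mod_check [simp]:
  "mod_regs check = {''u'', ''x'', ''t'', ''i'', ''k'', ''e''}" "mod_arrs check = {''b''}"
  by (auto simp: check_def)

lemma ht_check:
  assumes m: "0 < m" and env: "senv m N Kp s" and y: "reg s ''y'' = i * Kp" and i: "i < 2 ^ (3 * m + 4)" and Kp: "0 < Kp"
  shows "ht s check (1000 * m) (\<lambda>u. reg u ''e'' = of_bool (accept m (bit i)))"
proof -
  let ?b = "bit i"
  have cost: "40 * (3 * m + 4) + 20 + (6 + (m * 40 + 6 + 60)) \<le> 1000 * m" using m by simp
  show ?thesis unfolding check_def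
  proof (rule ht_seq[OF ht_decode_bits[OF env y i Kp] _ cost])
    fix s1 assume b1: "\<forall>t<3 * m + 4. arr s1 ''b'' t = of_bool (?b t)"
      and ag: "frame decode_bits s s1"
    have m1: "reg s1 ''m'' = m" using agree_reg[OF ag] env by (simp add: senv_def)
    let ?s = "run (''u'' ::= Const 0 ;; ''x'' ::= Const 0) s1"
    have s: "reg ?s ''m'' = m" "arr ?s = arr s1" "reg ?s ''u'' = 0" "reg ?s ''x'' = 0" using m1 by simp_all
    let ?A = "\<lambda>k. {j. j < k \<and> \<not> ?b j \<and> \<not> ?b (m + j)}" and ?B = "\<lambda>k. {j. j < k \<and> ?b j \<and> \<not> ?b (m + j)}"
    let ?I = "\<lambda>k u. reg u ''u'' = card (?A k) \<and> reg u ''x'' = card (?B k)"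
    show "ht s1 ((''u'' ::= Const 0 ;; ''x'' ::= Const 0) ;; For ''k'' ''m'' check_body ;; check_end)
      (6 + (m * 40 + 6 + 60)) (\<lambda>u. reg u ''e'' = of_bool (accept m ?b))"
    proof (rule ht_seq_run)
      show "ht ?s (For ''k'' ''m'' check_body ;; check_end) (m * 40 + 6 + 60) (\<lambda>u. reg u ''e'' = of_bool (accept m ?b))"
      proof (rule ht_seq)
        show "ht ?s (For ''k'' ''m'' check_body) (m * 40 + 6) (?I m)"
        proof (rule ht_for[where n = m and I = ?I and T = 32])
          fix k u assume k: "k < m" and ag: "loop_frame ''k'' check_body ?s u"
            and uk: "reg u ''k'' = k" and I: "?I k u"
          have "m + k < 3 * m + 4" "k < 3 * m + 4" using k by linarith+
          then have u: "reg u ''m'' = m" "arr u ''b'' k = of_bool (?b k)" "arr u ''b'' (m + k) = of_bool (?b (m + k))"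
            using agree_reg[OF ag] agree_arr[OF ag] s b1 by simp_all
          have A: "?A (Suc k) = (if \<not> ?b k \<and> \<not> ?b (m + k) then insert k (?A k) else ?A k)"
            "?B (Suc k) = (if ?b k \<and> \<not> ?b (m + k) then insert k (?B k) else ?B k)" by (auto simp: less_Suc_eq)
          show "ht u check_body 32 (loop_post ''k'' k ?I)"
            unfolding A by (rule ht_run) (use u uk I in auto)
        qed (use s in auto)
      next
        fix v assume I: "?I m v" and ag: "frame (For ''k'' ''m'' check_body) ?s v"
        define t where "t = 3 * m"
        have v: "reg v ''m'' = m" "arr v ''b'' = arr s1 ''b''" "m + (m + m) = t"
          using agree_reg[OF ag] agree_arr[OF ag] s by (simp_all add: t_def)
        have b: "arr s1 ''b'' t = of_bool (?b t)" "arr s1 ''b'' (t + 1) = of_bool (?b (t + 1))"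
          "arr s1 ''b'' (t + 2) = of_bool (?b (t + 2))" "arr s1 ''b'' (t + 3) = of_bool (?b (t + 3))"
          using b1 by (simp_all add: t_def)
        define a0 where "a0 = card (?A m)"
        define a1 where "a1 = card (?B m)"
        have vI: "reg v ''u'' = a0" "reg v ''x'' = a1" using I by (auto simp: a0_def a1_def)
        have acc: "accept m ?b \<longleftrightarrow> \<not> ?b (t + 1) \<and> \<not> ?b (t + 3) \<and> a0 + of_bool (?b t) = 1 \<and> a1 + of_bool (?b (t + 2)) = 1"
          by (simp add: accept_def t_def a0_def a1_def)
        show "ht v check_end 60 (\<lambda>u. reg u ''e'' = of_bool (accept m ?b))" unfolding acc
          by (rule ht_run) (use v vI b in \<open>simp_all del: One_nat_def add_2_eq_Suc' add_Suc_right\<close>)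
      qed simp
    qed simp_all
  qed
qed

text \<open>Register \<open>G\<close> is the row length, later \<open>K + 1\<close> for the rounded
  weights \<open>0\<close> to \<open>K\<close>. Register \<open>E\<close> is the number of state
  codes and \<open>H\<close> the length of a whole layer of the table.\<close>

definition menv :: "nat \<Rightarrow> nat \<Rightarrow> nat \<Rightarrow> (nat \<Rightarrow> nat) \<Rightarrow> (nat \<Rightarrow> nat) \<Rightarrow> (nat \<Rightarrow> nat) \<Rightarrow> nat \<Rightarrow> state \<Rightarrow> bool" where
  "menv m N Kp ws v pos W s \<longleftrightarrow> senv m N Kp s \<and> reg s ''N'' = N \<and> reg s ''G'' = Kp \<and>
     reg s ''E'' = 2 ^ (3 * m + 4) \<and> reg s ''H'' = 2 ^ (3 * m + 4) * Kp \<and> reg s ''W'' = W \<and>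
     (\<forall>l<N. arr s ''S'' l = ws l \<and> arr s ''v'' l = v l \<and> arr s ''P'' l = pos l)"

lemma menv_agree:
  "agree R A s u \<Longrightarrow> menv m N Kp ws v pos W s \<Longrightarrow> R \<inter> {''m'', ''T'', ''N'', ''G'', ''E'', ''H'', ''W''} = {} \<Longrightarrow>
   A \<inter> {''K'', ''R'', ''S'', ''v'', ''P''} = {} \<Longrightarrow> menv m N Kp ws v pos W u"
  by (auto simp: menv_def senv_def agree_def disjoint_iff)

text \<open>
  The row \<open>V\<close> of the table belongs to the state \<open>V mod 2 ^ (3 * m + 4)\<close> with \<open>V div 2 ^ (3 * m + 4)\<close> cells to be read.
\<close>

definition table :: "nat \<Rightarrow> nat \<Rightarrow> nat \<Rightarrow> (nat \<Rightarrow> nat) \<Rightarrow> nat \<Rightarrow> state \<Rightarrow> bool" where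
  "table m N Kp ws U s \<longleftrightarrow> (\<forall>V<U. \<forall>x<Kp. arr s ''F'' (V * Kp + x) =
     of_bool (feas m N ws (V div 2 ^ (3 * m + 4)) (V mod 2 ^ (3 * m + 4)) x))"

lemma table_feas:
  assumes "table m N Kp ws U s" "i < 2 ^ (3 * m + 4)" "r * 2 ^ (3 * m + 4) + i < U" "x < Kp"
  shows "arr s ''F'' (r * 2 ^ (3 * m + 4) * Kp + i * Kp + x) = of_bool (feas m N ws r i x)"
  using assms(1)[unfolded table_def, rule_format, OF assms(3,4)] assms(2) by (simp add: algebra_simps)

lemma flat_index: "V < U \<Longrightarrow> x < Kp \<Longrightarrow> V * Kp + x < U * (Kp :: nat)"
proof -
  assume "V < U" "x < Kp"
  then have "V * Kp + x < V * Kp + Kp" by simp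
  also have "\<dots> = Suc V * Kp" by simp
  also have "\<dots> \<le> U * Kp" using \<open>V < U\<close> by (intro mult_le_mono1) simp
  finally show ?thesis .
qed

lemma table_Suc:
  assumes "table m N Kp ws U s" "\<And>a. a < U * Kp \<Longrightarrow> arr u ''F'' a = arr s ''F'' a"
    "\<And>x. x < Kp \<Longrightarrow> arr u ''F'' (U * Kp + x) =
      of_bool (feas m N ws (U div 2 ^ (3 * m + 4)) (U mod 2 ^ (3 * m + 4)) x)"
  shows "table m N Kp ws (Suc U) u"
  using assms flat_index[of _ U _ Kp] unfolding table_def by (auto simp: less_Suc_eq)

abbreviation base_body :: com where
  "base_body \<equiv> com.If (And (Equal (Reg ''X'') (Const 0)) (Equal (Reg ''e'') (Const 1)))
     (Store ''F'' (Plus (Reg ''Z'') (Reg ''X'')) (Const 1)) (Store ''F'' (Plus (Reg ''Z'') (Reg ''X'')) (Const 0))"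

abbreviation fill_body :: com where
  "fill_body \<equiv>
     com.If (Equal (Fetch ''F'' (Plus (Reg ''B'') (Plus (Reg ''I'') (Reg ''X'')))) (Const 1))
       (Store ''F'' (Plus (Reg ''Z'') (Reg ''X'')) (Const 1))
       (com.If (And (bexp.Not (Less (Reg ''X'') (Reg ''s'')))
           (Equal (Fetch ''F'' (Plus (Reg ''B'') (Plus (Reg ''J'') (Minus (Reg ''X'') (Reg ''s''))))) (Const 1)))
         (Store ''F'' (Plus (Reg ''Z'') (Reg ''X'')) (Const 1))
         (Store ''F'' (Plus (Reg ''Z'') (Reg ''X'')) (Const 0)))"

lemma ht_base:
  assumes "reg s ''Z'' = U * Kp" "reg s ''G'' = Kp" "reg s ''e'' = of_bool a"
  shows "ht s (For ''X'' ''G'' base_body) (Kp * 40 + 6) (\<lambda>u. (\<forall>a<U * Kp. arr u ''F'' a = arr s ''F'' a) \<and>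
    (\<forall>x<Kp. arr u ''F'' (U * Kp + x) = of_bool (a \<and> x = 0)))"
proof -
  let ?I = "\<lambda>x u. (\<forall>a<U * Kp. arr u ''F'' a = arr s ''F'' a) \<and>
    (\<forall>x'<x. arr u ''F'' (U * Kp + x') = of_bool (a \<and> x' = 0))"
  show ?thesis
  proof (rule ht_for[where n = Kp and I = ?I and T = 32])
    fix x u assume x: "x < Kp" and ag: "loop_frame ''X'' base_body s u"
      and ux: "reg u ''X'' = x" and I: "?I x u"
    have "reg u ''Z'' = U * Kp" "reg u ''e'' = of_bool a"
      using agree_reg[OF ag] assms by simp_all
    then show "ht u base_body 32 (loop_post ''X'' x ?I)"
      by (intro ht_run) (use ux I in \<open>auto simp: less_Suc_eq\<close>)
  qed (use assms in auto)
qed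

text \<open>The hypotheses \<open>bd\<close> place both source rows inside the part already filled,
  so the writes into row \<open>U\<close> cannot disturb them. For \<open>X\<close> below the weight
  the truncated difference is \<open>0\<close>, and that fetch is harmless since the other conjunct
  fails.\<close>

lemma ht_fill:
  assumes "reg s ''Z'' = U * Kp" "reg s ''G'' = Kp" "reg s ''B'' = B" "reg s ''I'' = I0" "reg s ''J'' = J0" "reg s ''s'' = w"
    and bd: "B + I0 + Kp \<le> U * Kp" "B + J0 + Kp \<le> U * Kp"
    and f: "\<And>x. x < Kp \<Longrightarrow> arr s ''F'' (B + I0 + x) = of_bool (f x)" "\<And>x. x < Kp \<Longrightarrow> arr s ''F'' (B + J0 + x) = of_bool (g x)"
  shows "ht s (For ''X'' ''G'' fill_body) (Kp * 68 + 6) (\<lambda>u. (\<forall>a<U * Kp. arr u ''F'' a = arr s ''F'' a) \<and>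
    (\<forall>x<Kp. arr u ''F'' (U * Kp + x) = of_bool (f x \<or> w \<le> x \<and> g (x - w))))"
proof -
  let ?I = "\<lambda>x u. (\<forall>a<U * Kp. arr u ''F'' a = arr s ''F'' a) \<and>
    (\<forall>x'<x. arr u ''F'' (U * Kp + x') = of_bool (f x' \<or> w \<le> x' \<and> g (x' - w)))"
  show ?thesis
  proof (rule ht_for[where n = Kp and I = ?I and T = 60])
    fix x u assume x: "x < Kp" and ag: "loop_frame ''X'' fill_body s u"
      and ux: "reg u ''X'' = x" and I: "?I x u"
    have u: "reg u ''Z'' = U * Kp" "reg u ''B'' = B" "reg u ''I'' = I0" "reg u ''J'' = J0" "reg u ''s'' = w"
      using agree_reg[OF ag] assms by simp_all
    have "B + I0 + x < U * Kp" "B + J0 + (x - w) < U * Kp" using bd x by linarith+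
    then have F: "arr u ''F'' (B + (I0 + x)) = of_bool (f x)" "arr u ''F'' (B + (J0 + (x - w))) = of_bool (g (x - w))"
      using I f[OF x] f(2)[of "x - w"] x by (simp_all add: add.assoc)
    show "ht u fill_body 60 (loop_post ''X'' x ?I)"
      by (rule ht_run; cases "f x"; cases "g (x - w)"; cases "w \<le> x") (use u ux F I in \<open>auto simp: less_Suc_eq\<close>)
  qed (use assms in auto)
qed

section \<open>Filling the table layer by layer\<close>

abbreviation next_code :: com where
  "next_code \<equiv> ''y'' ::= Plus (Reg ''y'') (Reg ''G'') ;; ''Z'' ::= Plus (Reg ''Z'') (Reg ''G'')"

abbreviation layer0_body :: com where
  "layer0_body \<equiv> check ;; For ''X'' ''G'' base_body ;; next_code"

definition layer0 :: com where
  "layer0 = (''y'' ::= Const 0 ;; ''Z'' ::= Const 0) ;; For ''C'' ''E'' layer0_body"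

lemma mod_layer0 [simp]:
  "mod_regs layer0 = {''y'', ''Z'', ''C'', ''X'', ''u'', ''x'', ''t'', ''i'', ''k'', ''e''}" "mod_arrs layer0 = {''b'', ''F''}"
  by (auto simp: layer0_def)

lemma ht_layer0:
  assumes m: "0 < m" and env: "menv m N Kp ws v pos W s" and Kp: "0 < Kp"
  shows "ht s layer0 (2 ^ (3 * m + 4) * (1000 * m + 40 * Kp + 50) + 20) (\<lambda>u.
    table m N Kp ws (2 ^ (3 * m + 4)) u \<and> reg u ''Z'' = 2 ^ (3 * m + 4) * Kp)"
proof -
  define E :: nat where "E = 2 ^ (3 * m + 4)"
  let ?s = "run (''y'' ::= Const 0 ;; ''Z'' ::= Const 0) s"
  have env0: "menv m N Kp ws v pos W ?s" using env by (simp add: menv_def senv_def)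
  let ?I = "\<lambda>i u. table m N Kp ws i u \<and> reg u ''Z'' = i * Kp \<and> reg u ''y'' = i * Kp"
  show ?thesis unfolding layer0_def E_def[symmetric]
  proof (rule ht_seq_run)
    show "ht ?s (For ''C'' ''E'' layer0_body) (E * (1000 * m + 40 * Kp + 50) + 6)
      (\<lambda>u. table m N Kp ws E u \<and> reg u ''Z'' = E * Kp)"
    proof (rule ht_for[where n = E and I = ?I and T = "1000 * m + 40 * Kp + 36"])
      fix i u assume i: "i < E" and ag: "loop_frame ''C'' layer0_body ?s u"
        and I: "?I i u"
      have envu: "menv m N Kp ws v pos W u" by (rule menv_agree[OF ag env0]) (simp_all)
      have i': "i < 2 ^ (3 * m + 4)" using i by (simp add: E_def)
      have se: "senv m N Kp u" using envu by (simp add: menv_def)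
      let ?Q = "loop_post ''C'' i ?I"
      show "ht u layer0_body (1000 * m + 40 * Kp + 36) ?Q"
      proof (rule ht_seq[OF ht_check[OF m se _ i' Kp], where ?T2.0 = "40 * Kp + 36"])
        show "reg u ''y'' = i * Kp" using I by simp
        fix u1 assume e: "reg u1 ''e'' = of_bool (accept m (bit i))"
          and ag1: "frame check u u1"
        have u1: "reg u1 ''Z'' = i * Kp" "reg u1 ''G'' = Kp" "reg u1 ''y'' = i * Kp" "arr u1 ''F'' = arr u ''F''"
          using agree_reg[OF ag1] agree_arr[OF ag1] I envu by (simp_all add: menv_def)
        have t1: "table m N Kp ws i u1" using I u1 by (simp add: table_def)
        show "ht u1 (For ''X'' ''G'' base_body ;; next_code) (40 * Kp + 36) ?Q"
        proof (rule ht_seq[OF ht_base[OF u1(1,2) e]])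
          fix u2 assume F: "(\<forall>a<i * Kp. arr u2 ''F'' a = arr u1 ''F'' a) \<and>
            (\<forall>x<Kp. arr u2 ''F'' (i * Kp + x) = of_bool (accept m (bit i) \<and> x = 0))"
            and ag2: "frame (For ''X'' ''G'' base_body) u1 u2"
          have u2: "reg u2 ''Z'' = i * Kp" "reg u2 ''G'' = Kp" "reg u2 ''y'' = i * Kp"
            using agree_reg[OF ag2] u1 by simp_all
          have t2: "table m N Kp ws (Suc i) u2"
            by (rule table_Suc[OF t1]) (use F i' in auto)
          show "ht u2 next_code 20 ?Q"
            by (rule ht_run) (use u2 t2 in \<open>auto simp: table_def\<close>)
        qed simp
      qed simp
    next
      show "reg ?s ''E'' = E" using env0 by (simp add: menv_def E_def)
    qed (auto simp: table_def)
  qed simp_all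
qed

abbreviation layers_code :: com where
  "layers_code \<equiv>
     (''c'' ::= Const 0) ;; step ;; (''I'' ::= Reg ''z'' ;; ''c'' ::= Const 1) ;; step ;;
     (''J'' ::= Reg ''z'' ;; ''s'' ::= Fetch ''S'' (Reg ''l'')) ;; For ''X'' ''G'' fill_body ;; next_code"

abbreviation layers_body :: com where
  "layers_body \<equiv>
     (''l'' ::= Minus (Reg ''l'') (Const 1) ;; ''y'' ::= Const 0) ;; For ''C'' ''E'' layers_code ;;
     (''B'' ::= Plus (Reg ''B'') (Reg ''H''))"

definition layers :: com where
  "layers = (''l'' ::= Reg ''N'' ;; ''B'' ::= Const 0) ;; For ''r'' ''N'' layers_body"

lemma mod_layers [simp]:
  "mod_regs layers = {''l'', ''B'', ''r'', ''y'', ''C'', ''c'', ''I'', ''J'', ''s'', ''X'', ''Z''} \<union> mod_regs step"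
  "mod_arrs layers = insert ''F'' (mod_arrs step)"
  by (auto simp: layers_def)

text \<open>Both successors of row \<open>Suc r * E + i\<close> lie in layer \<open>r\<close>, all
  of whose rows are complete. The two transitions are computed before the loop over the rounded
  weights, so their quadratic cost is paid once per row and not once per entry.\<close>

lemma ht_layers_code:
  assumes m: "0 < m" and env: "menv m N Kp ws v pos W s" and Kp: "0 < Kp" and E: "E = 2 ^ (3 * m + 4)"
    and r: "r < N" and i: "i < E" and l: "reg s ''l'' = N - Suc r" and B: "reg s ''B'' = r * E * Kp"
    and y: "reg s ''y'' = i * Kp" and Z: "reg s ''Z'' = (Suc r * E + i) * Kp"
    and tab: "table m N Kp ws (Suc r * E + i) s"
  shows "ht s layers_code (4000 * (m * m) + 68 * Kp + 50) (\<lambda>u. table m N Kp ws (Suc (Suc r * E + i)) u \<and>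
    reg u ''y'' = Suc i * Kp \<and> reg u ''Z'' = Suc (Suc r * E + i) * Kp)"
    (is "ht _ _ _ ?Q")
proof -
  define U where "U = Suc r * E + i"
  define D where "D col = delta m (N - Suc r) col i" for col
  have D: "D col < 2 ^ (3 * m + 4)" "D col < E" for col by (simp_all add: D_def delta_less E)
  have i': "i < 2 ^ (3 * m + 4)" using i E by simp
  have l': "N - Suc r < N" using r by simp
  \<comment> \<open>The facts that survive every part of the body before the fill, bundled so that
    one footprint check carries them along.\<close>
  have keep: "menv m N Kp ws v pos W w \<and> reg w ''l'' = N - Suc r \<and> reg w ''B'' = r * E * Kp \<and> reg w ''y'' = i * Kp \<and>
      reg w ''Z'' = U * Kp \<and> table m N Kp ws U w"
    if h: "agree R A u w" "R \<inter> {''m'', ''T'', ''N'', ''G'', ''E'', ''H'', ''W'', ''l'', ''B'', ''y'', ''Z''} = {}"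
      "A \<inter> {''K'', ''R'', ''S'', ''v'', ''P'', ''F''} = {}"
     "menv m N Kp ws v pos W u \<and> reg u ''l'' = N - Suc r \<and> reg u ''B'' = r * E * Kp \<and> reg u ''y'' = i * Kp \<and>
      reg u ''Z'' = U * Kp \<and> table m N Kp ws U u" for R A u w
  proof -
    have "menv m N Kp ws v pos W w" by (rule menv_agree[OF h(1)]) (use h in auto)
    moreover have "''l'' \<notin> R" "''B'' \<notin> R" "''y'' \<notin> R" "''Z'' \<notin> R" "''F'' \<notin> A" using h(2,3) by auto
    ultimately show ?thesis using h(4) agree_reg[OF h(1)] agree_arr[OF h(1)] by (simp add: table_def)
  qed
  let ?keep = "\<lambda>u. menv m N Kp ws v pos W u \<and> reg u ''l'' = N - Suc r \<and> reg u ''B'' = r * E * Kp \<and> reg u ''y'' = i * Kp \<and>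
      reg u ''Z'' = U * Kp \<and> table m N Kp ws U u"
  have step: "ht u step (2000 * (m * m)) (\<lambda>w. reg w ''z'' = D col * Kp)"
    if "?keep u" "reg u ''c'' = of_bool col" for u col
    unfolding D_def by (rule ht_step[OF m, where N = N]) (use that i' Kp l' in \<open>auto simp: menv_def\<close>)
  have k0: "?keep s" using env l B y Z tab by (simp add: U_def)
  let ?s = "run (''c'' ::= Const 0) s"
  have ks: "?keep ?s" by (rule keep[OF _ _ _ k0, of "{''c''}" "{}"]) (auto simp: agree_def)
  show ?thesis
  proof (rule ht_seq_run[where ?T2.0 = "4000 * (m * m) + 68 * Kp + 46"], goal_cases)
    case 2
    show ?case
    proof (rule ht_seq[OF step[OF ks, of False], where ?T2.0 = "2000 * (m * m) + 68 * Kp + 46"], goal_cases)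
      case (2 s1)
      have k1: "?keep s1" by (rule keep[OF 2(2) _ _ ks]) simp_all
      let ?s1 = "run (''I'' ::= Reg ''z'' ;; ''c'' ::= Const 1) s1"
      have ks1: "?keep ?s1" by (rule keep[OF _ _ _ k1, of "{''c'', ''I''}" "{}"]) (auto simp: agree_def)
      have c1: "reg ?s1 ''c'' = of_bool True" "reg ?s1 ''I'' = D False * Kp" using 2(1) by simp_all
      show ?case
      proof (rule ht_seq_run[where ?T2.0 = "2000 * (m * m) + 68 * Kp + 40"], goal_cases)
        case 2
        show ?case
        proof (rule ht_seq[OF step[OF ks1 c1(1)], where ?T2.0 = "68 * Kp + 40"], goal_cases)
          case (1 s2)
          have k2: "?keep s2" by (rule keep[OF 1(2) _ _ ks1]) simp_all
          have I2: "reg s2 ''I'' = D False * Kp" using agree_reg[OF 1(2), of "''I''"] c1 by simp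
          let ?s2 = "run (''J'' ::= Reg ''z'' ;; ''s'' ::= Fetch ''S'' (Reg ''l'')) s2"
          have ks2: "?keep ?s2" by (rule keep[OF _ _ _ k2, of "{''J'', ''s''}" "{}"]) (auto simp: agree_def)
          have r2: "reg ?s2 ''I'' = D False * Kp" "reg ?s2 ''J'' = D True * Kp" "reg ?s2 ''s'' = ws (N - Suc r)"
            using 1(1) I2 k2 l' by (auto simp: menv_def)
          have rU: "r * E + D col < U" for col using D[of col] by (simp add: U_def)
          have bd: "r * E * Kp + D col * Kp + Kp \<le> U * Kp" for col
          proof -
            have "Suc (r * E + D col) * Kp \<le> U * Kp" using rU[of col] by (intro mult_le_mono1) simp
            then show ?thesis by (simp add: algebra_simps)
          qed
          have F: "arr ?s2 ''F'' (r * E * Kp + D col * Kp + x) = of_bool (feas m N ws r (D col) x)" if "x < Kp" for x col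
            using table_feas[OF _ D(1)[of col], of N Kp ws U ?s2 r x] ks2 rU[of col] that unfolding E by blast
          \<comment> \<open>Quotient and remainder of the row number recover \<open>Suc r\<close>
            and \<open>i\<close>, which turns the recurrence into the format of
            \<open>table\<close>.\<close>
          have ff: "feas m N ws r (D False) x \<or> ws (N - Suc r) \<le> x \<and> feas m N ws r (D True) (x - ws (N - Suc r)) \<longleftrightarrow>
             feas m N ws (U div 2 ^ (3 * m + 4)) (U mod 2 ^ (3 * m + 4)) x" for x
          proof -
            have "U div E = Suc r" "U mod E = i" using i unfolding U_def by (simp_all del: mult_Suc)
            then show ?thesis unfolding E[symmetric] by (simp add: D_def)
          qed
          have "ht ?s2 (For ''X'' ''G'' fill_body) (Kp * 68 + 6) (\<lambda>u. (\<forall>a<U * Kp. arr u ''F'' a = arr ?s2 ''F'' a) \<and>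
            (\<forall>x<Kp. arr u ''F'' (U * Kp + x) = of_bool (feas m N ws r (D False) x \<or> ws (N - Suc r) \<le> x \<and> feas m N ws r (D True) (x - ws (N - Suc r)))))"
            by (rule ht_fill[OF _ _ _ r2 bd bd F F]) (use ks2 in \<open>auto simp: menv_def\<close>)
          note fill = this[unfolded ff]
          show ?case
          proof (rule ht_seq_run[where ?T2.0 = "68 * Kp + 30"], goal_cases)
            case 2
            show ?case
            proof (rule ht_seq[OF fill, where ?T2.0 = 20], goal_cases)
              case (1 s3)
              have t3: "table m N Kp ws (Suc U) s3"
                by (rule table_Suc[of _ _ _ _ _ ?s2]) (use ks2 1(1) in auto)
              have r3: "reg s3 ''Z'' = U * Kp" "reg s3 ''G'' = Kp" "reg s3 ''y'' = i * Kp"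
                using agree_reg[OF 1(2)] ks2 by (simp_all add: menv_def)
              show ?case unfolding U_def[symmetric]
                by (rule ht_run) (use r3 t3 in \<open>auto simp: table_def\<close>)
            qed simp
          qed simp_all
        qed simp
      qed simp_all
    qed simp_all
  qed simp_all
qed

lemma ht_layers:
  assumes m: "0 < m" and env: "menv m N Kp ws v pos W s" and Kp: "0 < Kp" and E: "E = 2 ^ (3 * m + 4)"
    and Z: "reg s ''Z'' = E * Kp" and tab: "table m N Kp ws E s"
  shows "ht s layers (N * (E * (4000 * (m * m) + 68 * Kp + 60) + 40) + 20) (\<lambda>u.
    table m N Kp ws (Suc N * E) u \<and> reg u ''B'' = N * E * Kp)"
proof -
  let ?s = "run (''l'' ::= Reg ''N'' ;; ''B'' ::= Const 0) s"
  have env0: "menv m N Kp ws v pos W ?s" using env by (simp add: menv_def senv_def)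
  have N: "reg s ''N'' = N" using env by (simp add: menv_def)
  let ?I = "\<lambda>r u. table m N Kp ws (Suc r * E) u \<and> reg u ''Z'' = Suc r * E * Kp \<and> reg u ''B'' = r * E * Kp \<and> reg u ''l'' = N - r"
  show ?thesis unfolding layers_def
  proof (rule ht_seq_run)
    show "ht ?s (For ''r'' ''N'' layers_body) (N * (E * (4000 * (m * m) + 68 * Kp + 60) + 40) + 6)
      (\<lambda>u. table m N Kp ws (Suc N * E) u \<and> reg u ''B'' = N * E * Kp)"
    proof (rule ht_for[where n = N and I = ?I and T = "E * (4000 * (m * m) + 68 * Kp + 60) + 32"])
      fix r u assume r: "r < N" and ag: "loop_frame ''r'' layers_body ?s u"
        and I: "?I r u"
      have envu: "menv m N Kp ws v pos W u" by (rule menv_agree[OF ag env0]) simp_all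
      let ?u = "run (''l'' ::= Minus (Reg ''l'') (Const 1) ;; ''y'' ::= Const 0) u"
      have envu': "menv m N Kp ws v pos W ?u" using envu by (simp add: menv_def senv_def)
      have ru: "reg ?u ''l'' = N - Suc r" "reg ?u ''y'' = 0" "reg ?u ''Z'' = Suc r * E * Kp" "reg ?u ''B'' = r * E * Kp"
         "arr ?u = arr u" "reg ?u ''E'' = E"
        using I envu by (simp_all add: menv_def E)
      have tu: "table m N Kp ws (Suc r * E) ?u" using I by (simp add: table_def)
      let ?Q = "loop_post ''r'' r ?I"
      let ?J = "\<lambda>i u. table m N Kp ws (Suc r * E + i) u \<and> reg u ''Z'' = (Suc r * E + i) * Kp \<and> reg u ''y'' = i * Kp"
      show "ht u layers_body (E * (4000 * (m * m) + 68 * Kp + 60) + 32) ?Q"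
      proof (rule ht_seq_run)
        show "ht ?u (For ''C'' ''E'' layers_code ;; (''B'' ::= Plus (Reg ''B'') (Reg ''H''))) (E * (4000 * (m * m) + 68 * Kp + 60) + 20) ?Q"
        proof (rule ht_seq)
          show "ht ?u (For ''C'' ''E'' layers_code) (E * (4000 * (m * m) + 68 * Kp + 60) + 6) (?J E)"
          proof (rule ht_for[where n = E and I = ?J and T = "4000 * (m * m) + 68 * Kp + 50"])
            fix i w assume i: "i < E" and ag: "loop_frame ''C'' layers_code ?u w"
              and J: "?J i w"
            have envw: "menv m N Kp ws v pos W w" by (rule menv_agree[OF ag envu']) simp_all
            have rw: "reg w ''l'' = N - Suc r" "reg w ''B'' = r * E * Kp"
              using agree_reg[OF ag] ru by simp_all
            show "ht w layers_code (4000 * (m * m) + 68 * Kp + 50) (loop_post ''C'' i ?J)"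
              by (rule ht_sub[OF ht_layers_code[OF m envw Kp E r i rw]]) (use J in \<open>auto simp: table_def\<close>)
          qed (use ru tu in \<open>simp_all add: table_def\<close>)
        next
          fix w assume J: "?J E w" and ag: "frame (For ''C'' ''E'' layers_code) ?u w"
          have rw: "reg w ''l'' = N - Suc r" "reg w ''B'' = r * E * Kp" "reg w ''H'' = E * Kp"
            using agree_reg[OF ag] ru envu
            by (simp_all add: menv_def E)
          have "Suc r * E + E = Suc (Suc r) * E" by simp
          then have J': "table m N Kp ws (Suc (Suc r) * E) w" "reg w ''Z'' = Suc (Suc r) * E * Kp" using J by metis+
          show "ht w (''B'' ::= Plus (Reg ''B'') (Reg ''H'')) 10 ?Q"
            by (rule ht_run) (use J' rw in \<open>simp_all add: table_def algebra_simps\<close>)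
        qed simp
      qed simp_all
    qed (use env0 tab N Z in \<open>simp_all add: table_def\<close>)
  qed simp_all
qed

section \<open>Reconstructing one colouring\<close>

abbreviation sim_body :: com where
  "sim_body \<equiv>
     (''c'' ::= Const 1 ;; ''b'' ::= Minus (Reg ''b'') (Reg ''H'')) ;; step ;;
     com.If (And (bexp.Not (Less (Reg ''Y'') (Fetch ''S'' (Reg ''l''))))
         (Equal (Fetch ''F'' (Plus (Reg ''b'') (Plus (Reg ''z'') (Minus (Reg ''Y'') (Fetch ''S'' (Reg ''l'')))))) (Const 1)))
       (''y'' ::= Reg ''z'' ;; ''Y'' ::= Minus (Reg ''Y'') (Fetch ''S'' (Reg ''l'')) ;;
        ''A'' ::= Plus (Reg ''A'') (Fetch ''v'' (Reg ''l'')) ;; Store ''t'' (Fetch ''P'' (Reg ''l'')) (Const 1))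
       ((''c'' ::= Const 0) ;; step ;; (''y'' ::= Reg ''z'' ;; Store ''t'' (Fetch ''P'' (Reg ''l'')) (Const 0)))"

text \<open>Registers and arrays have separate name spaces: register \<open>b\<close> is the offset
  of the current layer, array \<open>b\<close> holds decoded bits. Moving one cell forward in the
  grid moves one layer back in the table.\<close>

definition sim :: com where
  "sim = (''y'' ::= Const 0 ;; ''Y'' ::= Reg ''X'' ;; ''A'' ::= Const 0 ;; ''b'' ::= Reg ''B'') ;; For ''l'' ''N'' sim_body"

lemma mod_sim [simp]:
  "mod_regs sim = {''l'', ''y'', ''Y'', ''A'', ''b'', ''c''} \<union> mod_regs step" "mod_arrs sim = insert ''t'' (mod_arrs step)"
  by (auto simp: sim_def)

text \<open>The colouring \<open>c\<close> is a ghost of which only the values below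
  \<open>l\<close> are fixed. Register \<open>Y\<close> is the rounded weight still to be collected
  from the unread cells.\<close>

definition sim_inv :: "nat \<Rightarrow> nat \<Rightarrow> nat \<Rightarrow> (nat \<Rightarrow> nat) \<Rightarrow> (nat \<Rightarrow> nat) \<Rightarrow> (nat \<Rightarrow> nat) \<Rightarrow> nat \<Rightarrow> nat \<Rightarrow> (nat \<Rightarrow> bool) \<Rightarrow> state \<Rightarrow> bool" where
  "sim_inv m N Kp ws v pos x l c u \<longleftrightarrow>
     reg u ''y'' = enc m c l * Kp \<and> feas m N ws (N - l) (enc m c l) (reg u ''Y'') \<and>
     reg u ''Y'' + (\<Sum>a<l. of_bool (c a) * ws a) = x \<and> reg u ''A'' = (\<Sum>a<l. of_bool (c a) * v a) \<and>
     (\<forall>a<l. arr u ''t'' (pos a) = of_bool (c a))"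

lemma sim_inv_upd:
  assumes m: "0 < m" and inv: "sim_inv m N Kp ws v pos x l c s" and pos: "inj_on pos {..<N}" and l: "l < N"
    and y: "reg u ''y'' = delta m l b (enc m c l) * Kp"
    and feas: "feas m N ws (N - Suc l) (delta m l b (enc m c l)) (reg u ''Y'')"
    and Y: "reg u ''Y'' + of_bool b * ws l = reg s ''Y''" and A: "reg u ''A'' = reg s ''A'' + of_bool b * v l"
    and t: "arr u ''t'' = (arr s ''t'')(pos l := of_bool b)"
  shows "sim_inv m N Kp ws v pos x (Suc l) (c(l := b)) u"
proof -
  let ?c = "c(l := b)"
  have "enc m ?c l = enc m c l" by (rule enc_cong[OF m]) simp
  then have e: "enc m ?c (Suc l) = delta m l b (enc m c l)" using delta_enc[OF m, of l ?c] by simp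
  \<comment> \<open>Injectivity of the output positions protects the entries written
    earlier.\<close>
  have "pos a \<noteq> pos l" if "a < l" for a using pos that l by (metis inj_on_def lessThan_iff less_trans nat_neq_iff)
  then show ?thesis using inv y feas Y A t unfolding sim_inv_def e by (auto simp: less_Suc_eq)
qed

lemma ht_sim_body:
  assumes m: "0 < m" and env: "menv m N Kp ws v pos W s" and Kp: "0 < Kp" and E: "E = 2 ^ (3 * m + 4)"
    and l: "l < N" "reg s ''l'' = l" and b: "reg s ''b'' = (N - l) * E * Kp" and tab: "table m N Kp ws (Suc N * E) s"
    and inv: "sim_inv m N Kp ws v pos x l c s" and x: "x < Kp" and pos: "inj_on pos {..<N}"
  shows "ht s sim_body (4000 * (m * m) + 80) (\<lambda>u. reg u ''b'' = (N - Suc l) * E * Kp \<and>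
    (\<exists>c. sim_inv m N Kp ws v pos x (Suc l) c u))" (is "ht _ _ _ ?Q")
proof -
  define r where "r = N - Suc l"
  have r: "N - l = Suc r" "N - Suc r = l" using l by (auto simp: r_def)
  define i where "i = enc m c l"
  have i: "i < 2 ^ (3 * m + 4)" by (simp add: i_def enc_less)
  define Y where "Y = reg s ''Y''"
  have Yx: "Y < Kp" using inv x by (simp add: sim_inv_def Y_def)
  have fe: "feas m N ws r (delta m l False i) Y \<or> ws l \<le> Y \<and> feas m N ws r (delta m l True i) (Y - ws l)"
    using inv unfolding sim_inv_def r i_def[symmetric] Y_def[symmetric] by (simp add: r)
  let ?s = "run (''c'' ::= Const 1 ;; ''b'' ::= Minus (Reg ''b'') (Reg ''H'')) s"
  have envs: "menv m N Kp ws v pos W ?s" using env by (simp add: menv_def senv_def)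
  have H: "reg s ''H'' = E * Kp" using env by (simp add: menv_def E)
  have "Suc r * E * Kp - E * Kp = r * E * Kp" by (simp add: algebra_simps)
  then have rs: "reg ?s ''b'' = r * E * Kp" "reg ?s ''c'' = of_bool True" "reg ?s ''l'' = l" "reg ?s ''y'' = i * Kp"
    "reg ?s ''Y'' = Y" "reg ?s ''A'' = reg s ''A''" "arr ?s = arr s"
    using b[unfolded r(1)] H l inv by (simp_all del: mult_Suc add: Y_def sim_inv_def i_def)
  have st: "ht u step (2000 * (m * m)) (\<lambda>u. reg u ''z'' = delta m l col i * Kp)"
    if "menv m N Kp ws v pos W u" "reg u ''y'' = i * Kp" "reg u ''l'' = l" "reg u ''c'' = of_bool col" for u col
    by (rule ht_step[OF m, where N = N]) (use that i Kp l in \<open>auto simp: menv_def\<close>)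
  show ?thesis
  proof (rule ht_seq_run[where ?T2.0 = "4000 * (m * m) + 70"], goal_cases)
    case 2
    show ?case
    proof (rule ht_seq[OF st[OF envs rs(4,3,2)], where ?T2.0 = "2000 * (m * m) + 70"], goal_cases)
      case (1 u)
      note z = 1(1)
      have envu: "menv m N Kp ws v pos W u" by (rule menv_agree[OF 1(2) envs]) simp_all
      have ru: "reg u ''b'' = r * E * Kp" "reg u ''l'' = l" "reg u ''y'' = i * Kp" "reg u ''Y'' = Y" "reg u ''A'' = reg s ''A''"
        "arr u ''t'' = arr s ''t''" "arr u ''F'' = arr s ''F''"
        using agree_reg[OF 1(2)] agree_arr[OF 1(2)] rs by simp_all
      have eu: "arr u ''S'' l = ws l" "arr u ''v'' l = v l" "arr u ''P'' l = pos l" using envu l by (auto simp: menv_def)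
      have "r * E + delta m l True i < Suc r * E" using delta_less[of m l True i] by (simp add: E)
      also have "\<dots> \<le> Suc N * E" by (intro mult_le_mono1) (simp add: r_def)
      finally have "arr s ''F'' (r * E * Kp + delta m l True i * Kp + (Y - ws l)) =
          of_bool (feas m N ws r (delta m l True i) (Y - ws l))"
        unfolding E by (intro table_feas[OF tab[unfolded E] delta_less]) (use Yx in auto)
      then have F: "arr s ''F'' (r * E * Kp + (delta m l True i * Kp + (Y - ws l))) =
          of_bool (feas m N ws r (delta m l True i) (Y - ws l))" by (simp add: add.assoc)
      show ?case
      proof (rule ht_if[where ?T1.0 = "2000 * (m * m) + 40"], goal_cases)
        case 1
        then have "ws l \<le> Y" "arr s ''F'' (r * E * Kp + (delta m l True i * Kp + (Y - ws l))) = 1"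
          using ru eu z by auto
        then have f: "ws l \<le> Y" "feas m N ws r (delta m l True i) (Y - ws l)" unfolding F by (simp_all del: One_nat_def)
        show ?case
        proof (rule ht_run, goal_cases)
          case 2
          show ?case
            by (intro conjI exI, use ru in \<open>simp add: r_def\<close>, rule sim_inv_upd[OF m inv pos l(1), where b = True])
              (use f ru eu z in \<open>simp_all add: i_def[symmetric] r_def[symmetric] Y_def[symmetric]\<close>)
        qed simp_all
      next
        case 2
        then have "\<not> (ws l \<le> Y \<and> arr s ''F'' (r * E * Kp + (delta m l True i * Kp + (Y - ws l))) = 1)"
          using ru eu z by auto
        \<comment> \<open>The table has refused colour \<open>True\<close>, so the feasibility
          carried by the invariant must come from \<open>False\<close>; no second lookup is
          made.\<close>
        then have f: "feas m N ws r (delta m l False i) Y" using fe unfolding F by auto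
        let ?u = "run (''c'' ::= Const 0) u"
        have envu': "menv m N Kp ws v pos W ?u" using envu by (simp add: menv_def senv_def)
        have c0: "reg ?u ''c'' = of_bool False" "reg ?u ''y'' = i * Kp" "reg ?u ''l'' = l" using ru by simp_all
        show ?case
        proof (rule ht_seq_run[where ?T2.0 = "2000 * (m * m) + 30"], goal_cases)
          case 2
          show ?case
          proof (rule ht_seq[OF st[OF envu' c0(2,3,1)], where ?T2.0 = 20], goal_cases)
            case (1 w)
            have rw: "reg w ''b'' = r * E * Kp" "reg w ''l'' = l" "reg w ''Y'' = Y" "reg w ''A'' = reg s ''A''"
                "arr w ''t'' = arr s ''t''" "arr w ''P'' l = pos l"
                using agree_reg[OF 1(2)] agree_arr[OF 1(2)] ru eu by simp_all
            show ?case
            proof (rule ht_run, goal_cases)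
              case 2
              show ?case
                by (intro conjI exI, use rw in \<open>simp add: r_def\<close>, rule sim_inv_upd[OF m inv pos l(1), where b = False])
                  (use f rw 1(1) in \<open>simp_all add: i_def[symmetric] r_def[symmetric] Y_def[symmetric]\<close>)
            qed simp_all
          qed simp
        qed simp_all
      qed simp
    qed simp
  qed simp_all
qed

text \<open>With no cell left, feasibility says that the state accepts and that nothing remains to
  be collected. Hence the colouring found is good and has rounded weight exactly
  \<open>x\<close>.\<close>

lemma ht_sim:
  assumes m: "0 < m" and env: "menv m N Kp ws v pos W s" and Kp: "0 < Kp" and E: "E = 2 ^ (3 * m + 4)"
    and B: "reg s ''B'' = N * E * Kp" and tab: "table m N Kp ws (Suc N * E) s"
    and x: "reg s ''X'' = x" "x < Kp" and feas: "feas m N ws N 0 x" and pos: "inj_on pos {..<N}"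
  shows "ht s sim (N * (4000 * (m * m) + 90) + 30) (\<lambda>u. \<exists>c. good m N c \<and>
     (\<Sum>a<N. of_bool (c a) * ws a) = x \<and> reg u ''A'' = (\<Sum>a<N. of_bool (c a) * v a) \<and>
     (\<forall>a<N. arr u ''t'' (pos a) = of_bool (c a)))" (is "ht _ _ _ ?Q")
proof -
  let ?init = "''y'' ::= Const 0 ;; ''Y'' ::= Reg ''X'' ;; ''A'' ::= Const 0 ;; ''b'' ::= Reg ''B''"
  let ?s = "run ?init s"
  let ?I = "\<lambda>l u. reg u ''b'' = (N - l) * E * Kp \<and> (\<exists>c. sim_inv m N Kp ws v pos x l c u)"
  have env0: "menv m N Kp ws v pos W ?s" using env by (simp add: menv_def senv_def)
  show ?thesis unfolding sim_def
  proof (rule ht_seq_run)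
    show "ht ?s (For ''l'' ''N'' sim_body) (N * (4000 * (m * m) + 90) + 10) ?Q"
    proof (rule ht_for[where n = N and I = ?I and T = "4000 * (m * m) + 80"])
      fix l u assume l: "l < N" and ag: "loop_frame ''l'' sim_body ?s u"
        and ul: "reg u ''l'' = l" and I: "?I l u"
      have envu: "menv m N Kp ws v pos W u" by (rule menv_agree[OF ag env0]) simp_all
      have tu: "table m N Kp ws (Suc N * E) u"
        using tab agree_arr[OF ag] by (simp add: table_def)
      obtain c where c: "sim_inv m N Kp ws v pos x l c u" using I by blast
      show "ht u sim_body (4000 * (m * m) + 80) (loop_post ''l'' l ?I)"
        by (rule ht_sub[OF ht_sim_body[OF m envu Kp E l ul conjunct1[OF I] tu c x(2) pos]]) (auto simp: sim_inv_def)
    next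
      fix u assume "?I N u"
      then obtain c where c: "sim_inv m N Kp ws v pos x N c u" by blast
      then show "?Q u" by (intro exI[of _ c]) (auto simp: sim_inv_def bit_enc good_def)
    next
      show "?I 0 (?s\<lparr>reg := (reg ?s)(''l'' := 0)\<rparr>)"
        using B x feas by (simp add: sim_inv_def enc_0)
    next
      show "N * (4000 * (m * m) + 80 + 8) + 6 \<le> N * (4000 * (m * m) + 90) + 10" by (simp add: algebra_simps)
    qed (use env in \<open>simp_all add: menv_def\<close>)
  qed simp_all
qed

section \<open>Search over all rounded weights\<close>

abbreviation keep_best :: com where
  "keep_best \<equiv>
     (''x'' ::= Minus (Reg ''W'') (Reg ''A'') ;; when (Less (Reg ''A'') (Reg ''x'')) (''x'' ::= Reg ''A'')) ;;
     com.If (Less (Reg ''V'') (Reg ''x''))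
       ((''V'' ::= Reg ''x'') ;; For ''k'' ''N'' (Store ''U'' (Reg ''k'') (Fetch ''t'' (Reg ''k''))))
       Skip"

abbreviation recon_body :: com where
  "recon_body \<equiv> com.If (Equal (Fetch ''F'' (Plus (Reg ''B'') (Reg ''X''))) (Const 1)) (sim ;; keep_best) Skip"

definition recon :: com where "recon = (''V'' ::= Const 0) ;; For ''X'' ''G'' recon_body"

lemma ht_keep_best:
  assumes "reg s ''W'' = W" "reg s ''A'' = A" "reg s ''V'' = V" "reg s ''N'' = N"
  shows "ht s keep_best (N * 20 + 60) (\<lambda>u. reg u ''V'' = max V (min A (W - A)) \<and>
    (if V < min A (W - A) then \<forall>k<N. arr u ''U'' k = arr s ''t'' k else arr u ''U'' = arr s ''U''))" (is "ht _ _ _ ?Q")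
proof -
  let ?i = "''x'' ::= Minus (Reg ''W'') (Reg ''A'') ;; when (Less (Reg ''A'') (Reg ''x'')) (''x'' ::= Reg ''A'')"
  let ?b = "Store ''U'' (Reg ''k'') (Fetch ''t'' (Reg ''k''))"
  have main: "ht s' (com.If (Less (Reg ''V'') (Reg ''x'')) ((''V'' ::= Reg ''x'') ;; For ''k'' ''N'' ?b) Skip) (N * 20 + 40) ?Q"
    if s: "reg s' ''x'' = min A (W - A)" "reg s' ''V'' = V" "reg s' ''N'' = N" "arr s' = arr s" for s'
  proof (rule ht_if)
    assume "bval (Less (Reg ''V'') (Reg ''x'')) s'"
    then have lt: "V < min A (W - A)" using s by simp
    let ?u = "run (''V'' ::= Reg ''x'') s'"
    show "ht s' ((''V'' ::= Reg ''x'') ;; For ''k'' ''N'' ?b) (N * 20 + 20) ?Q"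
    proof (rule ht_seq_run)
      show "ht ?u (For ''k'' ''N'' ?b) (N * 20 + 10) ?Q"
      proof (rule ht_for[where n = N and T = 12 and I = "\<lambda>k u. \<forall>i<k. arr u ''U'' i = arr s ''t'' i"])
        fix k u assume k: "k < N" and ag: "loop_frame ''k'' ?b ?u u"
          and uk: "reg u ''k'' = k" and I: "\<forall>i<k. arr u ''U'' i = arr s ''t'' i"
        have "arr u ''t'' = arr s ''t''" using agree_arr[OF ag] s by simp
        then show "ht u ?b 12 (\<lambda>v. \<forall>i<Suc k. arr (v\<lparr>reg := (reg v)(''k'' := Suc k)\<rparr>) ''U'' i = arr s ''t'' i)"
          by (intro ht_run) (use uk I in \<open>auto simp: less_Suc_eq\<close>)
      next
        fix u assume ag: "loop_frame ''k'' ?b ?u u" and U: "\<forall>i<N. arr u ''U'' i = arr s ''t'' i"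
        have "reg u ''V'' = min A (W - A)" using agree_reg[OF ag] s by simp
        then show "?Q u" using U lt by simp
      qed (use s in simp_all)
    qed simp_all
  next
    assume "\<not> bval (Less (Reg ''V'') (Reg ''x'')) s'"
    then have nl: "\<not> V < min A (W - A)" using s by simp
    then have "max V (min A (W - A)) = V" by (intro max_absorb1) linarith
    then have "?Q s'" using s nl by (simp only: if_False simp_thms)
    then show "ht s' Skip (N * 20 + 20) ?Q" by (intro ht_run) simp_all
  qed simp
  have "reg (run ?i s) ''x'' = min A (W - A)" "reg (run ?i s) ''V'' = V" "reg (run ?i s) ''N'' = N" "arr (run ?i s) = arr s"
    using assms by auto
  then show ?thesis by (intro ht_seq_run[OF _ main]) simp_all
qed

lemma ht_recon:
  assumes m: "0 < m" and env: "menv m N Kp ws v pos (\<Sum>a<N. v a) s" and Kp: "0 < Kp" and E: "E = 2 ^ (3 * m + 4)"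
    and B: "reg s ''B'' = N * E * Kp" and tab: "table m N Kp ws (Suc N * E) s"
    and pos: "inj_on pos {..<N}" "\<And>a. a < N \<Longrightarrow> pos a < N"
  shows "ht s recon (Kp * (N * (4000 * (m * m) + 110) + 120) + 20) (\<lambda>u. \<exists>V. best_found m N ws v pos Kp V (arr u ''U''))"
proof -
  let ?s = "run (''V'' ::= Const 0) s"
  let ?I = "\<lambda>x u. best_found m N ws v pos x (reg u ''V'') (arr u ''U'')"
  have env0: "menv m N Kp ws v pos (\<Sum>a<N. v a) ?s" using env by (simp add: menv_def senv_def)
  show ?thesis unfolding recon_def
  proof (rule ht_seq_run[where ?T2.0 = "Kp * (N * (4000 * (m * m) + 110) + 120) + 10"], goal_cases)
    case 2
    show ?case
    proof (rule ht_for[where n = Kp and I = ?I and T = "N * (4000 * (m * m) + 110) + 110"], goal_cases)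
      case (6 x u)
      note ag = 6(2)
      have envu: "menv m N Kp ws v pos (\<Sum>a<N. v a) u" by (rule menv_agree[OF ag env0]) simp_all
      have tu: "table m N Kp ws (Suc N * E) u"
        using tab agree_arr[OF ag] by (simp add: table_def)
      have Bu: "reg u ''B'' = N * E * Kp" using agree_reg[OF ag] B by simp
      \<comment> \<open>The row of the start configuration: code \<open>0\<close>, which is the
        empty prefix, in the layer with all \<open>N\<close> cells unread.\<close>
      have F: "arr u ''F'' (N * E * Kp + x) = of_bool (feas m N ws N 0 x)"
        using table_feas[OF tu[unfolded E], of 0 N x] 6(1) by (simp add: E)
      show ?case
      proof (rule ht_if[where ?T1.0 = "N * (4000 * (m * m) + 110) + 100"], goal_cases)
        case 1
        then have "arr u ''F'' (N * E * Kp + x) = 1" using Bu 6(3) by simp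
        then have feas: "feas m N ws N 0 x" unfolding F by (simp del: One_nat_def)
        show ?case
        proof (rule ht_seq[OF ht_sim[OF m envu Kp E Bu tu 6(3,1) feas pos(1)], where ?T2.0 = "N * 20 + 60"], goal_cases)
          case (1 u1)
          then obtain c where c: "good m N c" "(\<Sum>a<N. of_bool (c a) * ws a) = x"
            "reg u1 ''A'' = (\<Sum>a<N. of_bool (c a) * v a)" "\<forall>a<N. arr u1 ''t'' (pos a) = of_bool (c a)" by blast
          have r1: "reg u1 ''W'' = (\<Sum>a<N. v a)" "reg u1 ''V'' = reg u ''V''" "reg u1 ''N'' = N" "arr u1 ''U'' = arr u ''U''"
            using agree_reg[OF 1(2)] agree_arr[OF 1(2)] envu by (simp_all add: menv_def)
          show ?case
          proof (rule ht_sub[OF ht_keep_best[OF r1(1) c(3) r1(2,3), folded cval_def]], goal_cases)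
            case (1 w)
            have "best_found m N ws v pos (Suc x) (reg w ''V'') (arr w ''U'')"
              by (rule best_found_update[OF 6(4) c(1,2)]) (use 1(1) c(4) pos(2) r1(4) in auto)
            then show ?case by simp
          qed simp
        qed (simp add: algebra_simps)
      next
        case 2
        then have "arr u ''F'' (N * E * Kp + x) \<noteq> 1" using Bu 6(3) by simp
        then have "\<not> feas m N ws N 0 x" unfolding F by (simp del: One_nat_def)
        then show ?case by (intro ht_run) (use 6(4) best_found_skip in simp_all)
      qed simp
    next
      case (7 u)
      then show ?case by blast
    next
      case 8
      then show ?case by (simp add: add_mult_distrib2)
    qed (use env in \<open>simp_all add: menv_def best_found_def\<close>)
  qed simp_all
qed

section \<open>Preprocessing\<close>

text \<open>Position of a cell in the row-major input and output arrays.\<close>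

definition cell_index :: "nat \<Rightarrow> nat \<Rightarrow> nat \<Rightarrow> nat" where
  "cell_index m n a = (a mod m) * n + a div m"

lemma cell_index_div_mod:
  assumes "a < m * n"
  shows "cell_index m n a div n = a mod m" "cell_index m n a mod n = a div m"
proof -
  have "a div m < n" using assms by (metis less_mult_imp_div_less mult.commute)
  then show "cell_index m n a div n = a mod m" "cell_index m n a mod n = a div m"
    by (simp_all add: cell_index_def)
qed

lemma cell_index_less: "a < m * n \<Longrightarrow> cell_index m n a < m * n"
proof -
  assume a: "a < m * n"
  have "a div m < n" using a by (metis less_mult_imp_div_less mult.commute)
  moreover have "a mod m < m" using a by (cases m) auto
  ultimately show ?thesis unfolding cell_index_def by (rule flat_index[of "a mod m" m "a div m" n, rotated])
qed

lemma inj_cell_index: "inj_on (cell_index m n) {..<m * n}"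
  by (rule inj_onI) (metis cell_index_div_mod lessThan_iff div_mod_decomp)

section \<open>Cell count and column order\<close>

abbreviation size_body :: com where "size_body \<equiv> ''N'' ::= Plus (Reg ''N'') (Reg ''m'')"

definition pre_size :: com where "pre_size = (''N'' ::= Const 0) ;; For ''i'' ''n'' size_body"

lemma mod_pre_size [simp]: "mod_regs pre_size = {''N'', ''i''}" "mod_arrs pre_size = {}"
  by (auto simp: pre_size_def)

lemma ht_pre_size:
  assumes "reg s ''m'' = m" "reg s ''n'' = n"
  shows "ht s pre_size (n * 20 + 20) (\<lambda>u. reg u ''N'' = m * n)"
  unfolding pre_size_def
proof (rule ht_seq_run)
  let ?s = "run (''N'' ::= Const 0) s"
  show "ht ?s (For ''i'' ''n'' size_body) (n * 20 + 6) (\<lambda>u. reg u ''N'' = m * n)"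
  proof (rule ht_for[where n = n and T = 12 and I = "\<lambda>i u. reg u ''N'' = m * i"])
    fix k u assume ag: "loop_frame ''i'' size_body ?s u" and I: "reg u ''N'' = m * k"
    have "reg u ''m'' = m" using agree_reg[OF ag] assms by simp
    then show "ht u size_body 12 (\<lambda>v. reg (v\<lparr>reg := (reg v)(''i'' := Suc k)\<rparr>) ''N'' = m * Suc k)"
      by (intro ht_run) (use I in auto)
  qed (use assms in simp_all)
qed simp_all

abbreviation cells_store :: com where
  "cells_store \<equiv>
     Store ''P'' (Reg ''l'') (Reg ''a'') ;; Store ''R'' (Reg ''l'') (Reg ''x'') ;; ''u'' ::= Fetch ''w'' (Reg ''a'') ;;
     Store ''v'' (Reg ''l'') (Reg ''u'') ;; ''W'' ::= Plus (Reg ''W'') (Reg ''u'') ;;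
     when (Less (Reg ''B'') (Reg ''u'')) (''B'' ::= Reg ''u'')"

abbreviation cells_next :: com where
  "cells_next \<equiv>
     ''x'' ::= Plus (Reg ''x'') (Const 1) ;; ''a'' ::= Plus (Reg ''a'') (Reg ''n'') ;;
     when (Equal (Reg ''x'') (Reg ''m'')) (''x'' ::= Const 0 ;; ''j'' ::= Plus (Reg ''j'') (Const 1) ;; ''a'' ::= Reg ''j'')"

definition pre_cells :: com where
  "pre_cells = (''a'' ::= Const 0 ;; ''j'' ::= Const 0 ;; ''x'' ::= Const 0 ;; ''W'' ::= Const 0 ;; ''B'' ::= Const 0) ;;
     For ''l'' ''N'' (cells_store ;; cells_next)"

lemma mod_pre_cells [simp]:
  "mod_regs pre_cells = {''a'', ''j'', ''x'', ''W'', ''B'', ''l'', ''u''}" "mod_arrs pre_cells = {''P'', ''R'', ''v''}"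
  by (auto simp: pre_cells_def)

text \<open>The index \<open>a\<close> into the row-major input advances by \<open>n\<close> down a
  column and restarts at \<open>j\<close> for the next one, which avoids multiplication and
  division. Register \<open>B\<close> holds the largest weight at this stage;
  \<open>pre_round\<close> replaces it by the total minus that weight.\<close>

lemma ht_pre_cells:
  assumes m: "0 < m" "reg s ''m'' = m" and n: "reg s ''n'' = n" and N: "reg s ''N'' = N" "0 < N"
    and v: "\<And>a. a < N \<Longrightarrow> arr s ''w'' (cell_index m n a) = v a"
  shows "ht s pre_cells (N * 100 + 30) (\<lambda>u. (\<forall>i<N. arr u ''P'' i = cell_index m n i \<and> arr u ''R'' i = i mod m \<and> arr u ''v'' i = v i) \<and>
    reg u ''W'' = (\<Sum>i<N. v i) \<and> (\<exists>h<N. reg u ''B'' = v h \<and> (\<forall>i<N. v i \<le> v h)))"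
proof -
  let ?init = "''a'' ::= Const 0 ;; ''j'' ::= Const 0 ;; ''x'' ::= Const 0 ;; ''W'' ::= Const 0 ;; ''B'' ::= Const 0"
  let ?s = "run ?init s"
  let ?b = "cells_store ;; cells_next"
  let ?A = "\<lambda>l u. (\<forall>i<l. arr u ''P'' i = cell_index m n i \<and> arr u ''R'' i = i mod m \<and> arr u ''v'' i = v i) \<and>
    reg u ''W'' = (\<Sum>i<l. v i) \<and> (\<forall>i<l. v i \<le> reg u ''B'') \<and> (l = 0 \<and> reg u ''B'' = 0 \<or> (\<exists>h<l. reg u ''B'' = v h))"
  let ?B = "\<lambda>l u. reg u ''x'' = l mod m \<and> reg u ''j'' = l div m \<and> reg u ''a'' = cell_index m n l"
  let ?I = "\<lambda>l u. ?A l u \<and> ?B l u"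
  show ?thesis unfolding pre_cells_def
  proof (rule ht_seq_run)
    show "ht ?s (For ''l'' ''N'' ?b) (N * 100 + 10) (\<lambda>u. (\<forall>i<N. arr u ''P'' i = cell_index m n i \<and> arr u ''R'' i = i mod m \<and> arr u ''v'' i = v i) \<and>
    reg u ''W'' = (\<Sum>i<N. v i) \<and> (\<exists>h<N. reg u ''B'' = v h \<and> (\<forall>i<N. v i \<le> v h)))"
    proof (rule ht_for[where n = N and I = ?I and T = 80])
      fix l u assume l: "l < N" and ag: "loop_frame ''l'' ?b ?s u"
        and ul: "reg u ''l'' = l" and I: "?I l u"
      have u: "reg u ''m'' = m" "reg u ''n'' = n" "arr u ''w'' = arr s ''w''"
        using agree_reg[OF ag] agree_arr[OF ag] m n by simp_all
      show "ht u ?b 80 (loop_post ''l'' l ?I)"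
      proof (rule ht_seq)
        show "ht u cells_store 40 (?A (Suc l))"
        proof (rule ht_run)
          have a: "reg u ''a'' = cell_index m n l" "reg u ''x'' = l mod m" using I by auto
          have w: "arr u ''w'' (cell_index m n l) = v l" using u v[OF l] by simp
          have A: "?A l u" using I by blast
          have B: "reg (run cells_store u) ''B'' = max (reg u ''B'') (v l)"
            "reg (run cells_store u) ''W'' = reg u ''W'' + v l"
            "arr (run cells_store u) ''P'' = (arr u ''P'')(l := cell_index m n l)"
            "arr (run cells_store u) ''R'' = (arr u ''R'')(l := l mod m)"
            "arr (run cells_store u) ''v'' = (arr u ''v'')(l := v l)"
            using a w ul by auto
          have 1: "\<forall>i<Suc l. v i \<le> max (reg u ''B'') (v l)" using A by (auto simp: less_Suc_eq le_max_iff_disj)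
          have 2: "\<exists>h<Suc l. max (reg u ''B'') (v l) = v h"
          proof (cases "reg u ''B'' \<le> v l")
            case False
            then have "\<exists>h<l. reg u ''B'' = v h" using A by auto
            then show ?thesis using False by (metis less_Suc_eq max_absorb1 nat_le_linear)
          qed (auto simp: max_def)
          show "?A (Suc l) (run cells_store u)" unfolding B using A 1 2 by (simp add: less_Suc_eq)
        qed simp_all
        fix w assume A: "?A (Suc l) w" and agw: "frame cells_store u w"
        have w: "reg w ''x'' = l mod m" "reg w ''j'' = l div m" "reg w ''a'' = cell_index m n l" "reg w ''m'' = m" "reg w ''n'' = n"
          using agree_reg[OF agw] I u by simp_all
        have B: "?B (Suc l) (run cells_next w)"
        proof (cases "Suc (l mod m) = m")
          case True
          then have "Suc l mod m = 0" "Suc l div m = Suc (l div m)" by (simp_all add: mod_Suc div_Suc)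
          then show ?thesis using w True by (simp add: cell_index_def)
        next
          case False
          then have "Suc l mod m = Suc (l mod m)" "Suc l div m = l div m" by (simp_all add: mod_Suc div_Suc)
          then show ?thesis using w False by (simp add: cell_index_def)
        qed
        have A': "?A (Suc l) (run cells_next w)"
        proof -
          have E: "arr (run cells_next w) = arr w" "reg (run cells_next w) ''W'' = reg w ''W''" "reg (run cells_next w) ''B'' = reg w ''B''"
            by simp_all
          show ?thesis unfolding E by (rule A)
        qed
        show "ht w cells_next 40 (loop_post ''l'' l ?I)"
        proof (rule ht_run)
          define z where "z = run cells_next w"
          show "?I (Suc l) ((run cells_next w)\<lparr>reg := (reg (run cells_next w))(''l'' := Suc l)\<rparr>)"
            using A' B unfolding z_def[symmetric] by simp
        qed simp_all
      qed simp
    next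
      fix u assume I: "?I N u"
      then obtain h where h: "h < N" "reg u ''B'' = v h" using N(2) by auto
      show "(\<forall>i<N. arr u ''P'' i = cell_index m n i \<and> arr u ''R'' i = i mod m \<and> arr u ''v'' i = v i) \<and>
        reg u ''W'' = (\<Sum>i<N. v i) \<and> (\<exists>h<N. reg u ''B'' = v h \<and> (\<forall>i<N. v i \<le> v h))"
        using I h by (intro conjI exI[of _ h]) auto
    qed (use N in \<open>simp_all add: cell_index_def\<close>)
  qed simp_all
qed

section \<open>Accuracy and range of rounded weights\<close>

abbreviation accuracy_body :: com where
  "accuracy_body \<equiv> ''q'' ::= Minus (Reg ''q'') (Reg ''p'') ;; ''X'' ::= Plus (Reg ''X'') (Const 1)"

definition pre_accuracy :: com where
  "pre_accuracy = (''X'' ::= Const 1) ;; While (Less (Const 0) (Reg ''q'')) accuracy_body"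

lemma mod_pre_accuracy [simp]: "mod_regs pre_accuracy = {''X'', ''q''}" "mod_arrs pre_accuracy = {}"
  by (auto simp: pre_accuracy_def)

text \<open>The hypotheses characterise \<open>r\<close> as \<open>q / p\<close> rounded up, which
  is the number of truncated subtractions of \<open>p\<close> that exhaust \<open>q\<close>.\<close>

lemma ht_pre_accuracy:
  assumes p: "reg s ''p'' = p" and q: "reg s ''q'' = q" and r: "q \<le> r * p" "\<And>k. k < r \<Longrightarrow> k * p < q"
  shows "ht s pre_accuracy (r * 20 + 20) (\<lambda>u. reg u ''X'' = 1 + r)"
  unfolding pre_accuracy_def
proof (rule ht_seq_run)
  let ?I = "\<lambda>k (u :: state). reg u ''p'' = p \<and> reg u ''q'' = q - k * p \<and> reg u ''X'' = 1 + k"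
  show "ht (run (''X'' ::= Const 1) s) (While (Less (Const 0) (Reg ''q'')) accuracy_body) (r * 20 + 10) (\<lambda>u. reg u ''X'' = 1 + r)"
  proof (rule ht_sub[OF ht_while[where n = r and I = ?I and T = 14 and b = "Less (Const 0) (Reg ''q'')"]])
    fix k and u :: state assume "k < r" "?I k u"
    then show "bval (Less (Const 0) (Reg ''q'')) u \<and> ht u accuracy_body 14 (?I (Suc k))"
      using r(2)[of k] by (intro conjI ht_run) auto
  qed (use p q r(1) in auto)
qed simp_all

abbreviation range_body :: com where "range_body \<equiv> ''G'' ::= Plus (Reg ''G'') (Reg ''Y'')"

definition pre_range :: com where
  "pre_range = (''Y'' ::= Plus (Reg ''N'') (Reg ''N'') ;; ''G'' ::= Const 1) ;; For ''i'' ''X'' range_body"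

lemma mod_pre_range [simp]: "mod_regs pre_range = {''Y'', ''G'', ''i''}" "mod_arrs pre_range = {}"
  by (auto simp: pre_range_def)

lemma ht_pre_range:
  assumes N: "reg s ''N'' = N" and X: "reg s ''X'' = x"
  shows "ht s pre_range (x * 20 + 30) (\<lambda>u. reg u ''G'' = 2 * N * x + 1)"
  unfolding pre_range_def
proof (rule ht_seq_run)
  let ?s = "run (''Y'' ::= Plus (Reg ''N'') (Reg ''N'') ;; ''G'' ::= Const 1) s"
  show "ht ?s (For ''i'' ''X'' range_body) (x * 20 + 10) (\<lambda>u. reg u ''G'' = 2 * N * x + 1)"
  proof (rule ht_for[where n = x and T = 12 and I = "\<lambda>i u. reg u ''G'' = 2 * N * i + 1"])
    fix k u assume ag: "loop_frame ''i'' range_body ?s u" and I: "reg u ''G'' = 2 * N * k + 1"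
    have "reg u ''Y'' = 2 * N" using agree_reg[OF ag] N by simp
    then show "ht u range_body 12 (\<lambda>v. reg (v\<lparr>reg := (reg v)(''i'' := Suc k)\<rparr>) ''G'' = 2 * N * Suc k + 1)"
      by (intro ht_run) (use I in auto)
  qed (use X in simp_all)
qed simp_all

section \<open>Rounding the weights\<close>

abbreviation mult_body :: com where "mult_body \<equiv> ''u'' ::= Plus (Reg ''u'') (Fetch ''v'' (Reg ''l''))"

abbreviation div_body :: com where
  "div_body \<equiv> when (bexp.Not (Less (Reg ''u'') (Reg ''B'')))
     (''u'' ::= Minus (Reg ''u'') (Reg ''B'') ;; ''x'' ::= Plus (Reg ''x'') (Const 1))"

abbreviation round_body :: com where
  "round_body \<equiv> (''u'' ::= Const 0) ;; For ''i'' ''Y'' mult_body ;; (''x'' ::= Const 0) ;; For ''i'' ''G'' div_body ;;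
     Store ''S'' (Reg ''l'') (Reg ''x'')"

definition pre_round :: com where
  "pre_round = (''B'' ::= Minus (Reg ''W'') (Reg ''B'') ;; ''Y'' ::= Minus (Reg ''G'') (Const 1)) ;; For ''l'' ''N'' round_body"

lemma mod_pre_round [simp]: "mod_regs pre_round = {''B'', ''Y'', ''l'', ''u'', ''i'', ''x''}" "mod_arrs pre_round = {''S''}"
  by (auto simp: pre_round_def)

text \<open>Product and quotient by repeated addition and subtraction. Stopping the division after
  \<open>K + 1\<close> rounds bounds the time for cells much heavier than \<open>B\<close>; a
  quotient cut off in this way is \<open>K + 1\<close>, the overflow mark that
  \<open>rounded\<close> leaves without an upper bound.\<close>

lemma ht_round_body:
  assumes Y: "reg s ''Y'' = K" and G: "reg s ''G'' = K + 1" and B: "reg s ''B'' = B" and l: "reg s ''l'' = l"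
    and v: "arr s ''v'' l = v"
  shows "ht s round_body (K * 60 + 80) (\<lambda>u. rounded K B v (arr u ''S'' l) \<and> (\<forall>i. i \<noteq> l \<longrightarrow> arr u ''S'' i = arr s ''S'' i))"
    (is "ht _ _ _ ?Q")
proof (rule ht_seq_run)
  let ?s = "run (''u'' ::= Const 0) s"
  show "ht ?s (For ''i'' ''Y'' mult_body ;; (''x'' ::= Const 0) ;; For ''i'' ''G'' div_body ;; Store ''S'' (Reg ''l'') (Reg ''x''))
    (K * 60 + 76) ?Q"
  proof (rule ht_seq)
    show "ht ?s (For ''i'' ''Y'' mult_body) (K * 20 + 10) (\<lambda>u. reg u ''u'' = v * K)"
    proof (rule ht_for[where n = K and T = 12 and I = "\<lambda>i u. reg u ''u'' = v * i"])
      fix k u assume ag: "loop_frame ''i'' mult_body ?s u" and I: "reg u ''u'' = v * k"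
      have "reg u ''l'' = l" "arr u ''v'' l = v" using agree_reg[OF ag] agree_arr[OF ag] l v by simp_all
      then show "ht u mult_body 12 (\<lambda>w. reg (w\<lparr>reg := (reg w)(''i'' := Suc k)\<rparr>) ''u'' = v * Suc k)"
        by (intro ht_run) (use I in auto)
    qed (use Y in simp_all)
  next
    fix s1 assume u1: "reg s1 ''u'' = v * K" and ag: "frame (For ''i'' ''Y'' mult_body) ?s s1"
    have r1: "reg s1 ''B'' = B" "reg s1 ''G'' = K + 1" "reg s1 ''l'' = l" "arr s1 ''S'' = arr s ''S''"
      using agree_reg[OF ag] agree_arr[OF ag] B G l
      by simp_all
    let ?s1 = "run (''x'' ::= Const 0) s1"
    let ?I = "\<lambda>t u. reg u ''x'' * B + reg u ''u'' = v * K \<and> reg u ''x'' \<le> t \<and> (B \<le> reg u ''u'' \<longrightarrow> reg u ''x'' = t)"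
    show "ht s1 ((''x'' ::= Const 0) ;; For ''i'' ''G'' div_body ;; Store ''S'' (Reg ''l'') (Reg ''x'')) (K * 40 + 66) ?Q"
    proof (rule ht_seq_run)
      show "ht ?s1 (For ''i'' ''G'' div_body ;; Store ''S'' (Reg ''l'') (Reg ''x'')) (K * 40 + 60) ?Q"
      proof (rule ht_seq)
        show "ht ?s1 (For ''i'' ''G'' div_body) (K * 40 + 50) (?I (K + 1))"
        proof (rule ht_for[where n = "K + 1" and T = 24 and I = ?I])
          fix t u assume ag: "loop_frame ''i'' div_body ?s1 u" and I: "?I t u"
          have uB: "reg u ''B'' = B" using agree_reg[OF ag] r1 by simp
          show "ht u div_body 24 (loop_post ''i'' t ?I)"
          proof (rule ht_run)
            show "?I (Suc t) ((run div_body u)\<lparr>reg := (reg (run div_body u))(''i'' := Suc t)\<rparr>)"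
            proof (cases "B \<le> reg u ''u''")
              case True
              then show ?thesis using I uB by auto
            next
              case False
              then show ?thesis using I uB by auto
            qed
          qed simp_all
        qed (use u1 r1 in simp_all)
      next
        fix u assume I: "?I (K + 1) u" and ag: "frame (For ''i'' ''G'' div_body) ?s1 u"
        have u: "reg u ''l'' = l" "arr u ''S'' = arr s ''S''" using agree_reg[OF ag] agree_arr[OF ag] r1 by simp_all
        have "rounded K B v (reg u ''x'')" unfolding rounded_def
        proof (intro conjI impI)
          show "reg u ''x'' * B \<le> v * K" using I by linarith
          assume "reg u ''x'' \<le> K"
          then have "\<not> B \<le> reg u ''u''" using I by auto
          then show "v * K \<le> (reg u ''x'' + 1) * B" using I by simp
        qed
        then show "ht u (Store ''S'' (Reg ''l'') (Reg ''x'')) 10 ?Q" by (intro ht_run) (use u in simp_all)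
      qed simp
    qed simp_all
  qed simp
qed simp_all

lemma ht_pre_round:
  assumes W: "reg s ''W'' = W" and B: "reg s ''B'' = M" and G: "reg s ''G'' = K + 1" and N: "reg s ''N'' = N"
    and v: "\<And>l. l < N \<Longrightarrow> arr s ''v'' l = v l"
  shows "ht s pre_round (N * (K * 60 + 90) + 30) (\<lambda>u. \<forall>l<N. rounded K (W - M) (v l) (arr u ''S'' l))"
  unfolding pre_round_def
proof (rule ht_seq_run)
  let ?s = "run (''B'' ::= Minus (Reg ''W'') (Reg ''B'') ;; ''Y'' ::= Minus (Reg ''G'') (Const 1)) s"
  let ?I = "\<lambda>l u. \<forall>i<l. rounded K (W - M) (v i) (arr u ''S'' i)"
  show "ht ?s (For ''l'' ''N'' round_body) (N * (K * 60 + 90) + 10) (?I N)"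
  proof (rule ht_for[where n = N and I = ?I and T = "K * 60 + 80"])
    fix l u assume l: "l < N" and ag: "loop_frame ''l'' round_body ?s u"
      and ul: "reg u ''l'' = l" and I: "?I l u"
    have u: "reg u ''Y'' = K" "reg u ''G'' = K + 1" "reg u ''B'' = W - M" "arr u ''v'' l = v l"
      using agree_reg[OF ag] agree_arr[OF ag]
        W B G v[OF l] by simp_all
    show "ht u round_body (K * 60 + 80) (loop_post ''l'' l ?I)"
      by (rule ht_sub[OF ht_round_body[OF u(1-3) ul u(4)]]) (use I in \<open>auto simp: less_Suc_eq\<close>)
  next
    show "N * (K * 60 + 80 + 8) + 6 \<le> N * (K * 60 + 90) + 10" by (simp add: add_mult_distrib2)
  qed (use N in simp_all)
qed simp_all

abbreviation powers_body :: com where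
  "powers_body \<equiv> Store ''K'' (Reg ''i'') (Reg ''H'') ;; ''H'' ::= Plus (Reg ''H'') (Reg ''H'') ;; ''E'' ::= Plus (Reg ''E'') (Reg ''E'')"

definition pre_powers :: com where
  "pre_powers = (''T'' ::= Plus (Plus (Reg ''m'') (Plus (Reg ''m'') (Reg ''m''))) (Const 4) ;; ''E'' ::= Const 1 ;; ''H'' ::= Reg ''G'') ;;
     For ''i'' ''T'' powers_body"

lemma mod_pre_powers [simp]: "mod_regs pre_powers = {''T'', ''E'', ''H'', ''i''}" "mod_arrs pre_powers = {''K''}"
  by (auto simp: pre_powers_def)

lemma ht_pre_powers:
  assumes m: "reg s ''m'' = m" and G: "reg s ''G'' = Kp"
  shows "ht s pre_powers ((3 * m + 4) * 40 + 40) (\<lambda>u. reg u ''T'' = 3 * m + 4 \<and> reg u ''E'' = 2 ^ (3 * m + 4) \<and>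
    reg u ''H'' = 2 ^ (3 * m + 4) * Kp \<and> (\<forall>t<3 * m + 4. arr u ''K'' t = 2 ^ t * Kp))"
proof -
  define T where "T = 3 * m + 4"
  let ?i = "''T'' ::= Plus (Plus (Reg ''m'') (Plus (Reg ''m'') (Reg ''m''))) (Const 4) ;; ''E'' ::= Const 1 ;; ''H'' ::= Reg ''G''"
  let ?I = "\<lambda>i (u :: state). reg u ''E'' = 2 ^ i \<and> reg u ''H'' = 2 ^ i * Kp \<and> (\<forall>t<i. arr u ''K'' t = 2 ^ t * Kp)"
  have sT: "reg (run ?i s) ''T'' = T" using m by (simp add: T_def)
  show ?thesis unfolding pre_powers_def T_def[symmetric]
  proof (rule ht_seq_run)
    show "ht (run ?i s) (For ''i'' ''T'' powers_body) (T * 40 + 10) (\<lambda>u. reg u ''T'' = T \<and> reg u ''E'' = 2 ^ T \<and>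
      reg u ''H'' = 2 ^ T * Kp \<and> (\<forall>t<T. arr u ''K'' t = 2 ^ t * Kp))"
    proof (rule ht_for[where n = T and I = ?I and T = 30])
      fix k u assume uk: "reg u ''i'' = k" and I: "?I k u"
      show "ht u powers_body 30 (loop_post ''i'' k ?I)"
        by (rule ht_run) (use uk I in \<open>auto simp: less_Suc_eq\<close>)
    next
      fix u assume ag: "loop_frame ''i'' powers_body (run ?i s) u" and I: "?I T u"
      show "reg u ''T'' = T \<and> reg u ''E'' = 2 ^ T \<and> reg u ''H'' = 2 ^ T * Kp \<and> (\<forall>t<T. arr u ''K'' t = 2 ^ t * Kp)"
        using agree_reg[OF ag] sT I by simp
    qed (use sT G in simp_all)
  qed simp_all
qed

definition pre :: com where
  "pre = pre_size ;; pre_cells ;; pre_accuracy ;; pre_range ;; pre_round ;; pre_powers"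

lemma ht_pre:
  assumes m: "0 < m" "reg s ''m'' = m" and n: "reg s ''n'' = n" and N: "N = m * n" "0 < N"
    and p: "reg s ''p'' = p" and q: "reg s ''q'' = q" and r: "q \<le> r * p" "\<And>k. k < r \<Longrightarrow> k * p < q"
    and w: "\<And>a. a < N \<Longrightarrow> arr s ''w'' (cell_index m n a) = v a"
  defines "K \<equiv> 2 * N * (1 + r)"
  shows "ht s pre (600 * (N * (K + 1))) (\<lambda>u. menv m N (K + 1) (arr u ''S'') v (cell_index m n) (\<Sum>a<N. v a) u \<and>
    (\<exists>h<N. (\<forall>a<N. v a \<le> v h) \<and> (\<forall>a<N. rounded K ((\<Sum>a<N. v a) - v h) (v a) (arr u ''S'' a))))" (is "ht _ _ _ ?Q")
proof -
  have n0: "0 < n" using N by auto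
  \<comment> \<open>Rounding contributes the leading term \<open>60 * N * K\<close>; the other terms
    are linear in \<open>n\<close>, \<open>m\<close>, \<open>r\<close> or \<open>N\<close>, each at
    most \<open>N * K\<close>.\<close>
  have cost: "n * 20 + 20 + (N * 100 + 30 + (r * 20 + 20 + ((1 + r) * 20 + 30 + (N * (K * 60 + 90) + 30 + ((3 * m + 4) * 40 + 40)))))
     \<le> 600 * (N * (K + 1))"
  proof -
    have "n \<le> N" "m \<le> N" using N m n0 by simp_all
    moreover have "r \<le> N * K"
    proof -
      have "r \<le> K" unfolding K_def using N(2) by (cases N) auto
      also have "\<dots> \<le> N * K" using N(2) by simp
      finally show ?thesis .
    qed
    moreover have "N \<le> N * K" using N(2) by (simp add: K_def)
    moreover define NK where "NK = N * K"
    moreover have "600 * (N * (K + 1)) = 600 * NK + 600 * N" "N * (K * 60 + 90) = 60 * NK + 90 * N"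
      "(1 + r) * 20 = 20 + 20 * r" "(3 * m + 4) * 40 = 120 * m + 160"
      by (simp_all add: NK_def algebra_simps)
    ultimately show ?thesis using N(2) by linarith
  qed
  show ?thesis unfolding pre_def
  proof (rule ht_seq[OF ht_pre_size[OF m(2) n] _ cost], goal_cases)
    case (1 s1)
    have s1: "reg s1 ''m'' = m" "reg s1 ''n'' = n" "reg s1 ''N'' = N" "reg s1 ''p'' = p" "reg s1 ''q'' = q" "arr s1 = arr s"
      using agree_reg[OF 1(2)] agree_arr[OF 1(2)] m n p q 1(1) N by (simp_all add: fun_eq_iff)
    show ?case
    proof (rule ht_seq[OF ht_pre_cells[OF m(1) s1(1,2,3) N(2) w[folded s1(6)]] _ order_refl], goal_cases)
      case (2 s2)
      then obtain h where h: "h < N" "reg s2 ''B'' = v h" "\<forall>i<N. v i \<le> v h" and W: "reg s2 ''W'' = (\<Sum>i<N. v i)"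
        and P: "\<And>i. i < N \<Longrightarrow> arr s2 ''P'' i = cell_index m n i" and R: "\<And>i. i < N \<Longrightarrow> arr s2 ''R'' i = i mod m"
        and v: "\<And>i. i < N \<Longrightarrow> arr s2 ''v'' i = v i"
        by blast
      have s2: "reg s2 ''m'' = m" "reg s2 ''N'' = N" "reg s2 ''p'' = p" "reg s2 ''q'' = q"
        using agree_reg[OF 2(2)] s1 by simp_all
      show ?case
      proof (rule ht_seq[OF ht_pre_accuracy[OF s2(3,4) r] _ order_refl], goal_cases)
        case (2 s3)
        have s3: "reg s3 ''m'' = m" "reg s3 ''N'' = N" "reg s3 ''B'' = v h" "reg s3 ''W'' = (\<Sum>i<N. v i)" "arr s3 = arr s2"
          using agree_reg[OF 2(2)] agree_arr[OF 2(2)] s2 h W by (simp_all add: fun_eq_iff)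
        show ?case
        proof (rule ht_seq[OF ht_pre_range[OF s3(2) 2(1)] _ order_refl], goal_cases)
          case (1 s4)
          have s4: "reg s4 ''G'' = K + 1" "reg s4 ''m'' = m" "reg s4 ''N'' = N" "reg s4 ''B'' = v h" "reg s4 ''W'' = (\<Sum>i<N. v i)" "arr s4 = arr s2"
            using 1(1) agree_reg[OF 1(2)] agree_arr[OF 1(2)] s3 by (simp_all add: fun_eq_iff K_def)
          have v4: "\<And>l. l < N \<Longrightarrow> arr s4 ''v'' l = v l" using v s4 by simp
          show ?case
          proof (rule ht_seq[OF ht_pre_round[OF s4(5,4,1,3) v4] _ order_refl], goal_cases)
            case (2 s5)
            note S = 2(1)
            have s5: "reg s5 ''G'' = K + 1" "reg s5 ''m'' = m" "reg s5 ''N'' = N" "reg s5 ''W'' = (\<Sum>i<N. v i)"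
              "arr s5 ''P'' = arr s2 ''P''" "arr s5 ''R'' = arr s2 ''R''" "arr s5 ''v'' = arr s2 ''v''"
              using agree_reg[OF 2(2)] agree_arr[OF 2(2)] s4 by simp_all
            show ?case
            proof (rule ht_sub[OF ht_pre_powers[OF s5(2,1)] _ order_refl], goal_cases)
              case (1 u)
              have u: "reg u ''G'' = K + 1" "reg u ''m'' = m" "reg u ''N'' = N" "reg u ''W'' = (\<Sum>i<N. v i)"
                "arr u ''P'' = arr s2 ''P''" "arr u ''R'' = arr s2 ''R''" "arr u ''v'' = arr s2 ''v''" "arr u ''S'' = arr s5 ''S''"
                using agree_reg[OF 1(2)] agree_arr[OF 1(2)] s5 by simp_all
              have "menv m N (K + 1) (arr u ''S'') v (cell_index m n) (\<Sum>a<N. v a) u"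
                unfolding menv_def senv_def using 1(1) u P R v by auto
              then show ?case using h S u(8) by auto
            qed
          qed simp
        qed
      qed simp
    qed simp
  qed
qed

section \<open>The approximation scheme\<close>

definition alg :: com where "alg = pre ;; layer0 ;; layers ;; recon"

text \<open>With \<open>x = N * (1 + r)\<close> the target is \<open>P = x * m * N * 8 ^ m\<close>.
  Tabulation is the critical term: \<open>m \<le> N\<close> and \<open>N \<le> x\<close> give
  \<open>m * m \<le> m * x\<close>, and \<open>K + 1 \<le> 3 * x\<close>, so a row costs a multiple
  of \<open>m * x\<close>. In the reconstruction one factor \<open>m\<close> is absorbed by
  \<open>8 ^ m\<close>. The four coefficients sum to \<open>104800\<close>.\<close>

lemma alg_cost:
  assumes m: "0 < m" and n: "0 < n" and N_def: "N = m * n" and K_def: "K = 2 * N * (1 + r)" and E_def: "E = 2 ^ (3 * m + 4)"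
  defines "T1 \<equiv> 600 * (N * (K + 1))" and "T2 \<equiv> E * (1000 * m + 40 * (K + 1) + 50) + 20"
    and "T3 \<equiv> N * (E * (4000 * (m * m) + 68 * (K + 1) + 60) + 40) + 20"
    and "T4 \<equiv> (K + 1) * (N * (4000 * (m * m) + 110) + 120) + 20"
  shows "T1 + (T2 + (T3 + T4)) \<le> 120000 * ((1 + r) * (m * (m * n)\<^sup>2 * 8 ^ m))"
proof -
  have N0: "0 < N" using m n by (simp add: N_def)
  define e :: nat where "e = 8 ^ m"
  define x where "x = N * (1 + r)"
  define P where "P = x * (m * N * e)"
  have Ee: "E = 16 * e" by (simp add: E_def e_def power_add power_mult)
  have e1: "m \<le> e" "1 \<le> e"
  proof -
    have "m < 2 ^ m" by simp
    also have "(2 :: nat) ^ m \<le> 8 ^ m" by (rule power_mono) auto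
    finally show "m \<le> e" by (simp add: e_def)
  qed (simp add: e_def)
  have mN: "m \<le> N" using n by (simp add: N_def)
  have x1: "N \<le> x" "1 \<le> x" using N0 by (auto simp: x_def)
  have K: "K + 1 \<le> 3 * x" using x1(2) by (simp add: K_def x_def)
  have N1: "1 \<le> N" "1 \<le> m" using N0 m by simp_all
  have xP: "x * N \<le> P" and x0P: "x \<le> P" and EP: "e * x \<le> P" and xmm: "x * (N * (m * m)) \<le> P"
  proof -
    have 1: "N * 1 \<le> N * (m * e)" using N1 e1 by (intro mult_le_mono2) simp
    then show "x * N \<le> P" unfolding P_def by (intro mult_le_mono2) (simp add: algebra_simps)
    then show "x \<le> P" using N1 by (metis le_trans mult_le_mono2 nat_mult_1_right)
    have "e * 1 \<le> e * (m * N)" using N1 by (intro mult_le_mono2) simp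
    then have "x * e \<le> x * (m * N * e)" by (intro mult_le_mono2) (simp add: algebra_simps)
    then show "e * x \<le> P" by (simp add: P_def mult.commute)
    have "N * (m * m) \<le> N * (m * e)" using e1 by (intro mult_le_mono2) simp
    then show "x * (N * (m * m)) \<le> P" unfolding P_def by (intro mult_le_mono2) (simp add: algebra_simps)
  qed
  have P1: "1 \<le> P" using x1 x0P by simp
  have t1: "T1 \<le> 1800 * P"
  proof -
    have "N * (K + 1) \<le> N * (3 * x)" using K by (rule mult_le_mono2)
    then show ?thesis using xP by (simp add: T1_def algebra_simps)
  qed
  have t2: "T2 \<le> 20000 * P"
  proof -
    have "1000 * m + 40 * (K + 1) + 50 \<le> 1170 * x" using mN x1 mult_le_mono2[OF K, of 40] by linarith
    then have "E * (1000 * m + 40 * (K + 1) + 50) \<le> 16 * e * (1170 * x)" unfolding Ee by (rule mult_le_mono2)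
    also have "\<dots> = 18720 * (e * x)" by simp
    finally show ?thesis using EP P1 unfolding T2_def by linarith
  qed
  have t3: "T3 \<le> 70000 * P"
  proof -
    have a: "m * m \<le> m * x" using mN x1 by (intro mult_le_mono2) simp
    have b: "x \<le> m * x" using N1 by simp
    have "4000 * (m * m) + 68 * (K + 1) + 60 \<le> 4300 * (m * x)" using a b mult_le_mono2[OF K, of 68] x1 by linarith
    then have "E * (4000 * (m * m) + 68 * (K + 1) + 60) \<le> 16 * e * (4300 * (m * x))" unfolding Ee by (rule mult_le_mono2)
    also have "\<dots> = 68800 * (e * (m * x))" by simp
    finally have "N * (E * (4000 * (m * m) + 68 * (K + 1) + 60)) \<le> N * (68800 * (e * (m * x)))" by (rule mult_le_mono2)
    also have "\<dots> = 68800 * P" by (simp add: P_def algebra_simps)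
    finally have "N * (E * (4000 * (m * m) + 68 * (K + 1) + 60)) \<le> 68800 * P" .
    moreover have "T3 = N * (E * (4000 * (m * m) + 68 * (K + 1) + 60)) + 40 * N + 20" by (simp only: T3_def add_mult_distrib2 mult.commute)
    ultimately show ?thesis using x1 x0P P1 by linarith
  qed
  have t4: "T4 \<le> 13000 * P"
  proof -
    have "N * 1 \<le> N * (m * m)" using N1 by (intro mult_le_mono2) simp
    moreover have "N * (4000 * (m * m) + 110) = 4000 * (N * (m * m)) + 110 * N" by (simp add: algebra_simps)
    ultimately have "N * (4000 * (m * m) + 110) + 120 \<le> 4230 * (N * (m * m))" using N1 by linarith
    then have "(K + 1) * (N * (4000 * (m * m) + 110) + 120) \<le> 3 * x * (4230 * (N * (m * m)))" using K by (rule mult_le_mono[rotated])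
    also have "\<dots> = 12690 * (x * (N * (m * m)))" by simp
    finally show ?thesis using xmm P1 unfolding T4_def by linarith
  qed
  have "P = (1 + r) * (m * (m * n)\<^sup>2 * 8 ^ m)"
    by (simp add: P_def x_def e_def N_def power2_eq_square algebra_simps)
  then show ?thesis using t1 t2 t3 t4 by linarith
qed

lemma ht_alg:
  assumes inst: "grid_instance m n w" and r: "q \<le> r * p" "\<And>k. k < r \<Longrightarrow> k * p < q" "0 < r"
  shows "ht (scheme_input p q m n w) alg (120000 * ((1 + r) * (m * (m * n)\<^sup>2 * 8 ^ m))) (\<lambda>u.
    connected_bipartition m n (output_set m n u) \<and>
    r * OPT m n w \<le> (1 + r) * bipartition_value m n w (output_set m n u))"
    (is "ht ?s _ _ ?Q")
proof -
  define N where "N = m * n"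
  define K where "K = 2 * N * (1 + r)"
  define E :: nat where "E = 2 ^ (3 * m + 4)"
  define v where "v a = w (node m a)" for a
  let ?menv = "\<lambda>ws. menv m N (K + 1) ws v (cell_index m n) (\<Sum>a<N. v a)"
  have m: "0 < m" and n: "0 < n" and N2: "2 \<le> N" using inst by (auto simp: grid_instance_def N_def)
  have N0: "0 < N" using N2 by simp
  have s: "reg ?s ''m'' = m" "reg ?s ''n'' = n" "reg ?s ''p'' = p" "reg ?s ''q'' = q"
    by (simp_all add: scheme_input_def grid_input_def Let_def)
  have sv: "arr ?s ''w'' (cell_index m n a) = v a" if "a < N" for a
    using cell_index_div_mod[of a m n] cell_index_less[of a m n] that
    by (simp add: scheme_input_def grid_input_def Let_def v_def node_def N_def)
  have vpos: "0 < v a" if "a < N" for a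
    using node_image[OF m, of n] that inst unfolding v_def grid_instance_def N_def by blast
  have pre: "ht ?s pre (600 * (N * (K + 1))) (\<lambda>u. ?menv (arr u ''S'') u \<and>
    (\<exists>h<N. (\<forall>a<N. v a \<le> v h) \<and> (\<forall>a<N. rounded K ((\<Sum>a<N. v a) - v h) (v a) (arr u ''S'' a))))"
    unfolding K_def by (rule ht_pre[OF m s(1,2) N_def N0 s(3,4) r(1,2) sv])
  show ?thesis unfolding alg_def
  proof (rule ht_seq[OF pre _ alg_cost[OF m n N_def K_def E_def]], goal_cases)
    case (1 s1)
    then obtain ws h where env: "?menv ws s1" and h: "h < N" "\<And>a. a < N \<Longrightarrow> v a \<le> v h"
      and ws: "\<And>a. a < N \<Longrightarrow> rounded K ((\<Sum>a<N. v a) - v h) (v a) (ws a)" by blast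
    show ?case
    proof (rule ht_seq[OF ht_layer0[OF m env, folded E_def] _ order_refl], goal_cases)
      case (2 s2)
      have env2: "?menv ws s2" by (rule menv_agree[OF 2(2) env]) simp_all
      show ?case
      proof (rule ht_seq[OF ht_layers[OF m env2 _ E_def conjunct2[OF 2(1)] conjunct1[OF 2(1)]] _ order_refl], goal_cases)
        case (2 s3)
        have env3: "?menv ws s3" by (rule menv_agree[OF 2(2) env2]) simp_all
        have pos: "inj_on (cell_index m n) {..<N}" "\<And>a. a < N \<Longrightarrow> cell_index m n a < N"
          unfolding N_def by (rule inj_cell_index, rule cell_index_less)
        show ?case
        proof (rule ht_sub[OF ht_recon[OF m env3 _ E_def conjunct2[OF 2(1)] conjunct1[OF 2(1)] pos] _ order_refl], goal_cases)
          case (3 u)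
          then obtain V where "best_found m N ws v (cell_index m n) (K + 1) V (arr u ''U'')" by blast
          then obtain f where f: "good m N f" "\<forall>a<N. arr u ''U'' (cell_index m n a) = of_bool (f a)"
            "r * OPT m n w \<le> (1 + r) * cval N v f"
            using best_found_approx[OF m n N_def N2 v_def vpos h r(3) K_def ws] by blast
          have "output_set m n u = {x \<in> node m ` {..<N}. arr u ''U'' ((fst x - 1) * n + (snd x - 1)) \<noteq> 0}"
            unfolding output_set_def node_image[OF m, of n, folded N_def] by auto
          also have "\<dots> = cells_of m N f" using f(2) by (auto simp: cells_of_def node_def cell_index_def)
          finally have out: "output_set m n u = cells_of m N f" .
          show ?case unfolding out
            using f bipartition_value_cells[OF m N_def, of w f, folded v_def] connected_bipartition_iff_accept[OF m n N_def, of f]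
            by (simp add: good_def)
        qed simp_all
      qed simp
    qed simp
  qed
qed

section \<open>From integer accuracy to the final bounds\<close>

lemma ex_accuracy:
  fixes p q :: nat
  assumes "0 < p" "0 < q"
  shows "\<exists>r>0. q \<le> r * p \<and> (\<forall>k<r. k * p < q) \<and> real r < 1 + real q / real p"
proof -
  define r where "r = (LEAST r. q \<le> r * p)"
  have ex: "q \<le> q * p" using assms by simp
  have r1: "q \<le> r * p" unfolding r_def using ex by (rule LeastI)
  have r2: "\<forall>k<r. k * p < q" unfolding r_def using not_less_Least not_le by blast
  have r0: "0 < r" using r1 assms by (cases r) auto
  then have "(r - 1) * p < q" using r2 by simp
  then have "real ((r - 1) * p) < real q" by (simp only: of_nat_less_iff)
  then have "(real r - 1) * real p < real q" using r0 by (simp add: of_nat_diff)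
  then have "real r - 1 < real q / real p" using assms by (simp add: pos_less_divide_eq)
  then show ?thesis using r0 r1 r2 by (intro exI[of _ r]) auto
qed

text \<open>Passing from \<open>\<epsilon>\<close> to \<open>1 / r\<close> only sharpens the
  guarantee, as \<open>1 / r \<le> \<epsilon>\<close>. It costs at most a factor \<open>2\<close> in
  time, as \<open>r < 1 + 1 / \<epsilon>\<close>; this doubles the constant.\<close>

lemma alg_computes_approx:
  assumes inst: "grid_instance m n w" and p: "0 < p" and q: "0 < q"
  defines "\<epsilon> \<equiv> real p / real q"
  shows "computes_approx alg (scheme_input p q m n w) m n w \<epsilon>
    (240000 * ((1 + 1 / \<epsilon>) * real m * real (m * n) ^ 2 * 8 ^ m))"
proof -
  obtain r where r: "0 < r" "q \<le> r * p" "\<And>k. k < r \<Longrightarrow> k * p < q" "real r < 1 + real q / real p"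
    using ex_accuracy[OF p q] by blast
  obtain t s' where ex: "exec alg (scheme_input p q m n w) t s'" and t: "t \<le> 120000 * ((1 + r) * (m * (m * n)\<^sup>2 * 8 ^ m))"
    and cb: "connected_bipartition m n (output_set m n s')"
    and ap: "r * OPT m n w \<le> (1 + r) * bipartition_value m n w (output_set m n s')"
    using ht_alg[OF inst r(2,3,1)] unfolding ht_def by blast
  define X where "X = real m * real (m * n) ^ 2 * 8 ^ m"
  have X0: "0 \<le> X" by (simp add: X_def)
  have e: "1 / \<epsilon> = real q / real p" by (simp add: \<epsilon>_def)
  have e0: "0 < \<epsilon>" using p q by (simp add: \<epsilon>_def)
  have "real t \<le> real (120000 * ((1 + r) * (m * (m * n)\<^sup>2 * 8 ^ m)))" using t by (simp only: of_nat_le_iff)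
  also have "\<dots> = 120000 * ((1 + real r) * X)" by (simp add: X_def algebra_simps)
  also have "\<dots> \<le> 120000 * ((2 * (1 + 1 / \<epsilon>)) * X)"
  proof -
    have "0 \<le> real q / real p" by simp
    then have "1 + real r \<le> 2 + 2 * (1 / \<epsilon>)" using r(4) unfolding e by linarith
    then have "1 + real r \<le> 2 * (1 + 1 / \<epsilon>)" by simp
    then show ?thesis using X0 by (intro mult_left_mono mult_right_mono) auto
  qed
  finally have time: "real t \<le> 240000 * ((1 + 1 / \<epsilon>) * real m * real (m * n) ^ 2 * 8 ^ m)" by (simp add: X_def algebra_simps)
  define b where "b = bipartition_value m n w (output_set m n s')"
  have "real (r * OPT m n w) \<le> real ((1 + r) * b)" using ap unfolding b_def by (simp only: of_nat_le_iff)
  then have "real r * real (OPT m n w) \<le> (1 + real r) * real b" by (simp add: algebra_simps)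
  then have "real (OPT m n w) \<le> (1 + 1 / real r) * real b" using r(1) by (simp add: field_simps)
  also have "\<dots> \<le> (1 + \<epsilon>) * real b"
  proof -
    have "real q \<le> real (r * p)" using r(2) by (simp only: of_nat_le_iff)
    then have "1 / real r \<le> \<epsilon>" using r(1) p q by (simp add: \<epsilon>_def field_simps)
    then show ?thesis by (intro mult_right_mono) auto
  qed
  finally show ?thesis unfolding computes_approx_def using ex time cb b_def by blast
qed

text \<open>A positive weight occupies at least one bit.\<close>

lemma instance_size_ge: "grid_instance m n w \<Longrightarrow> m * n \<le> instance_size m n w"
proof -
  assume inst: "grid_instance m n w"
  have "card (grid_nodes m n) = (\<Sum>v\<in>grid_nodes m n. 1)" by simp
  also have "\<dots> \<le> (\<Sum>v\<in>grid_nodes m n. floorlog 2 (w v))"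
  proof (rule sum_mono)
    fix v assume "v \<in> grid_nodes m n"
    then have "0 < w v" using inst by (simp add: grid_instance_def)
    then show "1 \<le> floorlog 2 (w v)" by (simp add: floorlog_def)
  qed
  finally show ?thesis by (simp add: instance_size_def grid_nodes_def)
qed

text \<open>For fixed \<open>m\<close> the factor \<open>m * 8 ^ m\<close> goes into the
  coefficient. What remains is \<open>1 + 1 / \<epsilon>\<close> times a square, and each of these
  three factors is at most the size plus \<open>1 / \<epsilon>\<close>; hence the exponent
  \<open>3\<close>.\<close>

lemma fptas_alg: "1 \<le> m \<Longrightarrow> fptas m alg"
  unfolding fptas_def Let_def
proof (intro exI allI impI)
  fix n w and p q :: nat assume inst: "grid_instance m n w" and p: "0 < p" and q: "0 < q"
  define \<epsilon> where "\<epsilon> = real p / real q"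
  define S where "S = real (instance_size m n w)"
  have e0: "0 < 1 / \<epsilon>" using p q by (simp add: \<epsilon>_def)
  have N: "real (m * n) \<le> S" "1 \<le> real (m * n)"
    using instance_size_ge[OF inst] inst unfolding S_def grid_instance_def by (simp_all only: of_nat_le_iff) linarith
  have "(1 + 1 / \<epsilon>) * real (m * n) ^ 2 \<le> (S + 1 / \<epsilon>) * (S + 1 / \<epsilon>) ^ 2"
  proof (intro mult_mono power_mono)
    show "1 + 1 / \<epsilon> \<le> S + 1 / \<epsilon>" "real (m * n) \<le> S + 1 / \<epsilon>" "0 \<le> S + 1 / \<epsilon>" using N e0 by linarith+
  qed simp_all
  then have le: "(1 + 1 / \<epsilon>) * real (m * n) ^ 2 \<le> (S + 1 / \<epsilon>) ^ 3" by (simp add: power2_eq_square power3_eq_cube)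
  have "240000 * ((1 + 1 / \<epsilon>) * real m * real (m * n) ^ 2 * 8 ^ m) = (240000 * real m * 8 ^ m) * ((1 + 1 / \<epsilon>) * real (m * n) ^ 2)"
    by (simp only: ac_simps)
  also have "\<dots> \<le> (240000 * real m * 8 ^ m) * (S + 1 / \<epsilon>) ^ 3" using le by (intro mult_left_mono) auto
  finally show "computes_approx alg (scheme_input p q m n w) m n w (real p / real q)
      ((240000 * real m * 8 ^ m) * (real (instance_size m n w) + 1 / (real p / real q)) ^ 3)"
    using alg_computes_approx[OF inst p q] unfolding computes_approx_def \<epsilon>_def[symmetric] S_def[symmetric]
    by (meson order_trans)
qed

text \<open>A real \<open>\<epsilon>\<close> cannot be an input, but the program may depend on it:
  the integer \<open>k\<close>, which is \<open>1 / \<epsilon>\<close> rounded up, is compiled in as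
  a constant and the scheme is run with accuracy \<open>1 / k\<close>.\<close>

lemma fixed_accuracy:
  assumes \<epsilon>: "0 < \<epsilon>"
  shows "\<exists>P. \<forall>m n w. grid_instance m n w \<longrightarrow>
      computes_approx P (grid_input m n w) m n w \<epsilon>
        (500000 * ((1 + 1 / \<epsilon>) * real m * real (m * n) ^ 2 * 8 ^ m))"
proof (intro exI allI impI)
  define k where "k = nat \<lceil>1 / \<epsilon>\<rceil>"
  have k: "0 < k" "1 / \<epsilon> \<le> real k" "real k < 1 + 1 / \<epsilon>"
  proof -
    have "0 < 1 / \<epsilon>" using \<epsilon> by simp
    then show "0 < k" "1 / \<epsilon> \<le> real k" "real k < 1 + 1 / \<epsilon>" unfolding k_def by linarith+
  qed
  fix m n w assume inst: "grid_instance m n w"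
  let ?P = "''p'' ::= Const 1 ;; ''q'' ::= Const k ;; alg"
  define X where "X = real m * real (m * n) ^ 2 * 8 ^ m"
  obtain t s' where ex: "exec alg (scheme_input 1 k m n w) t s'"
    and t: "real t \<le> 240000 * ((1 + 1 / (real 1 / real k)) * real m * real (m * n) ^ 2 * 8 ^ m)"
    and cb: "connected_bipartition m n (output_set m n s')"
    and ap: "real (OPT m n w) \<le> (1 + real 1 / real k) * real (bipartition_value m n w (output_set m n s'))"
    using alg_computes_approx[OF inst _ k(1), of 1] unfolding computes_approx_def by auto
  define s0 where "s0 = grid_input m n w"
  define s1 where "s1 = s0\<lparr>reg := (reg s0)(''p'' := aval (Const 1) s0)\<rparr>"
  define s2 where "s2 = s1\<lparr>reg := (reg s1)(''q'' := aval (Const k) s1)\<rparr>"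
  have init: "scheme_input 1 k m n w = s2"
    by (simp add: scheme_input_def Let_def s0_def s1_def s2_def)
  have "exec (''p'' ::= Const 1) s0 (1 + acost (Const 1)) s1" "exec (''q'' ::= Const k) s1 (1 + acost (Const k)) s2"
    unfolding s1_def s2_def by (rule exec.Assign)+
  then have "exec ?P (grid_input m n w) ((1 + acost (Const 1)) + ((1 + acost (Const k)) + t)) s'"
    unfolding s0_def[symmetric] by (intro exec.Seq) (use ex in \<open>simp_all only: init\<close>)
  moreover have "real ((1 + acost (Const 1)) + ((1 + acost (Const k)) + t)) \<le> 500000 * ((1 + 1 / \<epsilon>) * real m * real (m * n) ^ 2 * 8 ^ m)"
  proof -
    have "1 \<le> X"
    proof -
      have "1 \<le> m" "1 \<le> m * n" using inst by (auto simp: grid_instance_def)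
      then have "real 1 \<le> real m" "real 1 \<le> real (m * n)" by (simp_all only: of_nat_le_iff)
      then have "1 \<le> real m" "1 \<le> real (m * n)" by simp_all
      then have "1 * 1 * 1 \<le> X" unfolding X_def by (intro mult_mono one_le_power) auto
      then show ?thesis by simp
    qed
    then have 1: "1 * 1 \<le> (1 + 1 / \<epsilon>) * X" using \<epsilon> by (intro mult_mono) auto
    have "real t \<le> 240000 * ((1 + real k) * X)" using t by (simp add: X_def mult.assoc)
    also have "\<dots> \<le> 240000 * ((2 * (1 + 1 / \<epsilon>)) * X)"
    proof -
      have "0 < 1 / \<epsilon>" using \<epsilon> by simp
      then have "1 + real k \<le> 2 + 2 * (1 / \<epsilon>)" using k(3) by linarith
      then have "1 + real k \<le> 2 * (1 + 1 / \<epsilon>)" by simp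
      then show ?thesis using \<open>1 \<le> X\<close> by (intro mult_left_mono mult_right_mono) auto
    qed
    finally have "real t \<le> 480000 * ((1 + 1 / \<epsilon>) * X)" by (simp add: algebra_simps)
    \<comment> \<open>The two initial assignments take two steps each. They fit into the slack
      because the bound without its constant is at least \<open>1\<close>.\<close>
    then have "real t + 4 \<le> 500000 * ((1 + 1 / \<epsilon>) * X)" using 1 by linarith
    then show ?thesis by (simp add: X_def mult.assoc)
  qed
  moreover have "real (OPT m n w) \<le> (1 + \<epsilon>) * real (bipartition_value m n w (output_set m n s'))"
  proof -
    have "1 / real k \<le> \<epsilon>" using k \<epsilon> by (simp add: field_simps)
    then have "(1 + real 1 / real k) * real (bipartition_value m n w (output_set m n s')) \<le>
      (1 + \<epsilon>) * real (bipartition_value m n w (output_set m n s'))" by (intro mult_right_mono) auto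
    then show ?thesis using ap by linarith
  qed
  ultimately show "computes_approx ?P (grid_input m n w) m n w \<epsilon>
        (500000 * ((1 + 1 / \<epsilon>) * real m * real (m * n) ^ 2 * 8 ^ m))"
    unfolding computes_approx_def using cb by blast
qed

theorem theorem6:
  shows "\<exists>(C :: real) > 0. \<exists>A :: com.
    (\<forall>\<epsilon> :: real. \<epsilon> > 0 \<longrightarrow> (\<exists>P :: com. \<forall>m n w. grid_instance m n w \<longrightarrow>
      computes_approx P (grid_input m n w) m n w \<epsilon>
        (C * ((1 + 1 / \<epsilon>) * real m * real (m * n) ^ 2 * 8 ^ m)))) \<and>
    (\<forall>p q :: nat. p > 0 \<longrightarrow> q > 0 \<longrightarrow> (\<forall>m n w. grid_instance m n w \<longrightarrow>
      (let \<epsilon> = real p / real q in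
       computes_approx A (scheme_input p q m n w) m n w \<epsilon>
         (C * ((1 + 1 / \<epsilon>) * real m * real (m * n) ^ 2 * 8 ^ m))))) \<and>
    (\<forall>m \<ge> 1. fptas m A)"
proof -
  have "computes_approx alg (scheme_input p q m n w) m n w (real p / real q)
      (500000 * ((1 + 1 / (real p / real q)) * real m * real (m * n) ^ 2 * 8 ^ m))"
    if "p > 0" "q > 0" "grid_instance m n w" for p q m n w
  proof -
    \<comment> \<open>The constant is raised to that of the fixed-accuracy programs, so that a
      single \<open>C\<close> serves both claims.\<close>
    have "240000 * ((1 + 1 / (real p / real q)) * real m * real (m * n) ^ 2 * 8 ^ m) \<le>
      500000 * ((1 + 1 / (real p / real q)) * real m * real (m * n) ^ 2 * 8 ^ m)"
      by (intro mult_right_mono) auto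
    then show ?thesis using alg_computes_approx[OF that(3,1,2)] unfolding computes_approx_def by (meson order_trans)
  qed
  then show ?thesis using fixed_accuracy fptas_alg
    by (intro exI[of _ "500000 :: real"] conjI exI[of _ alg]) (simp_all add: Let_def)
qed

end
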